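(* Let $\mathbf R$ be a commutative ring with unity $1$ and zero $0$; let $x=(x_1,\ldots,x_n)$, $y=(y_1,\ldots,y_n)$, $f(x)=(f_1(x),\ldots,f_s(x))\in\mathbf R[x]^s$; let $\partial:\widehat f_x\mapsto f(x)$, $\widehat f_y\mapsto f(y)$. If the ring $\mathbf H_0(x,\widehat f_x)\simeq\mathbf R[x]/(f(x))_x$ is a finitely generated module over $\mathbf R$, then there exists $e(x_*,\widehat f^x_* )\in\mathbf Z(x_*,\widehat f^x_* )$ such that $$\mathop{\top}\limits_{y}\mathop{\top}\limits_{\widehat f_y}\det\left\|\begin{matrix}\nabla f(x,y)\\ \widehat f_x-\widehat f_y\end{matrix}\right\|e(y_*,\widehat f^y_* )\stackrel{\partial}{\simeq} x^0(\widehat f_x)^0=1.$$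
   Context: $(f(x))_x$ is the ideal of $\mathbf R[x]$ generated by $f_1(x),\ldots,f_s(x)$. Variables. $\widehat f_x,\widehat f_y$ are collections of $s$, and $\widehat u$ a collection of $n$, Grassmann (anticommuting, square-zero) variables; variables from different collections also anticommute. $\Lambda_A(\widehat v)$ is the Grassmann algebra in $\widehat v$ over a commutative ring $A$; $|w|\in\mathbb Z/2$ is the parity of a homogeneous element or linear map. Zeroth powers $x^0$, $(\widehat f_x)^0$ denote $1$. Complexes. $\mathbf C(x,\widehat f_x)=\Lambda_{\mathbf R[x]}(\widehat f_x)$ is the Koszul complex of $f$, with differential the odd $\mathbf R[x]$-linear derivation $\partial(ab)=\partial(a)b+(-1)^{|a|}a\,\partial(b)$ with $\partial(\widehat f_{i,x})=f_i(x)$; $\mathbf H_0(x,\widehat f_x)$ is its homology in degree $0$ in $\widehat f_x$. The dual complex is $\mathbf C(x_*,\widehat f^x_* )=\mathrm{Hom}_{\mathbf R}(\mathbf C(x,\widehat f_x),\mathbf R)$ with $\partial[L]=-(-1)^{|L|}L\circ\partial$ for homogeneous $L$, and $\mathbf Z(x_*,\widehat f^x_* )=\{L\in\mathbf C(x_*,\widehat f^x_* ):\partial[L]=0\}$ is its module of cycles. $e(y_*,\widehat f^y_* )$ is $e(x_*,\widehat f^x_* )$ with $x$ renamed to $y$. For elements $c',c''\in\mathbf C(x,\widehat f_x)$, $c'\stackrel{\partial}{\simeq} c''$ means $c'-c''=\partial[c]$ for some $c\in\mathbf C(x,\widehat f_x)$. Difference quotients. $\nabla^kf_i(x,y)\in\mathbf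 R[x,y]$ ($k=1,\ldots,n$) are fixed polynomials with $\sum_{k=1}^n(x_k-y_k)\nabla^kf_i(x,y)=f_i(x)-f_i(y)$. Determinant. $D=\det\left\|\begin{matrix}\nabla f(x,y)\\ \widehat f_x-\widehat f_y\end{matrix}\right\|\in\Lambda_{\mathbf R[x,y]}(\widehat f_x,\widehat f_y)$ is the element not involving $\widehat u$ such that $\widehat u_1\widehat u_2\cdots\widehat u_n\,D$ is the component of top degree $n$ in $\widehat u$ of the ordered product $\prod_{i=1}^s\left(\sum_{k=1}^n\widehat u_k\nabla^kf_i(x,y)+\widehat f_{i,x}-\widehat f_{i,y}\right)$; it has parity $s-n$. Contraction. For a homogeneous functional $e\in\mathbf C(y_*,\widehat f^y_* )$, $\mathop{\top}\limits_y\mathop{\top}\limits_{\widehat f_y}D\,e=(-1)^{|D||e|}e(D)\in\mathbf C(x,\widehat f_x)$, where $e$ is extended linearly over $\mathbf R[x]$ and to the Grassmann parameters $\widehat f_x$ by $e(\theta w)=(-1)^{|e||\theta|}\theta\,e(w)$ for $\theta\in\Lambda_{\mathbf R[x]}(\widehat f_x)$, $w\in\Lambda_{\mathbf R[y]}(\widehat f_y)$; this is extended additively to inhomogeneous $e$. *)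

theory Defs
  imports "HOL-Library.Poly_Mapping" "HOL-Algebra.QuotRing"
begin

section \<open>Grassmann algebras\<close>

text \<open>
  An element of the Grassmann algebra on anticommuting variables of a linearly ordered type
  \<open>'g\<close> over \<open>'a\<close> is given by its coefficients: \<open>gcoeff a K\<close> is the coefficient of
  the product of the variables in the finite set \<open>K\<close>, taken in increasing order.
\<close>

typedef (overloaded) ('g, 'a::zero) grassmann =
  "{a :: 'g set \<Rightarrow> 'a. finite {K. a K \<noteq> 0} \<and> (\<forall>K. a K \<noteq> 0 \<longrightarrow> finite K)}"
  morphisms gcoeff Abs_grassmann
  by (rule exI[of _ "\<lambda>_. 0"]) simp

setup_lifting type_definition_grassmann

lemma grassmann_eqI: "(\<And>K. gcoeff a K = gcoeff b K) \<Longrightarrow> a = b"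
  by (simp add: gcoeff_inject[symmetric] ext)

lemma finite_gcoeff: "finite {K. gcoeff a K \<noteq> 0}"
  using gcoeff[of a] by simp

lemma gcoeff_nonzero_finite: "gcoeff a K \<noteq> 0 \<Longrightarrow> finite K"
  using gcoeff[of a] by simp

definition gsupp :: "('g, 'a::zero) grassmann \<Rightarrow> 'g set set"
  where "gsupp a = {K. gcoeff a K \<noteq> 0}"

lemma finite_gsupp [simp]: "finite (gsupp a)"
  by (simp add: gsupp_def finite_gcoeff)

lift_definition gmono :: "'a::zero \<Rightarrow> 'g set \<Rightarrow> ('g, 'a) grassmann"
  is "\<lambda>c K L. if L = K \<and> finite K then c else 0"
  by (auto intro: rev_finite_subset[of "{K}" for K] split: if_splits)

text \<open>
  \<open>gsign I J\<close> is the sign obtained when the increasing product over \<open>I\<close> followed by the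
  increasing product over \<open>J\<close> is sorted.
\<close>

definition gsign :: "'g::linorder set \<Rightarrow> 'g set \<Rightarrow> 'a::comm_ring_1"
  where "gsign I J = (- 1) ^ card {(i, j). i \<in> I \<and> j \<in> J \<and> j < i}"

instantiation grassmann :: (type, ab_group_add) ab_group_add
begin
lift_definition zero_grassmann :: "('a, 'b) grassmann" is "\<lambda>_. 0" by simp
lift_definition plus_grassmann :: "('a, 'b) grassmann \<Rightarrow> ('a, 'b) grassmann \<Rightarrow> ('a, 'b) grassmann"
  is "\<lambda>a b K. a K + b K"
proof goal_cases
  case (1 a b)
  have "{K. a K + b K \<noteq> 0} \<subseteq> {K. a K \<noteq> 0} \<union> {K. b K \<noteq> 0}" by auto
  then have "finite {K. a K + b K \<noteq> 0}" by (rule finite_subset) (use 1 in simp)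
  moreover have "finite K" if "a K + b K \<noteq> 0" for K
    using that 1 by (cases "a K = 0") auto
  ultimately show ?case by blast
qed
lift_definition uminus_grassmann :: "('a, 'b) grassmann \<Rightarrow> ('a, 'b) grassmann"
  is "\<lambda>a K. - a K" by simp
definition minus_grassmann :: "('a, 'b) grassmann \<Rightarrow> ('a, 'b) grassmann \<Rightarrow> ('a, 'b) grassmann"
  where "minus_grassmann a b = a + - b"
instance
  by standard (simp_all add: minus_grassmann_def, (transfer, simp add: algebra_simps)+)
end

lemma gcoeff_zero [simp]: "gcoeff 0 K = 0" by transfer simp
lemma gcoeff_add [simp]: "gcoeff (a + b) K = gcoeff a K + gcoeff b K" by transfer simp
lemma gcoeff_uminus [simp]: "gcoeff (- a) K = - gcoeff a K" by transfer simp
lemma gcoeff_diff [simp]: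
  "gcoeff (a - b) K = gcoeff a K - gcoeff (b :: ('g, 'a::ab_group_add) grassmann) K"
  unfolding minus_grassmann_def gcoeff_add gcoeff_uminus by simp
lemma gcoeff_sum [simp]: "gcoeff (\<Sum>i\<in>A. h i) K = (\<Sum>i\<in>A. gcoeff (h i) K)"
  by (induction A rule: infinite_finite_induct) auto
lemma gcoeff_gmono: "gcoeff (gmono c K) L = (if L = K \<and> finite K then c else 0)"
  by transfer simp

lemma gsign_empty [simp]: "gsign {} J = 1" "gsign I {} = 1"
  by (simp_all add: gsign_def)

lemma gsign_Un_left:
  assumes "finite I" "finite J" "finite L" "I \<inter> J = {}"
  shows "(gsign (I \<union> J) L :: 'a::comm_ring_1) = gsign I L * gsign J L"
proof -
  have fin: "finite {(i, j). i \<in> A \<and> j \<in> L \<and> j < i}" if "finite A" for A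
    by (rule finite_subset[of _ "A \<times> L"]) (use that assms in auto)
  have "{(i, j). i \<in> I \<union> J \<and> j \<in> L \<and> j < i} =
      {(i, j). i \<in> I \<and> j \<in> L \<and> j < i} \<union> {(i, j). i \<in> J \<and> j \<in> L \<and> j < i}" by auto
  moreover have "{(i, j). i \<in> I \<and> j \<in> L \<and> j < i} \<inter> {(i, j). i \<in> J \<and> j \<in> L \<and> j < i} = {}"
    using assms by auto
  ultimately show ?thesis
    by (simp add: gsign_def card_Un_disjoint fin assms power_add)
qed

lemma gsign_Un_right:
  assumes "finite I" "finite J" "finite L" "J \<inter> L = {}"
  shows "(gsign I (J \<union> L) :: 'a::comm_ring_1) = gsign I J * gsign I L"
proof -
  have fin: "finite {(i, j). i \<in> I \<and> j \<in> A \<and> j < i}" if "finite A" for A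
    by (rule finite_subset[of _ "I \<times> A"]) (use that assms in auto)
  have "{(i, j). i \<in> I \<and> j \<in> J \<union> L \<and> j < i} =
      {(i, j). i \<in> I \<and> j \<in> J \<and> j < i} \<union> {(i, j). i \<in> I \<and> j \<in> L \<and> j < i}" by auto
  moreover have "{(i, j). i \<in> I \<and> j \<in> J \<and> j < i} \<inter> {(i, j). i \<in> I \<and> j \<in> L \<and> j < i} = {}"
    using assms by auto
  ultimately show ?thesis
    by (simp add: gsign_def card_Un_disjoint fin assms power_add)
qed

instantiation grassmann :: (linorder, comm_ring_1) ring_1
begin

lift_definition one_grassmann :: "('a, 'b) grassmann" is "\<lambda>K. if K = {} then 1 else 0"
  by simp

lift_definition times_grassmann :: "('a, 'b) grassmann \<Rightarrow> ('a, 'b) grassmann \<Rightarrow> ('a, 'b) grassmann"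
  is "\<lambda>a b K. \<Sum>I\<in>Pow K. gsign I (K - I) * a I * b (K - I)"
proof goal_cases
  case (1 a b)
  let ?S = "{K. (\<Sum>I\<in>Pow K. gsign I (K - I) * a I * b (K - I)) \<noteq> 0}"
  have *: "\<exists>I J. K = I \<union> J \<and> a I \<noteq> 0 \<and> b J \<noteq> 0" if "K \<in> ?S" for K
  proof -
    from that obtain I where I: "I \<in> Pow K" "gsign I (K - I) * a I * b (K - I) \<noteq> 0"
      by (auto elim: sum.not_neutral_contains_not_neutral)
    then have "K = I \<union> (K - I)" "a I \<noteq> 0" "b (K - I) \<noteq> 0" by auto
    then show ?thesis by blast
  qed
  have "?S \<subseteq> (\<lambda>(I, J). I \<union> J) ` ({I. a I \<noteq> 0} \<times> {J. b J \<noteq> 0})"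
    using * by fast
  then have "finite ?S" by (rule finite_subset) (use 1 in auto)
  moreover have "finite K" if "K \<in> ?S" for K using *[OF that] 1 by auto
  ultimately show ?case by blast
qed

instance
proof
  fix a b c :: "('a, 'b) grassmann"
  show "a * b * c = a * (b * c)"
  proof (rule grassmann_eqI)
    fix K
    show "gcoeff (a * b * c) K = gcoeff (a * (b * c)) K"
    proof (cases "finite K")
      case True
      have "gcoeff (a * b * c) K = (\<Sum>M\<in>Pow K. \<Sum>I\<in>Pow M.
          gsign M (K - M) * (gsign I (M - I) * gcoeff a I * gcoeff b (M - I)) * gcoeff c (K - M))"
        by (simp add: times_grassmann.rep_eq sum_distrib_left sum_distrib_right)
      also have "\<dots> = (\<Sum>(M, I)\<in>Sigma (Pow K) Pow.
          gsign M (K - M) * (gsign I (M - I) * gcoeff a I * gcoeff b (M - I)) * gcoeff c (K - M))"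
        by (rule sum.Sigma) (use True in \<open>auto intro: finite_subset\<close>)
      also have "\<dots> = (\<Sum>(I, J)\<in>Sigma (Pow K) (\<lambda>I. Pow (K - I)).
          gsign I (K - I) * gcoeff a I * (gsign J (K - I - J) * gcoeff b J * gcoeff c (K - I - J)))"
      proof (rule sum.reindex_bij_witness[where i = "\<lambda>(I, J). (I \<union> J, I)" and j = "\<lambda>(M, I). (I, M - I)"];
          clarsimp)
        fix M I assume "M \<subseteq> K" "I \<subseteq> M"
        define J L where "J = M - I" and "L = K - M"
        have fin: "finite I" "finite J" "finite L"
          using True \<open>M \<subseteq> K\<close> \<open>I \<subseteq> M\<close> by (auto simp: J_def L_def intro: finite_subset)
        have sets: "M = I \<union> J" "K - I = J \<union> L" "K - I - J = L" "I \<inter> J = {}" "J \<inter> L = {}"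
          using \<open>M \<subseteq> K\<close> \<open>I \<subseteq> M\<close> by (auto simp: J_def L_def)
        show "gsign I (K - I) * gcoeff a I *
            (gsign (M - I) (K - I - (M - I)) * gcoeff b (M - I) * gcoeff c (K - I - (M - I))) =
            gsign M (K - M) * (gsign I (M - I) * gcoeff a I * gcoeff b (M - I)) * gcoeff c (K - M)"
          unfolding L_def[symmetric] J_def[symmetric] sets(3)
          unfolding sets(1,2)
          by (simp add: gsign_Un_left gsign_Un_right mult_ac sets(4,5) fin)
      qed auto
      also have "\<dots> = (\<Sum>I\<in>Pow K. \<Sum>J\<in>Pow (K - I).
          gsign I (K - I) * gcoeff a I * (gsign J (K - I - J) * gcoeff b J * gcoeff c (K - I - J)))"
        by (rule sum.Sigma[symmetric]) (use True in \<open>auto intro: finite_subset\<close>)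
      also have "\<dots> = gcoeff (a * (b * c)) K"
        by (simp add: times_grassmann.rep_eq sum_distrib_left sum_distrib_right)
      finally show ?thesis .
    qed (metis gcoeff_nonzero_finite)
  qed
  show "1 * a = a"
  proof (rule grassmann_eqI)
    fix K
    have "gcoeff (1 * a) K = (\<Sum>I\<in>Pow K. if I = {} then gcoeff a K else 0)"
      unfolding times_grassmann.rep_eq one_grassmann.rep_eq by (intro sum.cong) auto
    also have "\<dots> = gcoeff a K"
      by (cases "finite K") (use gcoeff_nonzero_finite[of a K] in auto)
    finally show "gcoeff (1 * a) K = gcoeff a K" .
  qed
  show "a * 1 = a"
  proof (rule grassmann_eqI)
    fix K
    have "gcoeff (a * 1) K = (\<Sum>I\<in>Pow K. if I = K then gcoeff a K else 0)"
      unfolding times_grassmann.rep_eq one_grassmann.rep_eq by (intro sum.cong) auto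
    also have "\<dots> = gcoeff a K"
      by (cases "finite K") (use gcoeff_nonzero_finite[of a K] in auto)
    finally show "gcoeff (a * 1) K = gcoeff a K" .
  qed
  show "(a + b) * c = a * c + b * c"
    by (rule grassmann_eqI) (simp add: times_grassmann.rep_eq algebra_simps sum.distrib)
  show "a * (b + c) = a * b + a * c"
    by (rule grassmann_eqI) (simp add: times_grassmann.rep_eq algebra_simps sum.distrib)
  have "gcoeff (0 :: ('a, 'b) grassmann) {} \<noteq> gcoeff 1 {}"
    by (simp add: one_grassmann.rep_eq)
  then show "(0 :: ('a, 'b) grassmann) \<noteq> 1" by metis
qed

end

abbreviation gvar :: "'g \<Rightarrow> ('g, 'a::comm_ring_1) grassmann"
  where "gvar v \<equiv> gmono 1 {v}"

abbreviation gconst :: "'a::comm_ring_1 \<Rightarrow> ('g, 'a) grassmann"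
  where "gconst c \<equiv> gmono c {}"

lemma gmono_expand: "a = (\<Sum>K\<in>gsupp a. gmono (gcoeff a K) K)"
  for a :: "('g, 'a::ab_group_add) grassmann"
proof (rule grassmann_eqI)
  fix L
  have "(\<Sum>K\<in>gsupp a. gcoeff (gmono (gcoeff a K) K) L) = (\<Sum>K\<in>gsupp a. if K = L then gcoeff a L else 0)"
    by (intro sum.cong) (auto simp: gcoeff_gmono gsupp_def dest: gcoeff_nonzero_finite)
  also have "\<dots> = gcoeff a L"
    by (subst sum.delta) (simp_all add: gsupp_def finite_gcoeff)
  finally show "gcoeff a L = gcoeff (\<Sum>K\<in>gsupp a. gmono (gcoeff a K) K) L" by simp
qed

lemma gmono_zero [simp]: "gmono 0 K = (0 :: ('g, 'a::ab_group_add) grassmann)"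
  by (rule grassmann_eqI) (simp add: gcoeff_gmono)

lemma gmono_add: "gmono (c + d) K = gmono c K + (gmono d K :: ('g, 'a::ab_group_add) grassmann)"
  by (rule grassmann_eqI) (simp add: gcoeff_gmono)

lemma gsupp_sum_add:
  fixes a b :: "('g, 'a::ab_group_add) grassmann" and h :: "'g set \<Rightarrow> 'a \<Rightarrow> 'b::ab_group_add"
  assumes h: "\<And>K c d. h K (c + d) = h K c + h K d"
  shows "(\<Sum>K\<in>gsupp (a + b). h K (gcoeff (a + b) K)) =
    (\<Sum>K\<in>gsupp a. h K (gcoeff a K)) + (\<Sum>K\<in>gsupp b. h K (gcoeff b K))"
proof -
  have h0: "h K 0 = 0" for K using h[of K 0 0] by simp
  let ?S = "gsupp a \<union> gsupp b"
  have ext: "(\<Sum>K\<in>gsupp c. h K (gcoeff c K)) = (\<Sum>K\<in>?S. h K (gcoeff c K))"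
    if "gsupp c \<subseteq> ?S" for c
    by (rule sum.mono_neutral_left) (use that h0 in \<open>auto simp: gsupp_def finite_gcoeff\<close>)
  have "gsupp (a + b) \<subseteq> ?S" by (auto simp: gsupp_def)
  then show ?thesis
    unfolding ext[OF \<open>gsupp (a + b) \<subseteq> ?S\<close>] ext[OF Un_upper1] ext[OF Un_upper2]
    by (simp add: h sum.distrib)
qed

lemma gsupp_sum_gmono:
  assumes "finite K" and "h K 0 = (0 :: 'b::comm_monoid_add)"
  shows "(\<Sum>L\<in>gsupp (gmono c K). h L (gcoeff (gmono c K) L)) = h K c"
proof (cases "c = 0")
  case True
  then have "gsupp (gmono c K) = {}" by (auto simp: gsupp_def gcoeff_gmono)
  then show ?thesis using True assms by simp
next
  case False
  then have "gsupp (gmono c K) = {K}" using assms by (auto simp: gsupp_def gcoeff_gmono)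
  then show ?thesis using assms by (simp add: gcoeff_gmono)
qed

lemma gsupp_finite: "K \<in> gsupp a \<Longrightarrow> finite K"
  by (simp add: gsupp_def gcoeff_nonzero_finite)

lemma gmono_one: "gmono 1 {} = (1 :: ('g::linorder, 'a::comm_ring_1) grassmann)"
  by (rule grassmann_eqI) (simp add: gcoeff_gmono one_grassmann.rep_eq)

lemma gmono_mult:
  fixes c d :: "'a::comm_ring_1" and I J :: "'g::linorder set"
  assumes "finite I" "finite J"
  shows "gmono c I * gmono d J =
    (if I \<inter> J = {} then gmono (gsign I J * c * d) (I \<union> J) else 0)"
proof (rule grassmann_eqI)
  fix K
  have "gcoeff (gmono c I * gmono d J) K =
      (\<Sum>M\<in>Pow K. if M = I then (if K - I = J then gsign I J * c * d else 0) else 0)"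
    unfolding times_grassmann.rep_eq
    by (intro sum.cong) (auto simp: gcoeff_gmono assms)
  also have "\<dots> = (if finite K \<and> I \<subseteq> K \<and> K - I = J then gsign I J * c * d else 0)"
    by (cases "finite K") auto
  also have "\<dots> = gcoeff (if I \<inter> J = {} then gmono (gsign I J * c * d) (I \<union> J) else 0) K"
    using assms by (auto simp: gcoeff_gmono)
  finally show "gcoeff (gmono c I * gmono d J) K = \<dots>" .
qed

lemma gvar_square: "gvar v * gvar v = (0 :: ('g::linorder, 'a::comm_ring_1) grassmann)"
  by (simp add: gmono_mult)

lemma gvar_anticomm:
  "gvar v * gvar w = - (gvar w * gvar v :: ('g::linorder, 'a::comm_ring_1) grassmann)"
proof (cases "v = w")
  case False
  have S: "{(i, j). i = v \<and> j = w \<and> j < i} = (if w < v then {(v, w)} else {})" for v w :: 'g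
    by auto
  show ?thesis using False
    by (intro grassmann_eqI)
      (auto simp: gmono_mult gsign_def gcoeff_gmono S insert_commute neq_iff)
qed (simp add: gvar_square)

text \<open>The component of parity \<open>p\<close>, for \<open>p\<close> equal to 0 or 1.\<close>

definition parity_part :: "nat \<Rightarrow> ('g, 'a::ab_group_add) grassmann \<Rightarrow> ('g, 'a) grassmann"
  where "parity_part p a = (\<Sum>K\<in>{K \<in> gsupp a. card K mod 2 = p}. gmono (gcoeff a K) K)"

lemma gcoeff_parity_part: "gcoeff (parity_part p a) K = (if card K mod 2 = p then gcoeff a K else 0)"
proof -
  have "gcoeff (parity_part p a) K =
      (\<Sum>L\<in>{L \<in> gsupp a. card L mod 2 = p}. if L = K then gcoeff a K else 0)"
    unfolding parity_part_def gcoeff_sum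
    by (intro sum.cong) (auto simp: gcoeff_gmono gsupp_finite)
  also have "\<dots> = (if card K mod 2 = p then gcoeff a K else 0)"
    by (subst sum.delta) (simp_all, auto simp: gsupp_def)
  finally show ?thesis .
qed

text \<open>The odd derivation that is linear over the coefficients and maps \<open>gvar v\<close> to \<open>\<phi> v\<close>.\<close>

definition gderiv ::
  "('g::linorder \<Rightarrow> 'a) \<Rightarrow> ('g, 'a::comm_ring_1) grassmann \<Rightarrow> ('g, 'a) grassmann"
  where "gderiv \<phi> a =
    (\<Sum>K\<in>gsupp a. \<Sum>v\<in>K. gmono ((- 1) ^ card {w \<in> K. w < v} * gcoeff a K * \<phi> v) (K - {v}))"

lemma gderiv_add: "gderiv \<phi> (a + b) = gderiv \<phi> a + gderiv \<phi> b"
  unfolding gderiv_def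
  by (rule gsupp_sum_add) (simp add: algebra_simps gmono_add sum.distrib)

lemma gderiv_zero [simp]: "gderiv \<phi> 0 = 0"
  using gderiv_add[of \<phi> 0 0] by simp

lemma gderiv_sum: "gderiv \<phi> (\<Sum>i\<in>A. h i) = (\<Sum>i\<in>A. gderiv \<phi> (h i))"
  by (induction A rule: infinite_finite_induct) (auto simp: gderiv_add)

lemma gderiv_gmono:
  assumes "finite K"
  shows "gderiv \<phi> (gmono c K) = (\<Sum>v\<in>K. gmono ((- 1) ^ card {w \<in> K. w < v} * c * \<phi> v) (K - {v}))"
  unfolding gderiv_def by (rule gsupp_sum_gmono) (simp_all add: assms)

lemma gderiv_gvar: "gderiv \<phi> (gvar v) = gconst (\<phi> v)"
proof -
  have *: "{w. w = v \<and> w < v} = {}" by auto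
  show ?thesis by (simp add: gderiv_gmono *)
qed

lemma gderiv_gconst [simp]: "gderiv \<phi> (gconst c) = 0"
  by (simp add: gderiv_gmono)

lemma gderiv_gconst_mult: "gderiv \<phi> (gconst c * a) = gconst c * gderiv \<phi> a"
proof -
  have "gderiv \<phi> (gconst c * gmono d K) = gconst c * gderiv \<phi> (gmono d K)" if "finite K" for d K
    using that
    by (simp add: gmono_mult gderiv_gmono sum_distrib_left mult_ac)
  then have "gderiv \<phi> (gconst c * (\<Sum>K\<in>gsupp a. gmono (gcoeff a K) K)) =
      gconst c * gderiv \<phi> (\<Sum>K\<in>gsupp a. gmono (gcoeff a K) K)"
    by (simp add: sum_distrib_left gderiv_sum gsupp_finite)
  then show ?thesis by (simp flip: gmono_expand)
qed

lemma gsign_single: "gsign {v} J = (- 1) ^ card {j \<in> J. j < v}"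
proof -
  have "{(i, j). i \<in> {v} \<and> j \<in> J \<and> j < i} = Pair v ` {j \<in> J. j < v}" by auto
  then show ?thesis by (simp add: gsign_def card_image inj_on_def)
qed

lemma gderiv_gvar_mult_gmono:
  fixes \<phi> :: "'g::linorder \<Rightarrow> 'a::comm_ring_1"
  assumes K: "finite K"
  shows "gderiv \<phi> (gvar v * gmono c K) = gconst (\<phi> v) * gmono c K - gvar v * gderiv \<phi> (gmono c K)"
proof (cases "v \<in> K")
  case True
  let ?s = "\<lambda>w. (- 1) ^ card {u \<in> K. u < w}"
  have "gvar v * gderiv \<phi> (gmono c K) =
      (\<Sum>w\<in>K. if w = v then gvar v * gmono (?s v * c * \<phi> v) (K - {v}) else 0)"
    using K unfolding gderiv_gmono[OF K] sum_distrib_left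
    by (intro sum.cong) (auto simp: gmono_mult True)
  also have "\<dots> = gvar v * gmono (?s v * c * \<phi> v) (K - {v})"
    using K True by simp
  also have "\<dots> = gmono (gsign {v} (K - {v}) * (?s v * c * \<phi> v)) K"
    using K True by (simp add: gmono_mult insert_absorb)
  also have "gsign {v} (K - {v}) = ?s v"
    unfolding gsign_single by (rule arg_cong[of _ _ "\<lambda>A. (- 1) ^ card A"]) auto
  also have "?s v * (?s v * c * \<phi> v) = \<phi> v * c"
    by (simp add: mult_ac power_mult_distrib[symmetric] flip: mult.assoc)
  finally show ?thesis using K True by (simp add: gmono_mult)
next
  case False
  let ?s = "\<lambda>w. (- 1) ^ card {u \<in> K. u < w}"
  let ?I = "insert v K"
  let ?g = "gsign {v} K * c"
  have T: "gmono ((- 1) ^ card {u \<in> ?I. u < w} * ?g * \<phi> w) (?I - {w}) =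
      - (gvar v * gmono (?s w * c * \<phi> w) (K - {w}))" if w: "w \<in> K" for w
  proof -
    have "v \<noteq> w" using w False by auto
    have 1: "((- 1) ^ card {u \<in> ?I. u < w} :: 'a) = (if v < w then - 1 else 1) * ?s w"
    proof -
      have "{u \<in> ?I. u < w} = (if v < w then insert v {u \<in> K. u < w} else {u \<in> K. u < w})" by auto
      then show ?thesis using K False by simp
    qed
    have 2: "(gsign {v} K :: 'a) = (if w < v then - 1 else 1) * gsign {v} (K - {w})"
    proof -
      have "{u \<in> K. u < v} =
          (if w < v then insert w {u \<in> K - {w}. u < v} else {u \<in> K - {w}. u < v})"
        using w by auto
      then show ?thesis using K False by (simp add: gsign_single)
    qed
    have "(- 1) ^ card {u \<in> ?I. u < w} * ?g * \<phi> w = - (gsign {v} (K - {w}) * (?s w * c * \<phi> w))"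
      unfolding 1 2 using \<open>v \<noteq> w\<close> by (auto simp: mult_ac neq_iff)
    moreover have "?I - {w} = insert v (K - {w})" using \<open>v \<noteq> w\<close> by auto
    moreover have "v \<notin> K - {w}" using False by auto
    ultimately show ?thesis using K
      by (intro grassmann_eqI) (simp add: gmono_mult gcoeff_gmono mult_ac)
  qed
  have "gvar v * gmono c K = gmono ?g ?I" using K False by (simp add: gmono_mult)
  also have "gderiv \<phi> \<dots> = gmono ((- 1) ^ card {u \<in> ?I. u < v} * ?g * \<phi> v) (?I - {v}) +
      (\<Sum>w\<in>K. gmono ((- 1) ^ card {u \<in> ?I. u < w} * ?g * \<phi> w) (?I - {w}))"
    using K False by (simp add: gderiv_gmono)
  also have "(\<Sum>w\<in>K. gmono ((- 1) ^ card {u \<in> ?I. u < w} * ?g * \<phi> w) (?I - {w})) =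
      - (gvar v * gderiv \<phi> (gmono c K))"
    unfolding gderiv_gmono[OF K] sum_distrib_left sum_negf[symmetric] by (rule sum.cong[OF refl T])
  also have "(- 1) ^ card {u \<in> ?I. u < v} * ?g * \<phi> v = \<phi> v * c"
  proof -
    have "{u \<in> ?I. u < v} = {u \<in> K. u < v}" by auto
    then show ?thesis
      by (simp add: gsign_single mult_ac power_mult_distrib[symmetric] flip: mult.assoc)
  qed
  finally show ?thesis using K False by (simp add: gmono_mult)
qed

lemma gderiv_gvar_mult:
  "gderiv \<phi> (gvar v * a) = gconst (\<phi> v) * a - gvar v * gderiv \<phi> a"
proof -
  have "gderiv \<phi> (gvar v * (\<Sum>K\<in>gsupp a. gmono (gcoeff a K) K)) =
      gconst (\<phi> v) * (\<Sum>K\<in>gsupp a. gmono (gcoeff a K) K) -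
      gvar v * gderiv \<phi> (\<Sum>K\<in>gsupp a. gmono (gcoeff a K) K)"
    by (simp add: sum_distrib_left gderiv_sum gderiv_gvar_mult_gmono gsupp_finite sum_subtractf)
  then show ?thesis by (simp flip: gmono_expand)
qed

lemma gderiv_gmono_mult:
  assumes "finite K"
  shows "gderiv \<phi> (gmono c K * b) =
    gderiv \<phi> (gmono c K) * b + (- 1) ^ card K * gmono c K * gderiv \<phi> b"
  using assms
proof (induction K)
  case empty
  show ?case by (simp add: gderiv_gconst_mult)
next
  case (insert v K)
  let ?e = "gsign {v} K"
  have "gmono c (insert v K) = gconst ?e * (gvar v * gmono c K)"
    using insert by (simp add: gmono_mult gsign_single mult_ac power_mult_distrib[symmetric] flip: mult.assoc)
  moreover have "gderiv \<phi> (gconst ?e * (gvar v * gmono c K) * b) =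
      gderiv \<phi> (gconst ?e * (gvar v * gmono c K)) * b -
      (- 1) ^ card K * (gconst ?e * (gvar v * gmono c K)) * gderiv \<phi> b"
    by (cases "even (card K)")
      (simp_all add: mult.assoc gderiv_gconst_mult gderiv_gvar_mult insert algebra_simps)
  ultimately show ?case using insert by simp
qed

lemma gderiv_mult:
  assumes "parity_part p a = a"
  shows "gderiv \<phi> (a * b) = gderiv \<phi> a * b + (- 1) ^ p * a * gderiv \<phi> b"
proof -
  have "card K mod 2 = p" if "K \<in> gsupp a" for K
    using that gcoeff_parity_part[of p a K] assms by (auto simp: gsupp_def split: if_splits)
  then have sgn: "(- 1) ^ card K = ((- 1) ^ p :: ('a, 'b) grassmann)" if "K \<in> gsupp a" for K
    using that by (metis minus_one_power_iff even_mod_2_iff)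
  have "gderiv \<phi> ((\<Sum>K\<in>gsupp a. gmono (gcoeff a K) K) * b) =
      gderiv \<phi> (\<Sum>K\<in>gsupp a. gmono (gcoeff a K) K) * b +
      (- 1) ^ p * (\<Sum>K\<in>gsupp a. gmono (gcoeff a K) K) * gderiv \<phi> b"
    by (simp add: sum_distrib_left sum_distrib_right gderiv_sum gderiv_gmono_mult gsupp_finite
        sum.distrib sgn)
  then show ?thesis by (simp flip: gmono_expand)
qed


section \<open>Variables and polynomials\<close>

text \<open>
  All algebras in question are subalgebras of a single Grassmann algebra over a single
  polynomial ring.  Its commuting variables are \<open>x\<close> and \<open>y\<close>, its anticommuting ones are
  \<open>u\<close>, \<open>f\<^sub>x\<close> and \<open>f\<^sub>y\<close>; every collection is indexed from 0.
\<close>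

datatype cvar = X nat | Y nat

datatype avar = U nat | FX nat | FY nat

fun avar_rank :: "avar \<Rightarrow> nat" where
  "avar_rank (U i) = 0" | "avar_rank (FX i) = 1" | "avar_rank (FY i) = 2"

fun avar_index :: "avar \<Rightarrow> nat" where
  "avar_index (U i) = i" | "avar_index (FX i) = i" | "avar_index (FY i) = i"

instantiation avar :: linorder
begin
definition "less_avar v w \<longleftrightarrow>
  avar_rank v < avar_rank w \<or> avar_rank v = avar_rank w \<and> avar_index v < avar_index w"
definition "less_eq_avar v w \<longleftrightarrow>
  avar_rank v < avar_rank w \<or> avar_rank v = avar_rank w \<and> avar_index v \<le> avar_index w"
instance
proof
  fix v w :: avar
  show "v \<le> w \<Longrightarrow> w \<le> v \<Longrightarrow> v = w"
    by (cases v; cases w) (auto simp: less_eq_avar_def)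
qed (auto simp: less_avar_def less_eq_avar_def)
end

type_synonym 'r mpol = "(cvar \<Rightarrow>\<^sub>0 nat) \<Rightarrow>\<^sub>0 'r"
type_synonym 'r galg = "(avar, 'r mpol) grassmann"

definition xvar :: "nat \<Rightarrow> 'r::comm_ring_1 mpol"
  where "xvar k = Poly_Mapping.single (Poly_Mapping.single (X k) 1) 1"

definition yvar :: "nat \<Rightarrow> 'r::comm_ring_1 mpol"
  where "yvar k = Poly_Mapping.single (Poly_Mapping.single (Y k) 1) 1"

definition polys :: "cvar set \<Rightarrow> 'r::comm_ring_1 mpol set"
  where "polys V = {p. \<forall>m\<in>Poly_Mapping.keys p. Poly_Mapping.keys m \<subseteq> V}"

definition grassmann_over :: "cvar set \<Rightarrow> avar set \<Rightarrow> 'r::comm_ring_1 galg set"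
  where "grassmann_over V G = {a. \<forall>K\<in>gsupp a. K \<subseteq> G \<and> gcoeff a K \<in> polys V}"

lemma polys_zero [simp]: "0 \<in> polys V"
  by (simp add: polys_def)

lemma polys_const [simp]: "Poly_Mapping.single 0 r \<in> polys V"
  by (simp add: polys_def)

lemma polys_one [simp]: "1 \<in> polys V"
  by (simp add: polys_def)

lemma polys_add: "p \<in> polys V \<Longrightarrow> q \<in> polys V \<Longrightarrow> p + q \<in> polys V"
  unfolding polys_def using keys_add[of p q] by blast

lemma polys_uminus [simp]: "- p \<in> polys V \<longleftrightarrow> p \<in> polys V"
  by (simp add: polys_def in_keys_iff)

lemma polys_mult: "p \<in> polys V \<Longrightarrow> q \<in> polys V \<Longrightarrow> p * q \<in> polys V"
proof -
  assume "p \<in> polys V" "q \<in> polys V"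
  then have "Poly_Mapping.keys (a + b) \<subseteq> V"
    if "a \<in> Poly_Mapping.keys p" "b \<in> Poly_Mapping.keys q" for a b
    using that keys_add[of a b] by (fastforce simp: polys_def)
  then show ?thesis
    unfolding polys_def using keys_mult[of p q] by blast
qed

lemma polys_sum: "(\<And>i. i \<in> A \<Longrightarrow> h i \<in> polys V) \<Longrightarrow> sum h A \<in> polys V"
  by (induction A rule: infinite_finite_induct) (auto intro: polys_add)

lemma polys_sign: "gsign I J \<in> polys V"
  by (simp add: gsign_def minus_one_power_iff)

lemma grassmann_over_iff:
  "a \<in> grassmann_over V G \<longleftrightarrow> (\<forall>K. gcoeff a K \<in> polys V \<and> (gcoeff a K \<noteq> 0 \<longrightarrow> K \<subseteq> G))"
proof -
  have "gcoeff a K \<in> polys V" if "K \<in> gsupp a \<longrightarrow> gcoeff a K \<in> polys V" for K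
    using that by (cases "gcoeff a K = 0") (auto simp: gsupp_def)
  then show ?thesis by (auto simp: grassmann_over_def gsupp_def)
qed

lemma grassmann_over_zero [simp]: "0 \<in> grassmann_over V G"
  by (simp add: grassmann_over_iff)

lemma grassmann_over_one [simp]: "1 \<in> grassmann_over V G"
  by (simp add: grassmann_over_iff one_grassmann.rep_eq)

lemma grassmann_over_add:
  "a \<in> grassmann_over V G \<Longrightarrow> b \<in> grassmann_over V G \<Longrightarrow> a + b \<in> grassmann_over V G"
  by (simp add: grassmann_over_iff polys_add) (metis add_0)

lemma grassmann_over_uminus [simp]: "- a \<in> grassmann_over V G \<longleftrightarrow> a \<in> grassmann_over V G"
  by (simp add: grassmann_over_iff)

lemma grassmann_over_diff:
  "a \<in> grassmann_over V G \<Longrightarrow> b \<in> grassmann_over V G \<Longrightarrow> a - b \<in> grassmann_over V G"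
  using grassmann_over_add[of a V G "- b"] by simp

lemma grassmann_over_sum:
  "(\<And>i. i \<in> A \<Longrightarrow> h i \<in> grassmann_over V G) \<Longrightarrow> sum h A \<in> grassmann_over V G"
  by (induction A rule: infinite_finite_induct) (auto intro: grassmann_over_add)

lemma grassmann_over_gmono: "c \<in> polys V \<Longrightarrow> K \<subseteq> G \<Longrightarrow> gmono c K \<in> grassmann_over V G"
  by (auto simp: grassmann_over_iff gcoeff_gmono)

lemma grassmann_over_mult:
  assumes "a \<in> grassmann_over V G" "b \<in> grassmann_over V G"
  shows "a * b \<in> grassmann_over V G"
proof -
  have "gcoeff (a * b) K \<in> polys V \<and> (gcoeff (a * b) K \<noteq> 0 \<longrightarrow> K \<subseteq> G)" for K
  proof
    show "gcoeff (a * b) K \<in> polys V"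
      unfolding times_grassmann.rep_eq
      using assms by (intro polys_sum polys_mult) (auto simp: grassmann_over_iff polys_sign)
    show "gcoeff (a * b) K \<noteq> 0 \<longrightarrow> K \<subseteq> G"
    proof
      assume "gcoeff (a * b) K \<noteq> 0"
      then obtain I where I: "I \<in> Pow K" "gsign I (K - I) * gcoeff a I * gcoeff b (K - I) \<noteq> 0"
        unfolding times_grassmann.rep_eq by (auto elim: sum.not_neutral_contains_not_neutral)
      then have "gcoeff a I \<noteq> 0" "gcoeff b (K - I) \<noteq> 0" by auto
      then have "I \<subseteq> G" "K - I \<subseteq> G" using assms by (auto simp: grassmann_over_iff)
      then show "K \<subseteq> G" by auto
    qed
  qed
  then show ?thesis by (simp add: grassmann_over_iff)
qed

lemma grassmann_over_prod_list:
  "(\<And>a. a \<in> set as \<Longrightarrow> a \<in> grassmann_over V G) \<Longrightarrow> prod_list as \<in> grassmann_over V G"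
  by (induction as) (auto intro: grassmann_over_mult)

lemma grassmann_over_mono:
  "a \<in> grassmann_over V G \<Longrightarrow> V \<subseteq> V' \<Longrightarrow> G \<subseteq> G' \<Longrightarrow> a \<in> grassmann_over V' G'"
  unfolding grassmann_over_def polys_def by blast

definition rconst :: "'r::comm_ring_1 \<Rightarrow> 'r galg"
  where "rconst r = gconst (Poly_Mapping.single 0 r)"

text \<open>
  \<open>swap_poly\<close> and \<open>swap_xy\<close> exchange the names \<open>x\<close> and \<open>y\<close>.  Since
  \<open>swap_xy\<close> moves coefficients without introducing signs, it is the renaming
  homomorphism only on elements that do not involve both \<open>f\<^sub>x\<close> and \<open>f\<^sub>y\<close>.
\<close>

fun swap_cvar :: "cvar \<Rightarrow> cvar" where
  "swap_cvar (X i) = Y i" | "swap_cvar (Y i) = X i"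

fun swap_avar :: "avar \<Rightarrow> avar" where
  "swap_avar (U i) = U i" | "swap_avar (FX i) = FY i" | "swap_avar (FY i) = FX i"

definition swap_poly :: "'r::comm_ring_1 mpol \<Rightarrow> 'r mpol"
  where "swap_poly = Poly_Mapping.map_key (Poly_Mapping.map_key swap_cvar)"

lemma inj_swap_cvar: "inj swap_cvar"
proof (rule injI)
  fix v w show "swap_cvar v = swap_cvar w \<Longrightarrow> v = w" by (cases v; cases w) auto
qed

lemma inj_map_key_swap_cvar: "inj (Poly_Mapping.map_key swap_cvar :: (cvar \<Rightarrow>\<^sub>0 nat) \<Rightarrow> _)"
proof (rule inj_on_inverseI)
  have "swap_cvar \<circ> swap_cvar = (\<lambda>v. v)"
  proof
    fix v show "(swap_cvar \<circ> swap_cvar) v = v" by (cases v) auto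
  qed
  then show "Poly_Mapping.map_key swap_cvar (Poly_Mapping.map_key swap_cvar m) = m"
    for m :: "cvar \<Rightarrow>\<^sub>0 nat"
    by (simp add: map_key_compose inj_swap_cvar map_key_id)
qed

lemma lookup_swap_poly:
  "Poly_Mapping.lookup (swap_poly p) m = Poly_Mapping.lookup p (Poly_Mapping.map_key swap_cvar m)"
  by (simp add: swap_poly_def map_key.rep_eq inj_map_key_swap_cvar)

lemma swap_poly_xvar: "swap_poly (xvar k) = yvar k"
proof -
  have "Poly_Mapping.map_key swap_cvar (Poly_Mapping.single (swap_cvar (X k)) (1 :: nat)) =
      Poly_Mapping.single (X k) 1"
    by (rule map_key_single[OF inj_swap_cvar])
  then have "xvar k = Poly_Mapping.single
      (Poly_Mapping.map_key swap_cvar (Poly_Mapping.single (Y k) (1 :: nat))) (1 :: 'a)"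
    by (simp add: xvar_def)
  then show ?thesis
    unfolding swap_poly_def yvar_def
    by (simp only: map_key_single[OF inj_map_key_swap_cvar])
qed

definition swap_xy :: "'r::comm_ring_1 galg \<Rightarrow> 'r galg"
  where "swap_xy a = (\<Sum>K\<in>gsupp a. gmono (swap_poly (gcoeff a K)) (swap_avar ` K))"


section \<open>The Koszul complex and its dual\<close>

definition koszul :: "nat \<Rightarrow> nat \<Rightarrow> 'r::comm_ring_1 galg set"
  where "koszul n s = grassmann_over (X ` {..<n}) (FX ` {..<s})"

definition koszul_deg :: "nat \<Rightarrow> nat \<Rightarrow> nat \<Rightarrow> 'r::comm_ring_1 galg set"
  where "koszul_deg n s d = {a \<in> koszul n s. \<forall>K\<in>gsupp a. card K = d}"

fun koszul_val :: "(nat \<Rightarrow> 'r::comm_ring_1 mpol) \<Rightarrow> avar \<Rightarrow> 'r mpol" where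
  "koszul_val f (U i) = 0"
| "koszul_val f (FX i) = f i"
| "koszul_val f (FY i) = swap_poly (f i)"

abbreviation koszul_diff :: "(nat \<Rightarrow> 'r::comm_ring_1 mpol) \<Rightarrow> 'r galg \<Rightarrow> 'r galg"
  where "koszul_diff f \<equiv> gderiv (koszul_val f)"

definition homologous ::
  "nat \<Rightarrow> nat \<Rightarrow> (nat \<Rightarrow> 'r::comm_ring_1 mpol) \<Rightarrow> 'r galg \<Rightarrow> 'r galg \<Rightarrow> bool"
  where "homologous n s f c' c'' \<longleftrightarrow> (\<exists>c\<in>koszul n s. c' - c'' = koszul_diff f c)"

text \<open>The homology ring in degree 0, and its structure map from the ground ring.\<close>

definition koszul_Z0 :: "nat \<Rightarrow> nat \<Rightarrow> (nat \<Rightarrow> 'r::comm_ring_1 mpol) \<Rightarrow> 'r galg ring"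
  where "koszul_Z0 n s f =
    \<lparr>carrier = {a \<in> koszul_deg n s 0. koszul_diff f a = 0}, mult = (*), one = 1, zero = 0, add = (+)\<rparr>"

definition koszul_B0 :: "nat \<Rightarrow> nat \<Rightarrow> (nat \<Rightarrow> 'r::comm_ring_1 mpol) \<Rightarrow> 'r galg set"
  where "koszul_B0 n s f = koszul_diff f ` koszul_deg n s 1"

definition koszul_H0 :: "nat \<Rightarrow> nat \<Rightarrow> (nat \<Rightarrow> 'r::comm_ring_1 mpol) \<Rightarrow> 'r galg set ring"
  where "koszul_H0 n s f = koszul_Z0 n s f Quot koszul_B0 n s f"

definition koszul_H0_map :: "nat \<Rightarrow> nat \<Rightarrow> (nat \<Rightarrow> 'r::comm_ring_1 mpol) \<Rightarrow> 'r \<Rightarrow> 'r galg set"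
  where "koszul_H0_map n s f r = koszul_B0 n s f +>\<^bsub>koszul_Z0 n s f\<^esub> rconst r"

text \<open>Finite generation of a ring \<open>Q\<close> as a module over \<open>'r\<close> along \<open>\<rho>\<close>.\<close>

definition fin_gen_along :: "('r \<Rightarrow> 'q) \<Rightarrow> ('q, 'm) ring_scheme \<Rightarrow> bool"
  where "fin_gen_along \<rho> Q \<longleftrightarrow> (\<exists>G. finite G \<and> G \<subseteq> carrier Q \<and>
    (\<forall>q\<in>carrier Q. \<exists>c. q = (\<Oplus>\<^bsub>Q\<^esub>g\<in>G. \<rho> (c g) \<otimes>\<^bsub>Q\<^esub> g)))"

lemma koszul_deg_0: "koszul_deg n s 0 = gconst ` polys (X ` {..<n})"
proof (intro Set.set_eqI iffI)
  fix a :: "'r::comm_ring_1 galg"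
  assume a: "a \<in> koszul_deg n s 0"
  have "K = {}" if "gcoeff a K \<noteq> 0" for K
  proof -
    have "finite K" using that by (rule gcoeff_nonzero_finite)
    moreover have "card K = 0" using a that by (simp add: koszul_deg_def gsupp_def)
    ultimately show ?thesis by simp
  qed
  then have "a = gconst (gcoeff a {})"
    by (intro grassmann_eqI) (auto simp: gcoeff_gmono)
  moreover have "gcoeff a {} \<in> polys (X ` {..<n})"
    using a by (simp add: koszul_deg_def koszul_def grassmann_over_iff)
  ultimately show "a \<in> gconst ` polys (X ` {..<n})" by blast
next
  fix a :: "'r::comm_ring_1 galg"
  assume "a \<in> gconst ` polys (X ` {..<n})"
  then show "a \<in> koszul_deg n s 0"
    by (auto simp: koszul_deg_def koszul_def gsupp_def gcoeff_gmono intro: grassmann_over_gmono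
        split: if_splits)
qed

lemma carrier_koszul_Z0: "carrier (koszul_Z0 n s f) = gconst ` polys (X ` {..<n})"
  by (auto simp: koszul_Z0_def koszul_deg_0)

lemma koszul_B0_eq:
  fixes f :: "nat \<Rightarrow> 'r::comm_ring_1 mpol"
  shows "koszul_B0 n s f =
    {gconst (\<Sum>i<s. g i * f i) | g. \<forall>i<s. g i \<in> polys (X ` {..<n})}"
proof (intro Set.set_eqI iffI)
  fix b assume "b \<in> koszul_B0 n s f"
  then obtain a where a: "a \<in> koszul_deg n s 1" and b: "b = koszul_diff f a"
    by (auto simp: koszul_B0_def)
  have form: "\<exists>i<s. K = {FX i}" if "gcoeff a K \<noteq> 0" for K
  proof -
    have "K \<subseteq> FX ` {..<s}" "card K = 1"
      using a that by (auto simp: koszul_deg_def koszul_def grassmann_over_iff gsupp_def)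
    then show ?thesis by (auto simp: card_1_singleton_iff)
  qed
  have a_eq: "a = (\<Sum>i<s. gmono (gcoeff a {FX i}) {FX i})"
  proof (rule grassmann_eqI)
    fix L
    show "gcoeff a L = gcoeff (\<Sum>i<s. gmono (gcoeff a {FX i}) {FX i}) L"
    proof (cases "\<exists>i<s. L = {FX i}")
      case True
      then obtain j where "j < s" "L = {FX j}" by blast
      then show ?thesis by (simp add: gcoeff_gmono)
    next
      case False
      then have "gcoeff a L = 0" using form by blast
      then show ?thesis using False by (simp add: gcoeff_gmono)
    qed
  qed
  have "b = koszul_diff f (\<Sum>i<s. gmono (gcoeff a {FX i}) {FX i})"
    unfolding b by (rule arg_cong[OF a_eq])
  also have "\<dots> = (\<Sum>i<s. koszul_diff f (gmono (gcoeff a {FX i}) {FX i}))"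
    by (rule gderiv_sum)
  also have "\<dots> = (\<Sum>i<s. gconst (gcoeff a {FX i} * f i))"
  proof (rule sum.cong[OF refl])
    fix i
    have *: "{w. w = FX i \<and> w < FX i} = {}" by auto
    show "koszul_diff f (gmono (gcoeff a {FX i}) {FX i}) = gconst (gcoeff a {FX i} * f i)"
      by (simp add: gderiv_gmono *)
  qed
  also have "\<dots> = gconst (\<Sum>i<s. gcoeff a {FX i} * f i)"
    by (rule grassmann_eqI) (simp add: gcoeff_gmono)
  finally have "b = gconst (\<Sum>i<s. gcoeff a {FX i} * f i)" .
  moreover have "gcoeff a {FX i} \<in> polys (X ` {..<n})" for i
    using a by (simp add: koszul_deg_def koszul_def grassmann_over_iff)
  ultimately show "b \<in> {gconst (\<Sum>i<s. g i * f i) | g. \<forall>i<s. g i \<in> polys (X ` {..<n})}"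
    by (intro CollectI exI[of _ "\<lambda>i. gcoeff a {FX i}"]) simp
next
  fix b :: "'r galg"
  assume "b \<in> {gconst (\<Sum>i<s. g i * f i) | g. \<forall>i<s. g i \<in> polys (X ` {..<n})}"
  then obtain g where g: "\<And>i. i < s \<Longrightarrow> g i \<in> polys (X ` {..<n})"
    and b: "b = gconst (\<Sum>i<s. g i * f i)" by blast
  let ?a = "\<Sum>i<s. gmono (g i) {FX i}"
  have "koszul_diff f ?a = (\<Sum>i<s. gconst (g i * f i))"
    unfolding gderiv_sum
  proof (rule sum.cong[OF refl])
    fix i
    have *: "{w. w = FX i \<and> w < FX i} = {}" by auto
    show "koszul_diff f (gmono (g i) {FX i}) = gconst (g i * f i)"
      by (simp add: gderiv_gmono *)
  qed
  also have "\<dots> = b"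
    unfolding b by (rule grassmann_eqI) (simp add: gcoeff_gmono)
  finally have "b = koszul_diff f ?a" by simp
  moreover have "?a \<in> koszul_deg n s 1"
  proof -
    have "card K = 1" if "gcoeff ?a K \<noteq> 0" for K
    proof -
      from that obtain i where "gcoeff (gmono (g i) {FX i}) K \<noteq> 0"
        unfolding gcoeff_sum by (auto elim: sum.not_neutral_contains_not_neutral)
      then show ?thesis by (auto simp: gcoeff_gmono split: if_splits)
    qed
    moreover have "?a \<in> koszul n s"
      unfolding koszul_def using g by (intro grassmann_over_sum grassmann_over_gmono) auto
    ultimately show ?thesis by (simp add: koszul_deg_def gsupp_def)
  qed
  ultimately show "b \<in> koszul_B0 n s f" by (auto simp: koszul_B0_def)
qed

lemma cring_koszul_Z0: "cring (koszul_Z0 n s f)"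
proof (rule cringI)
  show "abelian_group (koszul_Z0 n s f)"
  proof (rule abelian_groupI)
    fix a assume a: "a \<in> carrier (koszul_Z0 n s f)"
    then obtain p where p: "p \<in> polys (X ` {..<n})" "a = gconst p"
      unfolding carrier_koszul_Z0 by blast
    show "\<exists>b\<in>carrier (koszul_Z0 n s f). b \<oplus>\<^bsub>koszul_Z0 n s f\<^esub> a = \<zero>\<^bsub>koszul_Z0 n s f\<^esub>"
      unfolding carrier_koszul_Z0 using p
      by (intro bexI[of _ "gconst (- p)"]) (auto simp: koszul_Z0_def simp flip: gmono_add)
  qed (unfold carrier_koszul_Z0,
      auto simp: koszul_Z0_def add_ac polys_add image_iff simp flip: gmono_add
        intro: bexI[of _ 0])
  show "Group.comm_monoid (koszul_Z0 n s f)"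
    by (rule comm_monoidI, unfold carrier_koszul_Z0)
      (auto simp: koszul_Z0_def gmono_mult mult_ac polys_mult image_iff simp flip: gmono_one
        intro: bexI[of _ 1])
qed (simp add: koszul_Z0_def distrib_right)

lemma ideal_koszul_B0:
  assumes f: "\<And>i. i < s \<Longrightarrow> f i \<in> polys (X ` {..<n})"
  shows "ideal (koszul_B0 n s f) (koszul_Z0 n s f)"
proof (rule idealI)
  let ?Z = "koszul_Z0 n s f" and ?B = "koszul_B0 n s f" and ?R = "polys (X ` {..<n})"
  interpret cring ?Z by (rule cring_koszul_Z0)
  show "ring ?Z" by (rule ring_axioms)
  have sub: "?B \<subseteq> carrier ?Z"
    unfolding koszul_B0_eq carrier_koszul_Z0 using f
    by (auto intro!: imageI polys_sum polys_mult)
  have add: "a + b \<in> ?B" if ab: "a \<in> ?B" "b \<in> ?B" for a b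
  proof -
    obtain g h where gh: "\<forall>i<s. g i \<in> ?R" "\<forall>i<s. h i \<in> ?R"
      "a = gconst (\<Sum>i<s. g i * f i)" "b = gconst (\<Sum>i<s. h i * f i)"
      using ab unfolding koszul_B0_eq by auto
    then have "a + b = gconst (\<Sum>i<s. (g i + h i) * f i)"
      by (simp add: distrib_right sum.distrib flip: gmono_add)
    then show ?thesis
      unfolding koszul_B0_eq using gh by (intro CollectI exI[of _ "\<lambda>i. g i + h i"]) (simp add: polys_add)
  qed
  have mult: "gconst p * b \<in> ?B \<and> b * gconst p \<in> ?B" if pb: "p \<in> ?R" "b \<in> ?B" for p b
  proof -
    obtain g where g: "\<forall>i<s. g i \<in> ?R" "b = gconst (\<Sum>i<s. g i * f i)"
      using pb unfolding koszul_B0_eq by auto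
    then have "gconst p * b = gconst (\<Sum>i<s. p * g i * f i)" "b * gconst p = gconst (\<Sum>i<s. p * g i * f i)"
      by (simp_all add: gmono_mult sum_distrib_left mult_ac)
    then show ?thesis
      unfolding koszul_B0_eq using g pb
      by (intro conjI CollectI exI[of _ "\<lambda>i. p * g i"]) (simp_all add: polys_mult)
  qed
  show "subgroup ?B (add_monoid ?Z)"
  proof (rule add.subgroupI)
    show "?B \<subseteq> carrier ?Z" by (rule sub)
    have "gconst (\<Sum>i<s. 0 * f i) \<in> ?B"
      unfolding koszul_B0_eq by (intro CollectI exI[of _ "\<lambda>_. 0"]) simp
    then show "?B \<noteq> {}" by blast
    fix a assume a: "a \<in> ?B"
    have "\<ominus>\<^bsub>?Z\<^esub> a = gconst (- 1) * a"
    proof (rule minus_equality)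
      show "a \<in> carrier ?Z" using a sub by blast
      show "gconst (- 1) * a \<in> carrier ?Z" using mult[of "- 1" a] a sub by auto
      have "gconst (- 1) * a + a = (gconst (- 1) + gconst 1) * a"
        by (simp add: distrib_right gmono_one)
      also have "\<dots> = 0" by (simp flip: gmono_add)
      finally show "gconst (- 1) * a \<oplus>\<^bsub>?Z\<^esub> a = \<zero>\<^bsub>?Z\<^esub>" by (simp add: koszul_Z0_def)
    qed
    then show "\<ominus>\<^bsub>?Z\<^esub> a \<in> ?B" using mult[of "- 1" a] a by simp
    fix b assume "b \<in> ?B"
    then show "a \<oplus>\<^bsub>?Z\<^esub> b \<in> ?B" using add a by (simp add: koszul_Z0_def)
  qed
  fix a x assume "a \<in> ?B" "x \<in> carrier ?Z"
  then show "x \<otimes>\<^bsub>?Z\<^esub> a \<in> ?B" "a \<otimes>\<^bsub>?Z\<^esub> x \<in> ?B"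
    using mult unfolding carrier_koszul_Z0 by (auto simp: koszul_Z0_def)
qed

lemma fin_gen_koszul_H0_iff:
  fixes f :: "nat \<Rightarrow> 'r::comm_ring_1 mpol"
  assumes f: "\<And>i. i < s \<Longrightarrow> f i \<in> polys (X ` {..<n})"
  shows "fin_gen_along (koszul_H0_map n s f) (koszul_H0 n s f) \<longleftrightarrow>
    (\<exists>B. finite B \<and> B \<subseteq> polys (X ` {..<n}) \<and> (\<forall>p\<in>polys (X ` {..<n}).
      \<exists>c g. (\<forall>i<s. g i \<in> polys (X ` {..<n})) \<and>
        p = (\<Sum>b\<in>B. Poly_Mapping.single 0 (c b) * b) + (\<Sum>i<s. g i * f i)))"
    (is "?lhs \<longleftrightarrow> ?rhs")
proof -
  let ?Z = "koszul_Z0 n s f" and ?I = "koszul_B0 n s f" and ?H = "koszul_H0 n s f"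
    and ?R = "polys (X ` {..<n})"
  define cs where "cs p = ?I +>\<^bsub>?Z\<^esub> gconst p" for p
  interpret I: ideal ?I ?Z by (rule ideal_koszul_B0[OF f])
  interpret h: ring_hom_cring ?Z ?H "\<lambda>a. ?I +>\<^bsub>?Z\<^esub> a"
    unfolding koszul_H0_def by (rule I.rcos_ring_hom_cring[OF cring_koszul_Z0])
  have in_Z: "gconst p \<in> carrier ?Z" if "p \<in> ?R" for p
    using that by (auto simp: carrier_koszul_Z0)
  have carr: "carrier ?H = cs ` ?R"
    unfolding koszul_H0_def FactRing_def A_RCOSETS_def' cs_def by (auto simp: carrier_koszul_Z0)
  have sum_Z: "(\<Oplus>\<^bsub>?Z\<^esub>i\<in>A. gconst (q i)) = gconst (\<Sum>i\<in>A. q i) \<and> (\<Sum>i\<in>A. q i) \<in> ?R"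
    if "finite A" "\<forall>i\<in>A. q i \<in> ?R" for q and A :: "'b set"
    using that
  proof (induction A rule: finite_induct)
    case empty
    have "\<zero>\<^bsub>?Z\<^esub> = 0" by (simp add: koszul_Z0_def)
    then show ?case by simp
  next
    case (insert i A)
    then have "(\<Oplus>\<^bsub>?Z\<^esub>i\<in>insert i A. gconst (q i)) = gconst (q i) \<oplus>\<^bsub>?Z\<^esub> (\<Oplus>\<^bsub>?Z\<^esub>i\<in>A. gconst (q i))"
      by (intro I.finsum_insert) (auto intro: in_Z)
    moreover have "a \<oplus>\<^bsub>?Z\<^esub> b = a + b" for a b by (simp add: koszul_Z0_def)
    ultimately show ?case using insert by (simp add: gmono_add polys_add)
  qed
  have smult: "koszul_H0_map n s f r \<otimes>\<^bsub>?H\<^esub> cs p = cs (Poly_Mapping.single 0 r * p)"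
    if "p \<in> ?R" for r p
  proof -
    have "gconst (Poly_Mapping.single 0 r) \<otimes>\<^bsub>?Z\<^esub> gconst p = gconst (Poly_Mapping.single 0 r * p)"
      by (simp add: koszul_Z0_def gmono_mult)
    then show ?thesis
      unfolding koszul_H0_map_def cs_def rconst_def
      using h.hom_mult[OF in_Z[OF polys_const, of r] in_Z[OF that]] by simp
  qed
  have term_in: "koszul_H0_map n s f r \<otimes>\<^bsub>?H\<^esub> cs p \<in> carrier ?H" if "p \<in> ?R" for r p
    unfolding smult[OF that] carr using that by (intro imageI polys_mult) simp_all
  have sum_H: "(\<Oplus>\<^bsub>?H\<^esub>i\<in>A. koszul_H0_map n s f (c i) \<otimes>\<^bsub>?H\<^esub> cs (q i)) =
      cs (\<Sum>i\<in>A. Poly_Mapping.single 0 (c i) * q i)"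
    if "finite A" "\<forall>i\<in>A. q i \<in> ?R" for c q and A :: "'b set"
  proof -
    have q: "\<forall>i\<in>A. Poly_Mapping.single 0 (c i) * q i \<in> ?R"
      using that by (auto intro: polys_mult)
    have "cs (\<Sum>i\<in>A. Poly_Mapping.single 0 (c i) * q i) =
        ?I +>\<^bsub>?Z\<^esub> (\<Oplus>\<^bsub>?Z\<^esub>i\<in>A. gconst (Poly_Mapping.single 0 (c i) * q i))"
      using sum_Z[OF that(1) q] by (simp add: cs_def)
    also have "\<dots> = (\<Oplus>\<^bsub>?H\<^esub>i\<in>A. cs (Poly_Mapping.single 0 (c i) * q i))"
      unfolding cs_def by (subst h.hom_finsum) (use q in \<open>auto simp: o_def intro: in_Z\<close>)
    also have "\<dots> = (\<Oplus>\<^bsub>?H\<^esub>i\<in>A. koszul_H0_map n s f (c i) \<otimes>\<^bsub>?H\<^esub> cs (q i))"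
      by (rule h.S.finsum_cong') (use that term_in smult in auto)
    finally show ?thesis by simp
  qed
  have cs_eq: "cs p = cs q \<longleftrightarrow> (\<exists>g. (\<forall>i<s. g i \<in> ?R) \<and> p = q + (\<Sum>i<s. g i * f i))"
    if "p \<in> ?R" "q \<in> ?R" for p q
  proof -
    have "cs p = cs q \<longleftrightarrow> gconst p \<in> cs q"
    proof
      assume "cs p = cs q"
      then show "gconst p \<in> cs q" using I.a_rcos_self[OF in_Z[OF that(1)]] by (simp add: cs_def)
    next
      assume "gconst p \<in> cs q"
      then show "cs p = cs q"
        unfolding cs_def using I.a_repr_independence'[OF _ in_Z[OF that(2)], of "gconst p"] by simp
    qed
    also have "\<dots> \<longleftrightarrow> (\<exists>b\<in>?I. gconst p = b + gconst q)"
      unfolding cs_def a_r_coset_def' by (auto simp: koszul_Z0_def)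
    also have "\<dots> \<longleftrightarrow> (\<exists>g. (\<forall>i<s. g i \<in> ?R) \<and> gconst p = (gconst (q + (\<Sum>i<s. g i * f i)) :: 'r galg))"
      unfolding koszul_B0_eq by (auto simp: gmono_add add.commute)
    also have "\<dots> \<longleftrightarrow> (\<exists>g. (\<forall>i<s. g i \<in> ?R) \<and> p = q + (\<Sum>i<s. g i * f i))"
    proof -
      have "gconst x = (gconst y :: 'r galg) \<longleftrightarrow> x = y" for x y
        by (auto dest: arg_cong[of _ _ "\<lambda>a. gcoeff a {}"] simp: gcoeff_gmono)
      then show ?thesis by simp
    qed
    finally show ?thesis .
  qed
  show ?thesis
  proof
    assume ?lhs
    then obtain G where G: "finite G" "G \<subseteq> cs ` ?R"
      and gen: "\<forall>q\<in>cs ` ?R. \<exists>c. q = (\<Oplus>\<^bsub>?H\<^esub>g\<in>G. koszul_H0_map n s f (c g) \<otimes>\<^bsub>?H\<^esub> g)"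
      unfolding fin_gen_along_def carr by (elim exE conjE)
    obtain B where B: "B \<subseteq> ?R" "inj_on cs B" "G = cs ` B"
      using G(2) unfolding subset_image_inj by blast
    have "finite B" using G(1) B by (simp add: finite_image_iff)
    have "\<exists>c g. (\<forall>i<s. g i \<in> ?R) \<and> p = (\<Sum>b\<in>B. Poly_Mapping.single 0 (c b) * b) + (\<Sum>i<s. g i * f i)"
      if p: "p \<in> ?R" for p
    proof -
      obtain c where "cs p = (\<Oplus>\<^bsub>?H\<^esub>g\<in>G. koszul_H0_map n s f (c g) \<otimes>\<^bsub>?H\<^esub> g)"
        using bspec[OF gen imageI[OF p]] by (elim exE)
      also have "\<dots> = (\<Oplus>\<^bsub>?H\<^esub>b\<in>B. koszul_H0_map n s f (c (cs b)) \<otimes>\<^bsub>?H\<^esub> cs b)"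
        unfolding B(3) using term_in B by (intro h.S.finsum_reindex) auto
      also have "\<dots> = cs (\<Sum>b\<in>B. Poly_Mapping.single 0 (c (cs b)) * b)"
        by (rule sum_H) (use B \<open>finite B\<close> in auto)
      finally have "cs p = cs (\<Sum>b\<in>B. Poly_Mapping.single 0 (c (cs b)) * b)" .
      moreover have "(\<Sum>b\<in>B. Poly_Mapping.single 0 (c (cs b)) * b) \<in> ?R"
        using B by (auto intro!: polys_sum polys_mult)
      ultimately obtain g where "\<forall>i<s. g i \<in> ?R"
        "p = (\<Sum>b\<in>B. Poly_Mapping.single 0 (c (cs b)) * b) + (\<Sum>i<s. g i * f i)"
        using cs_eq[OF p] by blast
      then show ?thesis by (intro exI[of _ "\<lambda>b. c (cs b)"] exI[of _ g]) simp
    qed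
    then show ?rhs using \<open>finite B\<close> B(1) by blast
  next
    assume ?rhs
    then obtain B where B: "finite B" "B \<subseteq> ?R" and gen: "\<And>p. p \<in> ?R \<Longrightarrow>
        \<exists>c g. (\<forall>i<s. g i \<in> ?R) \<and> p = (\<Sum>b\<in>B. Poly_Mapping.single 0 (c b) * b) + (\<Sum>i<s. g i * f i)"
      by blast
    define r where "r = inv_into B cs"
    have r: "r g \<in> B" "cs (r g) = g" if "g \<in> cs ` B" for g
      using that by (simp_all add: r_def inv_into_into f_inv_into_f)
    have "\<exists>c. q = (\<Oplus>\<^bsub>?H\<^esub>g\<in>cs ` B. koszul_H0_map n s f (c g) \<otimes>\<^bsub>?H\<^esub> g)"
      if "q \<in> cs ` ?R" for q
    proof -
      from that obtain p where p: "p \<in> ?R" "q = cs p" by blast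
      obtain c g where cg: "\<forall>i<s. g i \<in> ?R"
        "p = (\<Sum>b\<in>B. Poly_Mapping.single 0 (c b) * b) + (\<Sum>i<s. g i * f i)"
        using gen[OF p(1)] by blast
      let ?c = "\<lambda>g. \<Sum>b\<in>{b \<in> B. cs b = g}. c b"
      have "(\<Sum>b\<in>B. Poly_Mapping.single 0 (c b) * b) \<in> ?R"
        using B by (intro polys_sum polys_mult) auto
      then have "q = cs (\<Sum>b\<in>B. Poly_Mapping.single 0 (c b) * b)"
        unfolding p(2) using cs_eq[OF p(1)] cg by blast
      also have "\<dots> = (\<Oplus>\<^bsub>?H\<^esub>b\<in>B. koszul_H0_map n s f (c b) \<otimes>\<^bsub>?H\<^esub> cs b)"
        by (rule sum_H[symmetric]) (use B in auto)
      also have "\<dots> = (\<Oplus>\<^bsub>?H\<^esub>b\<in>B. koszul_H0_map n s f (c b) \<otimes>\<^bsub>?H\<^esub> cs (r (cs b)))"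
        by (rule h.S.finsum_cong') (use term_in B r in auto)
      also have "\<dots> = cs (\<Sum>b\<in>B. Poly_Mapping.single 0 (c b) * r (cs b))"
        by (rule sum_H) (use B r in auto)
      also have "(\<Sum>b\<in>B. Poly_Mapping.single 0 (c b) * r (cs b)) =
          (\<Sum>g\<in>cs ` B. \<Sum>b\<in>{b \<in> B. cs b = g}. Poly_Mapping.single 0 (c b) * r (cs b))"
        by (rule sum.image_gen[OF B(1)])
      also have "\<dots> = (\<Sum>g\<in>cs ` B. Poly_Mapping.single 0 (?c g) * r g)"
      proof (rule sum.cong[OF refl])
        fix g
        have "Poly_Mapping.single 0 (sum c A) = (\<Sum>b\<in>A. Poly_Mapping.single 0 (c b) :: 'r mpol)" for A
          by (induction A rule: infinite_finite_induct) (auto simp: single_add)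
        then show "(\<Sum>b\<in>{b \<in> B. cs b = g}. Poly_Mapping.single 0 (c b) * r (cs b)) =
            Poly_Mapping.single 0 (?c g) * r g"
          by (simp add: sum_distrib_right)
      qed
      also have "cs \<dots> = (\<Oplus>\<^bsub>?H\<^esub>g\<in>cs ` B. koszul_H0_map n s f (?c g) \<otimes>\<^bsub>?H\<^esub> cs (r g))"
        by (rule sum_H[symmetric]) (use B r in auto)
      also have "\<dots> = (\<Oplus>\<^bsub>?H\<^esub>g\<in>cs ` B. koszul_H0_map n s f (?c g) \<otimes>\<^bsub>?H\<^esub> g)"
        by (rule h.S.finsum_cong') (use term_in B r in auto)
      finally show ?thesis by (rule exI[of _ ?c])
    qed
    then show ?lhs
      unfolding fin_gen_along_def carr using B by (intro exI[of _ "cs ` B"]) auto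
  qed
qed

text \<open>
  Functionals on the Koszul complex are represented by functions on the ambient algebra,
  of which only the values on the complex matter.
\<close>

definition koszul_dual :: "nat \<Rightarrow> nat \<Rightarrow> ('r::comm_ring_1 galg \<Rightarrow> 'r) set"
  where "koszul_dual n s = {L.
    (\<forall>a\<in>koszul n s. \<forall>b\<in>koszul n s. L (a + b) = L a + L b) \<and>
    (\<forall>r. \<forall>a\<in>koszul n s. L (rconst r * a) = r * L a)}"

definition dual_part :: "nat \<Rightarrow> ('r::comm_ring_1 galg \<Rightarrow> 'r) \<Rightarrow> 'r galg \<Rightarrow> 'r"
  where "dual_part p L = L \<circ> parity_part p"

definition dual_diff ::
  "(nat \<Rightarrow> 'r::comm_ring_1 mpol) \<Rightarrow> ('r galg \<Rightarrow> 'r) \<Rightarrow> 'r galg \<Rightarrow> 'r"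
  where "dual_diff f L a = (\<Sum>p<2. - ((- 1) ^ p) * dual_part p L (koszul_diff f a))"

definition koszul_dual_cycles ::
  "nat \<Rightarrow> nat \<Rightarrow> (nat \<Rightarrow> 'r::comm_ring_1 mpol) \<Rightarrow> ('r galg \<Rightarrow> 'r) set"
  where "koszul_dual_cycles n s f = {L \<in> koszul_dual n s. \<forall>a\<in>koszul n s. dual_diff f L a = 0}"


section \<open>The determinant and the contraction\<close>

definition det_product :: "nat \<Rightarrow> nat \<Rightarrow> (nat \<Rightarrow> nat \<Rightarrow> 'r::comm_ring_1 mpol) \<Rightarrow> 'r galg"
  where "det_product n s nabla =
    (\<Prod>i\<leftarrow>[0..<s]. (\<Sum>k<n. gvar (U k) * gconst (nabla k i)) + gvar (FX i) - gvar (FY i))"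

definition u_degree_part :: "nat \<Rightarrow> 'r::comm_ring_1 galg \<Rightarrow> 'r galg"
  where "u_degree_part d a = (\<Sum>K\<in>{K \<in> gsupp a. card (K \<inter> range U) = d}. gmono (gcoeff a K) K)"

definition koszul_det :: "nat \<Rightarrow> nat \<Rightarrow> (nat \<Rightarrow> nat \<Rightarrow> 'r::comm_ring_1 mpol) \<Rightarrow> 'r galg"
  where "koszul_det n s nabla = (THE D.
    D \<in> grassmann_over (X ` {..<n} \<union> Y ` {..<n}) (FX ` {..<s} \<union> FY ` {..<s}) \<and>
    (\<Prod>k\<leftarrow>[0..<n]. gvar (U k)) * D = u_degree_part n (det_product n s nabla))"
lemma prod_list_gvar_U:
  "(\<Prod>k\<leftarrow>[0..<n]. gvar (U k)) = (gmono 1 (U ` {..<n}) :: 'r::comm_ring_1 galg)"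
proof (induction n)
  case 0
  show ?case by (simp add: gmono_one)
next
  case (Suc n)
  have "gsign (U ` {..<n}) {U n} = (1 :: 'r mpol)"
  proof -
    have "{(i, j). i \<in> U ` {..<n} \<and> j \<in> {U n} \<and> j < i} = {}" by (auto simp: less_avar_def)
    then show ?thesis unfolding gsign_def by (simp only: card.empty power_0)
  qed
  then show ?case using Suc by (simp add: gmono_mult lessThan_Suc inj_image_mem_iff image_iff)
qed

lemma gcoeff_u_degree_part:
  "gcoeff (u_degree_part d a) K = (if card (K \<inter> range U) = d then gcoeff a K else 0)"
proof -
  have "gcoeff (u_degree_part d a) K =
      (\<Sum>L\<in>{L \<in> gsupp a. card (L \<inter> range U) = d}. if L = K then gcoeff a K else 0)"
    unfolding u_degree_part_def gcoeff_sum
    by (intro sum.cong) (auto simp: gcoeff_gmono gsupp_finite)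
  also have "\<dots> = (if card (K \<inter> range U) = d then gcoeff a K else 0)"
    by (subst sum.delta) (simp_all, auto simp: gsupp_def)
  finally show ?thesis .
qed

lemma gcoeff_U_mult:
  fixes D :: "'r::comm_ring_1 galg"
  assumes "\<And>K. gcoeff D K \<noteq> 0 \<Longrightarrow> K \<inter> range U = {}"
  shows "gcoeff (gmono 1 (U ` {..<n}) * D) L =
    (if U ` {..<n} \<subseteq> L then gcoeff D (L - U ` {..<n}) else 0)"
proof (cases "finite L")
  case True
  have sgn: "gsign (U ` {..<n}) K = (1 :: 'r mpol)" if "gcoeff D K \<noteq> 0" for K
  proof -
    have "U i \<notin> K" for i using assms[OF that] by auto
    moreover have "\<not> v < U i" if "v \<in> K" for v i
      using calculation that by (cases v) (auto simp: less_avar_def)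
    ultimately have "{(i, j). i \<in> U ` {..<n} \<and> j \<in> K \<and> j < i} = {}" by auto
    then show ?thesis unfolding gsign_def by (simp only: card.empty power_0)
  qed
  have "gcoeff (gmono 1 (U ` {..<n}) * D) L =
      (\<Sum>I\<in>Pow L. if I = U ` {..<n} then gcoeff D (L - U ` {..<n}) else 0)"
    unfolding times_grassmann.rep_eq
  proof (intro sum.cong refl)
    fix I
    show "gsign I (L - I) * gcoeff (gmono 1 (U ` {..<n})) I * gcoeff D (L - I) =
        (if I = U ` {..<n} then gcoeff D (L - U ` {..<n}) else 0)"
      using sgn by (cases "gcoeff D (L - I) = 0") (auto simp: gcoeff_gmono)
  qed
  then show ?thesis using True by simp
next
  case False
  then have "gcoeff D (L - U ` {..<n}) = 0" using gcoeff_nonzero_finite by fastforce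
  moreover have "gcoeff (gmono 1 (U ` {..<n}) * D) L = 0"
    using False gcoeff_nonzero_finite by blast
  ultimately show ?thesis by simp
qed

lemma det_product_in_grassmann_over:
  assumes "\<And>k i. k < n \<Longrightarrow> i < s \<Longrightarrow> nabla k i \<in> polys V"
  shows "det_product n s nabla \<in> grassmann_over V (U ` {..<n} \<union> (FX ` {..<s} \<union> FY ` {..<s}))"
  unfolding det_product_def
proof (rule grassmann_over_prod_list)
  fix a
  assume "a \<in> set (map (\<lambda>i. (\<Sum>k<n. gvar (U k) * gconst (nabla k i)) + gvar (FX i) - gvar (FY i)) [0..<s])"
  then obtain i where "i < s" and a: "a = (\<Sum>k<n. gvar (U k) * gconst (nabla k i)) + gvar (FX i) - gvar (FY i)"
    by auto
  then show "a \<in> grassmann_over V (U ` {..<n} \<union> (FX ` {..<s} \<union> FY ` {..<s}))"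
    unfolding a using assms
    by (intro grassmann_over_add grassmann_over_diff grassmann_over_sum grassmann_over_mult
        grassmann_over_gmono) auto
qed

lemma koszul_det_unique:
  fixes nabla :: "nat \<Rightarrow> nat \<Rightarrow> 'r::comm_ring_1 mpol"
  assumes nabla: "\<And>k i. k < n \<Longrightarrow> i < s \<Longrightarrow> nabla k i \<in> polys (X ` {..<n} \<union> Y ` {..<n})"
  shows "\<exists>!D. D \<in> grassmann_over (X ` {..<n} \<union> Y ` {..<n}) (FX ` {..<s} \<union> FY ` {..<s}) \<and>
    (\<Prod>k\<leftarrow>[0..<n]. gvar (U k)) * D = u_degree_part n (det_product n s nabla)"
proof -
  let ?V = "X ` {..<n} \<union> Y ` {..<n}" and ?F = "FX ` {..<s} \<union> FY ` {..<s}" and ?U = "U ` {..<n}"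
  let ?P = "det_product n s nabla"
  have P: "?P \<in> grassmann_over ?V (?U \<union> ?F)"
    using nabla by (rule det_product_in_grassmann_over)
  have noU: "K \<inter> range U = {}" if "D \<in> grassmann_over ?V ?F" "gcoeff D K \<noteq> 0" for K and D :: "'r galg"
    using that by (fastforce simp: grassmann_over_iff)
  have UD: "gcoeff (gmono 1 ?U * D) L = (if ?U \<subseteq> L then gcoeff D (L - ?U) else 0)"
    if "D \<in> grassmann_over ?V ?F" for L and D :: "'r galg"
    by (rule gcoeff_U_mult) (use noU that in blast)
  define D where "D = (\<Sum>L\<in>{L \<in> gsupp ?P. ?U \<subseteq> L}. gmono (gcoeff ?P L) (L - ?U))"
  have D_in: "D \<in> grassmann_over ?V ?F"
    unfolding D_def using P
    by (intro grassmann_over_sum grassmann_over_gmono) (auto simp: grassmann_over_def)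
  have D_coeff: "gcoeff D (L - ?U) = gcoeff ?P L" if "?U \<subseteq> L" for L
  proof -
    have "gcoeff D (L - ?U) = (\<Sum>M\<in>{L \<in> gsupp ?P. ?U \<subseteq> L}. if M = L then gcoeff ?P L else 0)"
      unfolding D_def gcoeff_sum using that
    proof (intro sum.cong refl)
      fix M assume M: "M \<in> {L \<in> gsupp ?P. ?U \<subseteq> L}"
      then have "L - ?U = M - ?U \<longleftrightarrow> M = L" using that by blast
      then show "gcoeff (gmono (gcoeff ?P M) (M - ?U)) (L - ?U) = (if M = L then gcoeff ?P L else 0)"
        using M by (auto simp: gcoeff_gmono gsupp_finite)
    qed
    then show ?thesis using that by (simp add: gsupp_def finite_gcoeff)
  qed
  have full: "?U \<subseteq> L \<longleftrightarrow> card (L \<inter> range U) = n" if "gcoeff ?P L \<noteq> 0" for L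
  proof -
    have sub: "L \<inter> range U \<subseteq> ?U" using P that by (fastforce simp: grassmann_over_iff)
    have card: "card ?U = n" by (simp add: card_image inj_on_def)
    show ?thesis
    proof
      assume "?U \<subseteq> L"
      then have "L \<inter> range U = ?U" using sub by blast
      then show "card (L \<inter> range U) = n" using card by simp
    next
      assume "card (L \<inter> range U) = n"
      then have "L \<inter> range U = ?U" using sub card by (intro card_subset_eq) auto
      then show "?U \<subseteq> L" by blast
    qed
  qed
  have D_eq: "gmono 1 ?U * D = u_degree_part n ?P"
  proof (rule grassmann_eqI)
    fix L
    show "gcoeff (gmono 1 ?U * D) L = gcoeff (u_degree_part n ?P) L"
      unfolding UD[OF D_in] gcoeff_u_degree_part using D_coeff full
      by (cases "gcoeff ?P L = 0") auto
  qed
  have uniq: "D' = D"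
    if D': "D' \<in> grassmann_over ?V ?F" "gmono 1 ?U * D' = gmono 1 ?U * D" for D'
  proof (rule grassmann_eqI)
    fix K
    show "gcoeff D' K = gcoeff D K"
    proof (cases "K \<inter> range U = {}")
      case True
      then have "K \<union> ?U - ?U = K" by auto
      then show ?thesis
        using arg_cong[OF D'(2), of "\<lambda>a. gcoeff a (K \<union> ?U)"] by (simp add: UD D'(1) D_in)
    next
      case False
      then have "gcoeff D' K = 0" "gcoeff D K = 0" using noU[OF D'(1)] noU[OF D_in] by blast+
      then show ?thesis by simp
    qed
  qed
  show ?thesis
    unfolding prod_list_gvar_U
  proof (rule ex1I)
    show "D \<in> grassmann_over ?V ?F \<and> gmono 1 ?U * D = u_degree_part n ?P"
      using D_in D_eq by blast
    fix D' assume "D' \<in> grassmann_over ?V ?F \<and> gmono 1 ?U * D' = u_degree_part n ?P"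
    then show "D' = D" using uniq D_eq by metis
  qed
qed

text \<open>
  \<open>extend_functional p e\<close> is the extension of a functional \<open>e\<close> of parity \<open>p\<close> on
  the Grassmann algebra in \<open>y, f\<^sub>y\<close> to the parameters \<open>x, f\<^sub>x\<close>.  It is
  given on each term \<open>(c x\<^sup>i f\<^sub>x\<^sup>I) (y\<^sup>j f\<^sub>y\<^sup>J)\<close>, with \<open>f\<^sub>x\<close> preceding \<open>f\<^sub>y\<close>
  as in the order of the variables.
\<close>

definition x_part :: "(cvar \<Rightarrow>\<^sub>0 nat) \<Rightarrow> (cvar \<Rightarrow>\<^sub>0 nat)"
  where "x_part m = (\<Sum>v\<in>Poly_Mapping.keys m \<inter> range X. Poly_Mapping.single v (Poly_Mapping.lookup m v))"

definition y_part :: "(cvar \<Rightarrow>\<^sub>0 nat) \<Rightarrow> (cvar \<Rightarrow>\<^sub>0 nat)"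
  where "y_part m = (\<Sum>v\<in>Poly_Mapping.keys m \<inter> range Y. Poly_Mapping.single v (Poly_Mapping.lookup m v))"

definition extend_functional :: "nat \<Rightarrow> ('r::comm_ring_1 galg \<Rightarrow> 'r) \<Rightarrow> 'r galg \<Rightarrow> 'r galg"
  where "extend_functional p e a =
    (\<Sum>K\<in>gsupp a. \<Sum>m\<in>Poly_Mapping.keys (gcoeff a K).
      gmono (Poly_Mapping.single (x_part m)
          ((- 1) ^ (p * card (K \<inter> range FX)) * Poly_Mapping.lookup (gcoeff a K) m *
            e (gmono (Poly_Mapping.single (y_part m) 1) (K \<inter> range FY))))
        (K \<inter> range FX))"

lemma lookup_x_part: "Poly_Mapping.lookup (x_part m) v = (if v \<in> range X then Poly_Mapping.lookup m v else 0)"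
proof -
  have "Poly_Mapping.lookup (x_part m) v =
      (\<Sum>w\<in>Poly_Mapping.keys m \<inter> range X. if w = v then Poly_Mapping.lookup m v else 0)"
    unfolding x_part_def lookup_sum by (intro sum.cong refl) (auto simp: lookup_single)
  then show ?thesis by (simp add: in_keys_iff)
qed

lemma lookup_y_part: "Poly_Mapping.lookup (y_part m) v = (if v \<in> range Y then Poly_Mapping.lookup m v else 0)"
proof -
  have "Poly_Mapping.lookup (y_part m) v =
      (\<Sum>w\<in>Poly_Mapping.keys m \<inter> range Y. if w = v then Poly_Mapping.lookup m v else 0)"
    unfolding y_part_def lookup_sum by (intro sum.cong refl) (auto simp: lookup_single)
  then show ?thesis by (simp add: in_keys_iff)
qed

lemma extend_functional_add:
  "extend_functional p e (a + b) = extend_functional p e a + extend_functional p e b"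
  unfolding extend_functional_def
  by (rule gsupp_sum_add, rule setsum_keys_plus_distrib)
    (simp_all add: algebra_simps single_add gmono_add)

lemma extend_functional_monomial:
  assumes "finite K"
  shows "extend_functional p e (gmono (Poly_Mapping.single m r) K) =
    gmono (Poly_Mapping.single (x_part m)
        ((- 1) ^ (p * card (K \<inter> range FX)) * r * e (gmono (Poly_Mapping.single (y_part m) 1) (K \<inter> range FY))))
      (K \<inter> range FX)"
  unfolding extend_functional_def
  by (subst gsupp_sum_gmono) (use assms in \<open>auto simp: lookup_single\<close>)

lemma grassmann_over_induct [consumes 1, case_names zero add monomial]:
  fixes a :: "'r::comm_ring_1 galg"
  assumes a: "a \<in> grassmann_over V G"
    and zero: "P 0" and add: "\<And>a b. P a \<Longrightarrow> P b \<Longrightarrow> P (a + b)"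
    and mono: "\<And>m r K. K \<in> gsupp a \<Longrightarrow> finite K \<Longrightarrow> K \<subseteq> G \<Longrightarrow> Poly_Mapping.keys m \<subseteq> V \<Longrightarrow>
      P (gmono (Poly_Mapping.single m r) K)"
  shows "P a"
proof -
  have sums: "P (sum h A)" if "\<And>i. i \<in> A \<Longrightarrow> P (h i)" for h :: "'i \<Rightarrow> 'r galg" and A
    using that by (induction A rule: infinite_finite_induct) (auto intro: zero add)
  have sums': "P (sum h A)" if "\<And>i. i \<in> A \<Longrightarrow> P (h i)" for h :: "'i \<Rightarrow> 'r galg" and A
    using that by (induction A rule: infinite_finite_induct) (auto intro: zero add)
  have "P (gmono c K)" if K: "K \<in> gsupp a" and c: "c = gcoeff a K" for c K
  proof -
    have "c = (\<Sum>m\<in>Poly_Mapping.keys c. Poly_Mapping.single m (Poly_Mapping.lookup c m))"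
    proof (rule poly_mapping_eqI)
      fix k
      have "(\<Sum>m\<in>Poly_Mapping.keys c. Poly_Mapping.lookup (Poly_Mapping.single m (Poly_Mapping.lookup c m)) k) =
          (\<Sum>m\<in>Poly_Mapping.keys c. if m = k then Poly_Mapping.lookup c k else 0)"
        by (intro sum.cong refl) (auto simp: lookup_single)
      then show "Poly_Mapping.lookup c k = Poly_Mapping.lookup
          (\<Sum>m\<in>Poly_Mapping.keys c. Poly_Mapping.single m (Poly_Mapping.lookup c m)) k"
        by (simp add: lookup_sum in_keys_iff)
    qed
    moreover have "gmono (sum h A) K = (\<Sum>m\<in>A. gmono (h m) K)"
      for h :: "(cvar \<Rightarrow>\<^sub>0 nat) \<Rightarrow> 'r mpol" and A
      by (induction A rule: infinite_finite_induct) (auto simp: gmono_add)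
    ultimately have "gmono c K =
        (\<Sum>m\<in>Poly_Mapping.keys c. gmono (Poly_Mapping.single m (Poly_Mapping.lookup c m)) K)"
      by metis
    moreover have "P \<dots>"
      using a K c by (intro sums mono) (auto simp: grassmann_over_def polys_def gsupp_finite)
    ultimately show ?thesis by simp
  qed
  then have "P (\<Sum>K\<in>gsupp a. gmono (gcoeff a K) K)" by (intro sums') simp
  then show ?thesis by (simp flip: gmono_expand)
qed

lemma extend_functional_mult:
  fixes \<theta> w :: "'r::comm_ring_1 galg"
  assumes \<theta>: "\<theta> \<in> grassmann_over (range X) (range FX)" "parity_part q \<theta> = \<theta>"
    and w: "w \<in> grassmann_over V G" and VG: "V \<subseteq> range Y" "G \<subseteq> range FY"
    and e_add: "\<And>a b. a \<in> grassmann_over V G \<Longrightarrow> b \<in> grassmann_over V G \<Longrightarrow> e (a + b) = e a + e b"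
    and e_scale: "\<And>r a. a \<in> grassmann_over V G \<Longrightarrow> e (rconst r * a) = r * e a"
  shows "extend_functional p e (\<theta> * w) = (- 1) ^ (p * q) * \<theta> * rconst (e w)"
proof -
  have e0: "e 0 = 0" using e_add[of 0 0] by simp
  have r0: "rconst 0 = (0 :: 'r galg)" and r_add: "rconst (r + r') = rconst r + (rconst r' :: 'r galg)" for r r'
    by (simp_all add: rconst_def single_add gmono_add)
  have E0: "extend_functional p e 0 = 0" using extend_functional_add[of p e 0 0] by simp
  have par: "card I mod 2 = q" if "I \<in> gsupp \<theta>" for I
    using that gcoeff_parity_part[of q \<theta> I] \<theta>(2) by (auto simp: gsupp_def split: if_splits)
  have mono: "extend_functional p e (gmono (Poly_Mapping.single m r) I * gmono (Poly_Mapping.single m' r') K) =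
      (- 1) ^ (p * q) * gmono (Poly_Mapping.single m r) I * rconst (e (gmono (Poly_Mapping.single m' r') K))"
    if I: "finite I" "I \<subseteq> range FX" "card I mod 2 = q" and m: "Poly_Mapping.keys m \<subseteq> range X"
      and K: "finite K" "K \<subseteq> G" and m': "Poly_Mapping.keys m' \<subseteq> V" for m r I m' r' K
  proof -
    have sets: "I \<inter> K = {}" "(I \<union> K) \<inter> range FX = I" "(I \<union> K) \<inter> range FY = K"
      using I K VG by auto
    have "{(i, j). i \<in> I \<and> j \<in> K \<and> j < i} = {}"
      using I K VG by (fastforce simp: less_avar_def)
    then have "gsign I K = (1 :: 'r mpol)" unfolding gsign_def by (simp only: card.empty power_0)
    then have prod: "gmono (Poly_Mapping.single m r) I * gmono (Poly_Mapping.single m' r') K =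
        gmono (Poly_Mapping.single (m + m') (r * r')) (I \<union> K)"
      using I K sets by (simp add: gmono_mult mult_single)
    have parts: "x_part (m + m') = m" "y_part (m + m') = m'"
    proof -
      have "Poly_Mapping.lookup m v = 0" if "v \<notin> range X" for v
        using that m by (auto simp: in_keys_iff)
      moreover have "Poly_Mapping.lookup m' v = 0" if "v \<notin> range Y" for v
        using that m' VG by (auto simp: in_keys_iff)
      moreover have "v \<in> range X \<longleftrightarrow> v \<notin> range Y" for v by (cases v) auto
      ultimately show "x_part (m + m') = m" "y_part (m + m') = m'"
        by (auto intro!: poly_mapping_eqI simp: lookup_x_part lookup_y_part lookup_add)
    qed
    have mono_in: "gmono (Poly_Mapping.single m' 1) K \<in> grassmann_over V G"
      using K m' by (intro grassmann_over_gmono) (auto simp: polys_def)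
    have "gmono (Poly_Mapping.single m' r') K = rconst r' * gmono (Poly_Mapping.single m' 1) K"
      using K by (simp add: rconst_def gmono_mult mult_single)
    then have e: "e (gmono (Poly_Mapping.single m' r') K) = r' * e (gmono (Poly_Mapping.single m' 1) K)"
      using e_scale[OF mono_in] by simp
    have sgn: "(- 1) ^ (p * card I) = ((- 1) ^ (p * q) :: 'a::comm_ring_1)"
      using I(3) by (auto simp: minus_one_power_iff)
    have gsgn: "(- 1) ^ k * gmono (Poly_Mapping.single m s) I = (gmono (Poly_Mapping.single m ((- 1) ^ k * s)) I :: 'r galg)" for k s
    proof -
      have "- gmono c I = (gmono (- c) I :: 'r galg)" for c
        by (rule grassmann_eqI) (simp add: gcoeff_gmono)
      then show ?thesis by (simp add: minus_one_power_iff single_uminus)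
    qed
    show ?thesis
      unfolding prod using I K
      by (simp add: extend_functional_monomial sets parts sgn e rconst_def gsgn gmono_mult mult_single mult_ac)
  qed
  have mono_w: "extend_functional p e (gmono (Poly_Mapping.single m r) I * w) =
      (- 1) ^ (p * q) * gmono (Poly_Mapping.single m r) I * rconst (e w)"
    if I: "finite I" "I \<subseteq> range FX" "card I mod 2 = q" and m: "Poly_Mapping.keys m \<subseteq> range X"
    for m r I
  proof -
    have "w \<in> grassmann_over V G \<and> extend_functional p e (gmono (Poly_Mapping.single m r) I * w) =
      (- 1) ^ (p * q) * gmono (Poly_Mapping.single m r) I * rconst (e w)"
      using w
    proof (induction w rule: grassmann_over_induct)
      case zero
      then show ?case by (simp add: e0 r0 E0)
    next
      case (add a b)
      then show ?case
        by (simp add: e_add grassmann_over_add distrib_left extend_functional_add r_add)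
    next
      case (monomial m' r' K)
      then show ?case using mono[OF I m, of K m' r r']
        by (auto simp: polys_def intro!: grassmann_over_gmono)
    qed
    then show ?thesis by blast
  qed
  from \<theta>(1) show ?thesis
  proof (induction rule: grassmann_over_induct)
    case zero
    then show ?case by (simp add: E0)
  next
    case (add a b)
    then show ?case by (simp add: distrib_left distrib_right extend_functional_add)
  next
    case (monomial m r I)
    then show ?case using mono_w par by blast
  qed
qed

text \<open>
  \<open>contract_y D e\<close> contracts \<open>D\<close> with the functional obtained from \<open>e\<close> by renaming
  \<open>x\<close> to \<open>y\<close>; it is extended additively to inhomogeneous arguments, with sign \<open>(-1)\<^sup>p\<^sup>q\<close> for \<open>e\<close> of parity \<open>p\<close>
  and \<open>D\<close> of parity \<open>q\<close>.
\<close>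

definition contract_y :: "'r::comm_ring_1 galg \<Rightarrow> ('r galg \<Rightarrow> 'r) \<Rightarrow> 'r galg"
  where "contract_y D e = (\<Sum>p<2. \<Sum>q<2.
    (- 1) ^ (q * p) * extend_functional p (dual_part p e \<circ> swap_xy) (parity_part q D))"

end

theory Submission
  imports Defs "Jordan_Normal_Form.Char_Poly"
begin

text \<open>
  Write \<open>I\<close> for the ideal of \<open>f\<^sub>1, \<dots>, f\<^sub>s\<close> in \<open>R[x]\<close>.  The root functional is obtained from a
  system for which everything is explicit.  Finite generation of \<open>R[x]/I\<close> makes every \<open>x\<^sub>k\<close>
  integral over \<open>R\<close> modulo \<open>I\<close>, so there are monic one-variable polynomials \<open>q\<^sub>k\<close> of positive
  degree \<open>d\<^sub>k\<close> with
  \<open>q\<^sub>k(x\<^sub>k) = \<Sum>\<^sub>i G\<^sub>k\<^sub>i f\<^sub>i\<close> (\<open>monic_relation_if_fin_gen\<close>).  For the system of the \<open>q\<^sub>k(x\<^sub>k)\<close> the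
  residue \<open>\<Lambda>\<close>, the coefficient of \<open>\<Prod>\<^sub>k y\<^sub>k\<^bsup>d\<^sub>k-1\<^esup>\<close> in the remainder modulo the \<open>q\<^sub>k(y\<^sub>k)\<close>, kills
  all multiples of the \<open>q\<^sub>k(y\<^sub>k)\<close> and maps the Bezoutian
  \<open>\<Prod>\<^sub>k (q\<^sub>k(y\<^sub>k) - q\<^sub>k(x\<^sub>k))/(y\<^sub>k - x\<^sub>k)\<close> to 1.

  The matrix \<open>G\<close> transports this functional to the Koszul complex of \<open>f\<close>: with
  \<open>\<gamma>\<^sub>k = \<Sum>\<^sub>i G\<^sub>k\<^sub>i f\<^sub>i\<^sub>,\<^sub>y\<close> (\<open>G\<close> taken at \<open>y\<close>, \<open>f\<^sub>i\<^sub>,\<^sub>y\<close> the Grassmann variable) and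
  \<open>\<Gamma> = \<gamma>\<^sub>1 \<dots> \<gamma>\<^sub>n\<close>, put \<open>e(w) = \<Lambda>(\<close>coefficient of \<open>f\<^sub>1\<^sub>,\<^sub>y \<dots> f\<^sub>s\<^sub>,\<^sub>y\<close> in \<open>\<Gamma> w)\<close>.
  It is a cycle (\<open>residue_functional_cycle\<close>): the product \<open>\<Gamma> w\<close> with \<open>w\<close> of degree \<open>s - n + 1\<close>
  vanishes for reasons of degree, and \<open>\<partial>\<Gamma>\<close> lies in the ideal of the \<open>\<partial>\<gamma>\<^sub>k = q\<^sub>k(y\<^sub>k)\<close>.

  The contraction of \<open>D\<close> with \<open>e\<close> is computed in \<open>contract_koszul_det\<close>.  The product
  defining \<open>D\<close> has the odd factors \<open>\<eta>\<^sub>i - f\<^sub>i\<^sub>,\<^sub>y\<close>, where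
  \<open>\<eta>\<^sub>i = \<Sum>\<^sub>l u\<^sub>l \<nabla>\<^sup>lf\<^sub>i + f\<^sub>i\<^sub>,\<^sub>x\<close>; each of them annihilates it, so that it acts as a delta function
  and \<open>f\<^sub>i\<^sub>,\<^sub>y\<close> may be replaced by \<open>\<eta>\<^sub>i\<close> in \<open>\<Gamma>\<close>.  All signs cancel and the contraction is
  \<open>\<Lambda>\<close> of the coefficient of \<open>u\<^sub>1 \<dots> u\<^sub>n\<close> in \<open>a\<^sub>1 \<dots> a\<^sub>n\<close>, where \<open>a\<^sub>k = \<Sum>\<^sub>i G\<^sub>k\<^sub>i(y) \<eta>\<^sub>i\<close>.

  It remains to compare this coefficient, the determinant of \<open>\<Sum>\<^sub>i G\<^sub>k\<^sub>i(y) \<nabla>\<^sup>lf\<^sub>i\<close>, with the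
  Bezoutian, which is the corresponding coefficient for the forms
  \<open>b\<^sub>k = u\<^sub>k (q\<^sub>k(y\<^sub>k) - q\<^sub>k(x\<^sub>k))/(y\<^sub>k - x\<^sub>k)\<close>.  Let \<open>\<partial>\<close> now be the odd derivation with
  \<open>u\<^sub>l \<mapsto> y\<^sub>l - x\<^sub>l\<close>.  The terms in \<open>f\<^sub>x\<close> do not affect the coefficient of \<open>u\<^sub>1 \<dots> u\<^sub>n\<close> and may be dropped.
  Modulo the ideal of the \<open>f\<^sub>i(x)\<close> and \<open>q\<^sub>k(y\<^sub>k)\<close> all \<open>\<partial>a\<^sub>k\<close> and \<open>\<partial>b\<^sub>k\<close> vanish, and
  \<open>a\<^sub>k - b\<^sub>k\<close> is a boundary because the Koszul complex of the regular sequence \<open>y\<^sub>l - x\<^sub>l\<close> is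
  exact in degree 1 (\<open>row_forms_homotopic\<close>).  Hence the two products differ by a boundary
  (\<open>prod_list_homotopic\<close>), and a boundary has no component of top degree in \<open>u\<close>.  So the
  contraction is congruent to \<open>\<Lambda>(Bezoutian) = 1\<close> modulo \<open>I\<close>, which is homology to 1.
\<close>

section \<open>Polynomials\<close>

abbreviation pconst :: "'r::comm_ring_1 \<Rightarrow> 'r mpol"
  where "pconst r \<equiv> Poly_Mapping.single 0 r"

definition pvar :: "cvar \<Rightarrow> 'r::comm_ring_1 mpol"
  where "pvar v = Poly_Mapping.single (Poly_Mapping.single v 1) 1"

lemma poly_mapping_sum_singles:
  "p = (\<Sum>m\<in>Poly_Mapping.keys p. Poly_Mapping.single m (Poly_Mapping.lookup p m))"
proof (rule poly_mapping_eqI)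
  fix k
  have "(\<Sum>m\<in>Poly_Mapping.keys p. Poly_Mapping.lookup (Poly_Mapping.single m (Poly_Mapping.lookup p m)) k) =
      (\<Sum>m\<in>Poly_Mapping.keys p. if m = k then Poly_Mapping.lookup p k else 0)"
    by (intro sum.cong refl) (auto simp: lookup_single)
  then show "Poly_Mapping.lookup p k = Poly_Mapping.lookup
      (\<Sum>m\<in>Poly_Mapping.keys p. Poly_Mapping.single m (Poly_Mapping.lookup p m)) k"
    by (simp add: lookup_sum in_keys_iff)
qed

lemma mpol_additive_induct [case_names zero add single]:
  fixes p :: "'a \<Rightarrow>\<^sub>0 'b::comm_monoid_add"
  assumes "P 0" and "\<And>p q. P p \<Longrightarrow> P q \<Longrightarrow> P (p + q)"
    and "\<And>m r. m \<in> Poly_Mapping.keys p \<Longrightarrow> P (Poly_Mapping.single m r)"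
  shows "P p"
proof -
  have "P (sum h A)" if "\<And>m. m \<in> A \<Longrightarrow> P (h m)" for h and A :: "'a set"
    using that by (induction A rule: infinite_finite_induct) (auto intro: assms)
  then have "P (\<Sum>m\<in>Poly_Mapping.keys p. Poly_Mapping.single m (Poly_Mapping.lookup p m))"
    using assms(3) .
  then show ?thesis by (simp only: poly_mapping_sum_singles[symmetric])
qed

lemma additive_eq_on_singles:
  fixes F G :: "('a \<Rightarrow>\<^sub>0 'b::comm_monoid_add) \<Rightarrow> 'c::ab_group_add"
  assumes "\<And>p q. F (p + q) = F p + F q" "\<And>p q. G (p + q) = G p + G q"
    and "\<And>m r. m \<in> Poly_Mapping.keys p \<Longrightarrow> F (Poly_Mapping.single m r) = G (Poly_Mapping.single m r)"
  shows "F p = G p"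
proof (induction p rule: mpol_additive_induct)
  case zero
  show ?case using assms(1)[of 0 0] assms(2)[of 0 0] by simp
next
  case (add p q)
  then show ?case by (simp only: assms(1,2))
next
  case (single m r)
  then show ?case by (rule assms(3))
qed

text \<open>
  Additive maps out of the polynomial ring are used throughout without being packaged as linear
  maps; identities between them, here multiplicativity, need only be checked on terms.
\<close>

lemma mult_hom_if_on_singles:
  fixes F :: "'r::comm_ring_1 mpol \<Rightarrow> 'b::comm_ring_1"
  assumes add: "\<And>p q. F (p + q) = F p + F q"
    and "\<And>m r m' r'. F (Poly_Mapping.single m r * Poly_Mapping.single m' r') =
      F (Poly_Mapping.single m r) * F (Poly_Mapping.single m' r')"
  shows "F (p * q) = F p * F q"
proof (rule additive_eq_on_singles[of "\<lambda>p. F (p * q)" "\<lambda>p. F p * F q"])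
  fix m r
  show "F (Poly_Mapping.single m r * q) = F (Poly_Mapping.single m r) * F q"
    by (rule additive_eq_on_singles[of "\<lambda>q. F (_ * q)"])
      (simp_all add: assms distrib_left)
qed (simp_all add: add distrib_right)

lemma polys_pvar: "v \<in> V \<Longrightarrow> pvar v \<in> polys V"
  by (simp add: polys_def pvar_def)

lemma polys_power: "p \<in> polys V \<Longrightarrow> p ^ k \<in> polys V"
  by (induction k) (auto intro: polys_mult)

lemma polys_prod: "(\<And>i. i \<in> A \<Longrightarrow> h i \<in> polys V) \<Longrightarrow> prod h A \<in> polys V"
  by (induction A rule: infinite_finite_induct) (auto intro: polys_mult)

lemma polys_diff: "p \<in> polys V \<Longrightarrow> q \<in> polys V \<Longrightarrow> p - q \<in> polys V"
  using polys_add[of p V "- q"] by simp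

lemma polys_mono: "p \<in> polys V \<Longrightarrow> V \<subseteq> W \<Longrightarrow> p \<in> polys W"
  unfolding polys_def by blast

lemma polys_UNIV [simp]: "p \<in> polys UNIV"
  by (simp add: polys_def)

lemma pvar_power: "pvar v ^ k = Poly_Mapping.single (Poly_Mapping.single v k) 1"
  by (induction k) (simp_all add: pvar_def mult_single flip: single_add)

lemma polys_induct [consumes 1, case_names const var add mult]:
  fixes p :: "'r::comm_ring_1 mpol"
  assumes p: "p \<in> polys V"
    and const: "\<And>r. P (pconst r)" and var: "\<And>v. v \<in> V \<Longrightarrow> P (pvar v)"
    and add: "\<And>p q. P p \<Longrightarrow> P q \<Longrightarrow> P (p + q)" and mult: "\<And>p q. P p \<Longrightarrow> P q \<Longrightarrow> P (p * q)"
  shows "P p"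
proof (induction p rule: mpol_additive_induct)
  case zero
  show ?case using const[of 0] by simp
next
  case (add p q)
  then show ?case by (rule assms(4))
next
  case (single m r)
  have power: "P (pvar v ^ k)" if "v \<in> V" for v k
    using const[of 1] by (induction k) (auto intro: mult var that)
  have "P (Poly_Mapping.single (\<Sum>v\<in>A. Poly_Mapping.single v (h v)) r)"
    if "finite A" "A \<subseteq> V" for A and h :: "cvar \<Rightarrow> nat"
    using that
  proof (induction A rule: finite_induct)
    case empty
    then show ?case by (simp add: const)
  next
    case (insert v A)
    then have "P (pvar v ^ h v * Poly_Mapping.single (\<Sum>v\<in>A. Poly_Mapping.single v (h v)) r)"
      by (intro mult power) auto
    then show ?case using insert by (simp add: pvar_power mult_single)
  qed
  moreover have "Poly_Mapping.keys m \<subseteq> V" using p single by (auto simp: polys_def)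
  ultimately have "P (Poly_Mapping.single
      (\<Sum>v\<in>Poly_Mapping.keys m. Poly_Mapping.single v (Poly_Mapping.lookup m v)) r)" by simp
  then show ?case by (simp only: poly_mapping_sum_singles[symmetric])
qed

text \<open>
  The \<open>R\<close>-algebra homomorphism with \<open>v \<mapsto> \<rho> v\<close>.  It serves for setting variables to 0 and
  for the partial diagonals \<open>y\<^sub>l := x\<^sub>l\<close>.
\<close>

definition subst_poly :: "(cvar \<Rightarrow> 'r mpol) \<Rightarrow> 'r::comm_ring_1 mpol \<Rightarrow> 'r mpol"
  where "subst_poly \<rho> p = (\<Sum>m\<in>Poly_Mapping.keys p.
    pconst (Poly_Mapping.lookup p m) * (\<Prod>v\<in>Poly_Mapping.keys m. \<rho> v ^ Poly_Mapping.lookup m v))"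

lemma subst_poly_add: "subst_poly \<rho> (p + q) = subst_poly \<rho> p + subst_poly \<rho> q"
  unfolding subst_poly_def
  by (rule setsum_keys_plus_distrib) (simp_all add: single_add algebra_simps)

lemma subst_poly_single:
  "subst_poly \<rho> (Poly_Mapping.single m r) = pconst r * (\<Prod>v\<in>Poly_Mapping.keys m. \<rho> v ^ Poly_Mapping.lookup m v)"
  by (simp add: subst_poly_def)

lemma subst_poly_pconst [simp]: "subst_poly \<rho> (pconst r) = pconst r"
  by (simp add: subst_poly_single)

lemma subst_poly_pvar [simp]: "subst_poly \<rho> (pvar v) = \<rho> v"
  by (simp add: subst_poly_single pvar_def)

lemma subst_poly_mult: "subst_poly \<rho> (p * q) = subst_poly \<rho> p * subst_poly \<rho> q"
proof (rule mult_hom_if_on_singles[of "subst_poly \<rho>", OF subst_poly_add])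
  fix m m' :: "cvar \<Rightarrow>\<^sub>0 nat" and r r' :: 'a
  let ?E = "\<lambda>A m. \<Prod>v\<in>A. \<rho> v ^ Poly_Mapping.lookup m v"
  let ?A = "Poly_Mapping.keys m \<union> Poly_Mapping.keys m'"
  have ext: "?E (Poly_Mapping.keys k) k = ?E ?A k" if "Poly_Mapping.keys k \<subseteq> ?A" for k :: "cvar \<Rightarrow>\<^sub>0 nat"
    by (rule prod.mono_neutral_left) (use that in \<open>auto simp: in_keys_iff\<close>)
  show "subst_poly \<rho> (Poly_Mapping.single m r * Poly_Mapping.single m' r') =
    subst_poly \<rho> (Poly_Mapping.single m r) * subst_poly \<rho> (Poly_Mapping.single m' r')"
    unfolding mult_single subst_poly_single
    using ext[of m] ext[of m'] ext[OF keys_add[of m m']]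
    by (simp add: lookup_add power_add prod.distrib mult_ac flip: mult_single[of 0 r 0 r', simplified])
qed

lemma subst_poly_zero [simp]: "subst_poly \<rho> 0 = 0" and subst_poly_one [simp]: "subst_poly \<rho> 1 = 1"
  using subst_poly_pconst[of \<rho> 0] subst_poly_pconst[of \<rho> 1] by simp_all

lemma subst_poly_uminus: "subst_poly \<rho> (- p) = - subst_poly \<rho> p"
  using subst_poly_add[of \<rho> p "- p"] by (simp add: eq_neg_iff_add_eq_0 add.commute)

lemma subst_poly_diff: "subst_poly \<rho> (p - q) = subst_poly \<rho> p - subst_poly \<rho> q"
  using subst_poly_add[of \<rho> p "- q"] by (simp add: subst_poly_uminus)

lemma subst_poly_sum: "subst_poly \<rho> (sum h A) = (\<Sum>i\<in>A. subst_poly \<rho> (h i))"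
  by (induction A rule: infinite_finite_induct) (auto simp: subst_poly_add)

lemma subst_poly_in_polys:
  assumes "p \<in> polys V" "\<And>v. v \<in> V \<Longrightarrow> \<rho> v \<in> polys W"
  shows "subst_poly \<rho> p \<in> polys W"
  using assms(1) by (induction rule: polys_induct) (auto simp: subst_poly_add subst_poly_mult intro: assms polys_add polys_mult)

lemma subst_poly_ident:
  assumes "p \<in> polys V" "\<And>v. v \<in> V \<Longrightarrow> \<rho> v = pvar v"
  shows "subst_poly \<rho> p = p"
  using assms(1) by (induction rule: polys_induct) (auto simp: subst_poly_add subst_poly_mult assms)

section \<open>Renaming of polynomials\<close>

lemma swap_cvar_involution [simp]: "swap_cvar (swap_cvar v) = v"
  by (cases v) auto

lemma map_key_swap_cvar_involution [simp]:
  "Poly_Mapping.map_key swap_cvar (Poly_Mapping.map_key swap_cvar m) = m"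
  by (rule poly_mapping_eqI) (simp add: map_key.rep_eq inj_swap_cvar)

lemma swap_poly_add: "swap_poly (p + q) = swap_poly p + swap_poly q"
  by (rule poly_mapping_eqI) (simp add: lookup_swap_poly lookup_add)

lemma swap_poly_single:
  "swap_poly (Poly_Mapping.single m r) = Poly_Mapping.single (Poly_Mapping.map_key swap_cvar m) r"
  by (rule poly_mapping_eqI) (auto simp: lookup_swap_poly lookup_single when_def)

lemma swap_poly_pconst [simp]: "swap_poly (pconst r) = pconst r"
  by (simp add: swap_poly_single inj_swap_cvar)

lemma swap_poly_mult: "swap_poly (p * q) = swap_poly p * swap_poly q"
  by (rule mult_hom_if_on_singles[of swap_poly, OF swap_poly_add])
    (simp add: mult_single swap_poly_single map_key_plus inj_swap_cvar)

lemma swap_poly_zero [simp]: "swap_poly 0 = 0"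
  by (rule poly_mapping_eqI) (simp add: lookup_swap_poly)

lemma swap_poly_sum: "swap_poly (sum h A) = (\<Sum>i\<in>A. swap_poly (h i))"
  by (induction A rule: infinite_finite_induct) (auto simp: swap_poly_add)

lemma swap_poly_involution [simp]: "swap_poly (swap_poly p) = p"
  by (rule poly_mapping_eqI) (simp add: lookup_swap_poly)

lemma swap_poly_pvar: "swap_poly (pvar v) = pvar (swap_cvar v)"
proof -
  have "Poly_Mapping.map_key swap_cvar (Poly_Mapping.single v (1::nat)) = Poly_Mapping.single (swap_cvar v) 1"
    using map_key_single[OF inj_swap_cvar, of "swap_cvar v" "1::nat"] by simp
  then show ?thesis by (simp only: swap_poly_single pvar_def)
qed

lemma swap_poly_in_polys: "p \<in> polys V \<Longrightarrow> swap_poly p \<in> polys (swap_cvar ` V)"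
proof (induction rule: polys_induct)
  case (var v)
  then show ?case by (simp only: swap_poly_pvar polys_pvar imageI)
qed (auto simp: swap_poly_add swap_poly_mult intro: polys_add polys_mult)

section \<open>The residue of a system of monic one-variable polynomials\<close>

definition at_poly :: "'r::comm_ring_1 poly \<Rightarrow> 'r mpol \<Rightarrow> 'r mpol"
  where "at_poly q p = (\<Sum>i\<le>degree q. pconst (Polynomial.coeff q i) * p ^ i)"

text \<open>
  The coefficient of \<open>t\<^bsup>d-1\<^esup>\<close> in the remainder of \<open>t\<^sup>j\<close> modulo a monic \<open>q\<close> of degree \<open>d\<close>, given by
  the linear recurrence that \<open>q\<close> imposes on these numbers.  The inner conditional only makes
  termination evident.
\<close>

fun top_rem_coeff :: "'r::comm_ring_1 poly \<Rightarrow> nat \<Rightarrow> 'r" where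
  "top_rem_coeff q j = (if j < degree q then (if Suc j = degree q then 1 else 0)
    else - (\<Sum>i<degree q. if degree q = 0 then 0 else Polynomial.coeff q i * top_rem_coeff q (j - degree q + i)))"

declare top_rem_coeff.simps [simp del]

lemma top_rem_coeff_recurrence:
  assumes "Polynomial.coeff q (degree q) = 1"
  shows "(\<Sum>i\<le>degree q. Polynomial.coeff q i * top_rem_coeff q (j + i)) = 0"
proof -
  have "top_rem_coeff q (j + degree q) = - (\<Sum>i<degree q. Polynomial.coeff q i * top_rem_coeff q (j + i))"
    by (subst top_rem_coeff.simps) simp
  moreover have "{..degree q} = insert (degree q) {..<degree q}" by auto
  ultimately show ?thesis using assms by simp
qed

lemma top_rem_coeff_low: "j < degree q \<Longrightarrow> top_rem_coeff q j = (if Suc j = degree q then 1 else 0)"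
  by (subst top_rem_coeff.simps) simp

text \<open>
  The map \<open>v\<^sup>j \<mapsto> t j\<close>, linear over the polynomials in the other variables.
\<close>

definition contract_pow :: "(nat \<Rightarrow> 'r) \<Rightarrow> cvar \<Rightarrow> 'r::comm_ring_1 mpol \<Rightarrow> 'r mpol"
  where "contract_pow t v p = (\<Sum>m\<in>Poly_Mapping.keys p.
    Poly_Mapping.single (m - Poly_Mapping.single v (Poly_Mapping.lookup m v))
      (t (Poly_Mapping.lookup m v) * Poly_Mapping.lookup p m))"

lemma contract_pow_add: "contract_pow t v (p + q) = contract_pow t v p + contract_pow t v q"
  unfolding contract_pow_def
  by (rule setsum_keys_plus_distrib) (simp_all add: single_add algebra_simps)

lemma contract_pow_single:
  "contract_pow t v (Poly_Mapping.single m r) =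
    Poly_Mapping.single (m - Poly_Mapping.single v (Poly_Mapping.lookup m v)) (t (Poly_Mapping.lookup m v) * r)"
  by (simp add: contract_pow_def)

lemma contract_pow_mult:
  assumes "c \<in> polys V" "v \<notin> V"
  shows "contract_pow t v (c * p) = c * contract_pow t v p"
proof (rule additive_eq_on_singles[of "\<lambda>c. contract_pow t v (c * p)" "\<lambda>c. c * contract_pow t v p"])
  fix m r assume "m \<in> Poly_Mapping.keys c"
  then have m: "Poly_Mapping.lookup m v = 0"
    using assms by (fastforce simp: polys_def simp flip: not_in_keys_iff_lookup_eq_zero)
  show "contract_pow t v (Poly_Mapping.single m r * p) = Poly_Mapping.single m r * contract_pow t v p"
  proof (rule additive_eq_on_singles[of "\<lambda>p. contract_pow t v (_ * p)"])
    fix m' r'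
    have "m + m' - Poly_Mapping.single v (Poly_Mapping.lookup m' v) =
        m + (m' - Poly_Mapping.single v (Poly_Mapping.lookup m' v))"
      by (rule poly_mapping_eqI) (auto simp: lookup_minus lookup_add lookup_single m when_def)
    then show "contract_pow t v (Poly_Mapping.single m r * Poly_Mapping.single m' r') =
        Poly_Mapping.single m r * contract_pow t v (Poly_Mapping.single m' r')"
      by (simp add: mult_single contract_pow_single lookup_add m mult.left_commute)
  qed (simp_all add: distrib_left contract_pow_add)
qed (simp_all add: distrib_right contract_pow_add)

lemma contract_pow_power: "contract_pow t v (pvar v ^ j) = pconst (t j)"
  by (simp add: pvar_power contract_pow_single)

lemma contract_pow_zero [simp]: "contract_pow t v 0 = 0"
  by (simp add: contract_pow_def)

lemma contract_pow_sum: "contract_pow t v (sum h A) = (\<Sum>i\<in>A. contract_pow t v (h i))"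
  by (induction A rule: infinite_finite_induct) (auto simp: contract_pow_add)

lemma contract_pow_in_polys: "p \<in> polys V \<Longrightarrow> contract_pow t v p \<in> polys (V - {v})"
  unfolding contract_pow_def
proof (rule polys_sum)
  fix m assume "p \<in> polys V" "m \<in> Poly_Mapping.keys p"
  then have "Poly_Mapping.keys m \<subseteq> V" by (simp add: polys_def)
  then have "Poly_Mapping.keys (m - Poly_Mapping.single v (Poly_Mapping.lookup m v)) \<subseteq> V - {v}"
    by (auto simp: in_keys_iff lookup_minus lookup_single when_def subset_iff split: if_splits)
  then show "Poly_Mapping.single (m - Poly_Mapping.single v (Poly_Mapping.lookup m v)) r \<in> polys (V - {v})" for r
    by (simp add: polys_def)
qed

lemma contract_pow_const_mult: "contract_pow t v (pconst r * p) = pconst r * contract_pow t v p"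
  by (rule contract_pow_mult[of _ "{}"]) simp_all

text \<open>
  On \<open>v\<^sup>j q(v)\<close> the value is the left side of the recurrence for \<open>top_rem_coeff\<close>.
\<close>

lemma contract_pow_at_poly:
  fixes q :: "'r::comm_ring_1 poly"
  assumes "Polynomial.coeff q (degree q) = 1"
  shows "contract_pow (top_rem_coeff q) v (at_poly q (pvar v) * p) = 0"
proof (rule additive_eq_on_singles[of "\<lambda>p. contract_pow (top_rem_coeff q) v (_ * p)" "\<lambda>p. 0"])
  fix m :: "cvar \<Rightarrow>\<^sub>0 nat" and r :: 'r
  let ?j = "Poly_Mapping.lookup m v"
  let ?m = "m - Poly_Mapping.single v ?j"
  have m: "m = ?m + Poly_Mapping.single v ?j"
    by (rule poly_mapping_eqI) (auto simp: lookup_minus lookup_add lookup_single when_def)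
  have c: "Poly_Mapping.single ?m r \<in> polys (- {v})"
    by (auto simp: polys_def in_keys_iff lookup_minus split: if_splits)
  have "Poly_Mapping.single m r = Poly_Mapping.single ?m r * pvar v ^ ?j"
    unfolding pvar_power mult_single by (subst m) simp
  then have "at_poly q (pvar v) * Poly_Mapping.single m r =
      Poly_Mapping.single ?m r * (\<Sum>i\<le>degree q. pconst (Polynomial.coeff q i) * pvar v ^ (?j + i))"
    by (simp add: at_poly_def sum_distrib_left sum_distrib_right power_add mult_ac)
  also have "contract_pow (top_rem_coeff q) v \<dots> =
      Poly_Mapping.single ?m r * (\<Sum>i\<le>degree q. pconst (Polynomial.coeff q i) * pconst (top_rem_coeff q (?j + i)))"
    by (simp add: contract_pow_mult[OF c] contract_pow_sum contract_pow_const_mult contract_pow_power)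
  also have "(\<Sum>i\<le>degree q. pconst (Polynomial.coeff q i) * pconst (top_rem_coeff q (?j + i))) =
      pconst (\<Sum>i\<le>degree q. Polynomial.coeff q i * top_rem_coeff q (?j + i))"
    by (rule poly_mapping_eqI) (simp add: mult_single lookup_sum lookup_single when_def)
  also have "\<dots> = 0" by (simp add: top_rem_coeff_recurrence[OF assms])
  finally show "contract_pow (top_rem_coeff q) v (at_poly q (pvar v) * Poly_Mapping.single m r) = 0" by simp
qed (simp_all add: distrib_left contract_pow_add)

text \<open>
  \<open>(q(b) - q(a))/(b - a)\<close>, written out so that no division is needed.
\<close>

definition diff_quotient :: "'r::comm_ring_1 poly \<Rightarrow> 'r mpol \<Rightarrow> 'r mpol \<Rightarrow> 'r mpol"
  where "diff_quotient q a b = (\<Sum>i\<le>degree q. pconst (Polynomial.coeff q i) * (\<Sum>j<i. b ^ j * a ^ (i - Suc j)))"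

lemma diff_quotient: "(b - a) * diff_quotient q a b = at_poly q b - at_poly q a"
proof -
  have "(b - a) * (c * (\<Sum>j<i. b ^ j * a ^ (i - Suc j))) = c * b ^ i - c * a ^ i" for c i
    by (simp add: power_diff_sumr2[of b i a] right_diff_distrib[symmetric] mult_ac)
  then show ?thesis
    by (simp add: diff_quotient_def at_poly_def sum_distrib_left sum_subtractf)
qed

text \<open>
  The difference quotient has degree \<open>d - 1\<close> in \<open>v\<close>, where only the leading coefficient 1 of
  \<open>q\<close> contributes; \<open>top_rem_coeff\<close> vanishes on all smaller powers.
\<close>

lemma contract_pow_diff_quotient:
  assumes q: "Polynomial.coeff q (degree q) = 1" "degree q > 0" and a: "a \<in> polys V" "v \<notin> V"
  shows "contract_pow (top_rem_coeff q) v (diff_quotient q a (pvar v)) = 1"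
proof -
  have "contract_pow (top_rem_coeff q) v (diff_quotient q a (pvar v)) =
    (\<Sum>i\<le>degree q. pconst (Polynomial.coeff q i) * (\<Sum>j<i. a ^ (i - Suc j) * pconst (top_rem_coeff q j)))"
    unfolding diff_quotient_def using a
    by (simp add: contract_pow_sum contract_pow_const_mult mult.commute[of "_ ^ _" "a ^ _"]
      contract_pow_mult[OF polys_power] contract_pow_power)
  also have "\<dots> = (\<Sum>i\<le>degree q. if i = degree q then 1 else 0)"
  proof (rule sum.cong[OF refl])
    fix i assume i: "i \<in> {..degree q}"
    have "(\<Sum>j<i. a ^ (i - Suc j) * pconst (top_rem_coeff q j)) =
        (\<Sum>j<i. if Suc j = degree q then 1 else 0)"
      using i by (intro sum.cong refl) (auto simp: top_rem_coeff_low)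
    also have "\<dots> = (\<Sum>j<i. if j = degree q - 1 then 1 else 0)"
      using q(2) by (intro sum.cong refl) auto
    also have "\<dots> = (if i = degree q then 1 else 0)" using i q(2) by auto
    finally show "pconst (Polynomial.coeff q i) * (\<Sum>j<i. a ^ (i - Suc j) * pconst (top_rem_coeff q j)) =
        (if i = degree q then 1 else 0)" using q(1) by simp
  qed
  finally show ?thesis by simp
qed

lemma at_poly_in_polys: "p \<in> polys V \<Longrightarrow> at_poly q p \<in> polys V"
  unfolding at_poly_def by (intro polys_sum polys_mult polys_power) auto

lemma diff_quotient_in_polys: "a \<in> polys V \<Longrightarrow> b \<in> polys V \<Longrightarrow> diff_quotient q a b \<in> polys V"
  unfolding diff_quotient_def by (intro polys_sum polys_mult polys_power) auto

text \<open>
  The iterated residue in \<open>y\<^sub>0, \<dots>, y\<^sub>n\<^sub>-\<^sub>1\<close>, a map \<open>R[x,y] \<rightarrow> R[x]\<close> linear over \<open>R[x]\<close>.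
\<close>

fun y_residue :: "(nat \<Rightarrow> 'r::comm_ring_1 poly) \<Rightarrow> nat \<Rightarrow> 'r mpol \<Rightarrow> 'r mpol" where
  "y_residue q 0 p = p"
| "y_residue q (Suc k) p = y_residue q k (contract_pow (top_rem_coeff (q k)) (Y k) p)"

lemma y_residue_add: "y_residue q n (a + b) = y_residue q n a + y_residue q n b"
  by (induction n arbitrary: a b) (simp_all add: contract_pow_add)

lemma y_residue_zero [simp]: "y_residue q n 0 = 0"
  by (induction n) simp_all

lemma y_residue_uminus: "y_residue q n (- a) = - y_residue q n a"
  using y_residue_add[of q n a "- a"] by (simp add: eq_neg_iff_add_eq_0 add.commute)

lemma y_residue_diff: "y_residue q n (a - b) = y_residue q n a - y_residue q n b"
  using y_residue_add[of q n a "- b"] by (simp add: y_residue_uminus)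

lemma y_residue_mult:
  assumes "c \<in> polys (range X)"
  shows "y_residue q n (c * p) = c * y_residue q n p"
  by (induction n arbitrary: p) (auto simp: contract_pow_mult[OF assms] image_iff)

lemma y_residue_in_polys: "p \<in> polys V \<Longrightarrow> y_residue q n p \<in> polys (V - Y ` {..<n})"
proof (induction n arbitrary: p V)
  case (Suc n)
  have eq: "V - {Y n} - Y ` {..<n} = V - Y ` {..<Suc n}" by (auto simp: lessThan_Suc)
  show ?case
    using Suc.IH[OF contract_pow_in_polys[OF Suc.prems, of "top_rem_coeff (q n)" "Y n"]] unfolding eq by simp
qed simp

lemma y_residue_at_poly:
  assumes "k < n" "Polynomial.coeff (q k) (degree (q k)) = 1"
  shows "y_residue q n (at_poly (q k) (pvar (Y k)) * p) = 0"
  using assms(1)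
proof (induction n arbitrary: p)
  case (Suc n)
  show ?case
  proof (cases "k = n")
    case True
    then show ?thesis using contract_pow_at_poly[OF assms(2)] by simp
  next
    case False
    have "at_poly (q k) (pvar (Y k)) \<in> polys {Y k}"
      by (intro at_poly_in_polys polys_pvar) simp
    then show ?thesis using Suc False by (simp add: contract_pow_mult)
  qed
qed simp

text \<open>
  The Bezoutian of a system with separated variables is a product of difference quotients, each
  of which has residue 1 in its own variable and is a constant for the other residues.
\<close>

lemma y_residue_diff_quotient:
  assumes "\<And>k. k < n \<Longrightarrow> Polynomial.coeff (q k) (degree (q k)) = 1 \<and> degree (q k) > 0"
  shows "y_residue q n (\<Prod>k<n. diff_quotient (q k) (pvar (X k)) (pvar (Y k))) = 1"
  using assms
proof (induction n)
  case (Suc n)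
  have c: "(\<Prod>k<n. diff_quotient (q k) (pvar (X k)) (pvar (Y k))) \<in> polys (UNIV - {Y n})"
    by (intro polys_prod diff_quotient_in_polys polys_pvar) auto
  have "contract_pow (top_rem_coeff (q n)) (Y n) (diff_quotient (q n) (pvar (X n)) (pvar (Y n))) = 1"
    using Suc.prems[of n] by (intro contract_pow_diff_quotient[of _ _ "{X n}"] polys_pvar) auto
  then show ?case using Suc by (simp add: contract_pow_mult[OF c])
qed simp

section \<open>Monic relations modulo the ideal\<close>

text \<open>
  The coefficients range over all polynomials in all variables, which makes this a genuine ideal
  of the ambient ring; \<open>gen_ideal_coefficients_in_polys\<close> recovers coefficients in \<open>R[x]\<close>.
\<close>

definition gen_ideal :: "nat \<Rightarrow> (nat \<Rightarrow> 'r::comm_ring_1 mpol) \<Rightarrow> 'r mpol set"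
  where "gen_ideal s f = {\<Sum>i<s. h i * f i | h. True}"

lemma gen_ideal_zero [simp]: "0 \<in> gen_ideal s f"
  unfolding gen_ideal_def by (intro CollectI exI[of _ "\<lambda>_. 0"]) simp

lemma gen_ideal_add: "a \<in> gen_ideal s f \<Longrightarrow> b \<in> gen_ideal s f \<Longrightarrow> a + b \<in> gen_ideal s f"
  unfolding gen_ideal_def
proof (elim CollectE exE conjE)
  fix h h' assume "a = (\<Sum>i<s. h i * f i)" "b = (\<Sum>i<s. h' i * f i)"
  then show "a + b \<in> {\<Sum>i<s. h i * f i | h. True}"
    by (intro CollectI exI[of _ "\<lambda>i. h i + h' i"]) (simp add: distrib_right sum.distrib)
qed

lemma gen_ideal_mult: "a \<in> gen_ideal s f \<Longrightarrow> c * a \<in> gen_ideal s f"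
  unfolding gen_ideal_def
proof (elim CollectE exE conjE)
  fix h assume "a = (\<Sum>i<s. h i * f i)"
  then show "c * a \<in> {\<Sum>i<s. h i * f i | h. True}"
    by (intro CollectI exI[of _ "\<lambda>i. c * h i"]) (simp add: sum_distrib_left mult.assoc)
qed

lemma gen_ideal_sum: "(\<And>i. i \<in> A \<Longrightarrow> h i \<in> gen_ideal s f) \<Longrightarrow> sum h A \<in> gen_ideal s f"
  by (induction A rule: infinite_finite_induct) (auto intro: gen_ideal_add)

lemma gen_ideal_generator:
  assumes "i < s"
  shows "f i \<in> gen_ideal s f"
proof -
  have "(\<Sum>j<s. (if j = i then 1 else 0) * f j) = (\<Sum>j<s. if j = i then f i else 0)"
    by (intro sum.cong) auto
  also have "\<dots> = f i" using assms by simp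
  finally show ?thesis
    unfolding gen_ideal_def by (intro CollectI exI[of _ "\<lambda>j. if j = i then 1 else 0"]) simp
qed

text \<open>
  Setting the variables outside \<open>V\<close> to 0 fixes \<open>p\<close> and all \<open>f\<^sub>i\<close>.
\<close>

lemma gen_ideal_coefficients_in_polys:
  fixes f :: "nat \<Rightarrow> 'r::comm_ring_1 mpol"
  assumes f: "\<And>i. i < s \<Longrightarrow> f i \<in> polys V" and p: "p \<in> gen_ideal s f" "p \<in> polys V"
  shows "\<exists>h. (\<forall>i. h i \<in> polys V) \<and> p = (\<Sum>i<s. h i * f i)"
proof -
  let ?\<rho> = "\<lambda>v. if v \<in> V then pvar v else (0 :: 'r mpol)"
  obtain h where h: "p = (\<Sum>i<s. h i * f i)" using p(1) by (auto simp: gen_ideal_def)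
  have "p = subst_poly ?\<rho> p" using p(2) by (simp add: subst_poly_ident)
  also have "\<dots> = (\<Sum>i<s. subst_poly ?\<rho> (h i) * f i)"
    unfolding h subst_poly_sum subst_poly_mult using subst_poly_ident[OF f, of _ ?\<rho>] by (intro sum.cong refl) simp
  finally have "p = (\<Sum>i<s. subst_poly ?\<rho> (h i) * f i)" .
  moreover have "subst_poly ?\<rho> (h i) \<in> polys V" for i
    by (rule subst_poly_in_polys[of _ UNIV]) (auto intro: polys_pvar)
  ultimately show ?thesis by (intro exI[of _ "\<lambda>i. subst_poly ?\<rho> (h i)"]) blast
qed

lemma pconst_eq_zero_iff [simp]: "pconst r = 0 \<longleftrightarrow> r = 0"
  by (metis lookup_single_eq lookup_zero single_zero)

lemma at_poly_eq_poly: "at_poly q p = poly (map_poly pconst q) p"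
proof -
  have "degree (map_poly pconst q) = degree q"
    by (rule degree_map_poly) simp
  then show ?thesis by (simp add: poly_altdef at_poly_def coeff_map_poly)
qed

lemma pconst_hom: "comm_ring_hom (pconst :: 'r::comm_ring_1 \<Rightarrow> _)"
  by standard (simp_all add: single_add mult_single)

lemma at_poly_hom: "comm_ring_hom (\<lambda>q :: 'r::comm_ring_1 poly. at_poly q p)"
proof -
  interpret c: comm_ring_hom "pconst :: 'r \<Rightarrow> _" by (rule pconst_hom)
  interpret m: map_poly_comm_ring_hom "pconst :: 'r \<Rightarrow> 'r mpol" ..
  show ?thesis
    by standard (simp_all add: at_poly_eq_poly m.hom_add m.hom_mult)
qed

text \<open>
  The determinant trick: multiplication by \<open>z\<close> acts on the generators \<open>b\<^sub>j\<close> through the matrix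
  \<open>c\<close>, so the characteristic polynomial of \<open>c\<close> at \<open>z\<close> annihilates all \<open>b\<^sub>j\<close>, hence also 1,
  modulo the ideal.
\<close>

lemma monic_relation_of_linear_system:
  fixes b :: "nat \<Rightarrow> 'r::comm_ring_1 mpol"
  assumes z: "\<And>i. i < m \<Longrightarrow> z * b i - (\<Sum>j<m. pconst (c i j) * b j) \<in> gen_ideal s f"
    and one: "1 - (\<Sum>j<m. pconst (d j) * b j) \<in> gen_ideal s f"
  shows "\<exists>q. Polynomial.coeff q (degree q) = 1 \<and> degree q > 0 \<and> at_poly q z \<in> gen_ideal s f"
proof -
  interpret E: comm_ring_hom "\<lambda>q :: 'r poly. at_poly q z" by (rule at_poly_hom)
  define C where "C = mat m m (\<lambda>(i, j). c i j)"
  define Q where "Q = map_mat (\<lambda>q. at_poly q z) (char_poly_matrix C)"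
  have C: "C \<in> carrier_mat m m" by (simp add: C_def)
  have Q: "Q \<in> carrier_mat m m" using C by (simp add: Q_def)
  have detQ: "det Q = at_poly (char_poly C) z"
    by (simp add: Q_def char_poly_def E.hom_det)
  have Q_entry: "Q $$ (i, j) = (if i = j then z else 0) - pconst (c i j)" if "i < m" "j < m" for i j
  proof -
    have "at_poly [:r:] z = pconst r" for r :: 'r by (simp add: at_poly_def)
    moreover have "at_poly [:0, 1:] z = z" by (simp add: at_poly_eq_poly)
    moreover have "char_poly_matrix C $$ (i, j) = (if i = j then [:0, 1:] else 0) + [:- c i j:]"
      using that by (simp add: char_poly_matrix_def C_def)
    moreover have "Q $$ (i, j) = at_poly (char_poly_matrix C $$ (i, j)) z"
      using that char_poly_matrix_closed[OF C] by (simp add: Q_def)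
    ultimately show ?thesis by (simp add: E.hom_add single_uminus)
  qed
  have Qb: "(\<Sum>j<m. Q $$ (l, j) * b j) \<in> gen_ideal s f" if "l < m" for l
  proof -
    have "(\<Sum>j<m. Q $$ (l, j) * b j) =
        (\<Sum>j<m. (if j = l then z * b l else 0) - pconst (c l j) * b j)"
      using that by (intro sum.cong refl) (auto simp: Q_entry left_diff_distrib)
    also have "\<dots> = z * b l - (\<Sum>j<m. pconst (c l j) * b j)"
      using that by (simp add: sum_subtractf)
    finally show ?thesis using z[OF that] by simp
  qed
  have det_b: "det Q * b i \<in> gen_ideal s f" if i: "i < m" for i
  proof -
    have entry: "(\<Sum>l<m. adj_mat Q $$ (i, l) * Q $$ (l, j)) = (if j = i then det Q else 0)" if "j < m" for j
    proof -
      have "(adj_mat Q * Q) $$ (i, j) = (\<Sum>l<m. adj_mat Q $$ (i, l) * Q $$ (l, j))"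
        using i that Q adj_mat(1)[OF Q] by (simp add: scalar_prod_def atLeast0LessThan)
      then show ?thesis using adj_mat(3)[OF Q] i that by (cases "j = i") simp_all
    qed
    have "(\<Sum>l<m. adj_mat Q $$ (i, l) * (\<Sum>j<m. Q $$ (l, j) * b j)) =
        (\<Sum>l<m. \<Sum>j<m. adj_mat Q $$ (i, l) * Q $$ (l, j) * b j)"
      by (simp add: sum_distrib_left mult.assoc)
    also have "\<dots> = (\<Sum>j<m. (\<Sum>l<m. adj_mat Q $$ (i, l) * Q $$ (l, j)) * b j)"
      by (subst sum.swap) (simp add: sum_distrib_right)
    also have "\<dots> = (\<Sum>j<m. if j = i then det Q * b i else 0)"
      by (intro sum.cong refl) (simp add: entry)
    finally have "det Q * b i = (\<Sum>l<m. adj_mat Q $$ (i, l) * (\<Sum>j<m. Q $$ (l, j) * b j))"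
      using i by simp
    then show ?thesis by (auto intro!: gen_ideal_sum gen_ideal_mult Qb)
  qed
  have "det Q = det Q * (1 - (\<Sum>j<m. pconst (d j) * b j)) + (\<Sum>j<m. pconst (d j) * (det Q * b j))"
    by (simp add: right_diff_distrib sum_distrib_left mult_ac)
  also have "\<dots> \<in> gen_ideal s f"
    using det_b by (intro gen_ideal_add gen_ideal_sum gen_ideal_mult[OF one] gen_ideal_mult[of "det Q * _"]) auto
  finally have det_in: "det Q \<in> gen_ideal s f" .
  (* The extra factor z keeps the degree positive when m = 0. *)
  let ?q = "pCons 0 (char_poly C)"
  have deg: "degree (char_poly C) = m" "Polynomial.coeff (char_poly C) m = 1"
    using degree_monic_char_poly[OF C] by auto
  then have "char_poly C \<noteq> 0" by auto
  then have "degree ?q = Suc m" "Polynomial.coeff ?q (Suc m) = 1" using deg by auto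
  moreover have "at_poly ?q z = z * at_poly (char_poly C) z"
  proof -
    have "?q = [:0, 1:] * char_poly C" by simp
    moreover have "at_poly [:0, 1:] z = z" by (simp add: at_poly_eq_poly)
    ultimately show ?thesis by (simp only: E.hom_mult)
  qed
  ultimately show ?thesis
    using det_in detQ by (intro exI[of _ ?q]) (simp add: gen_ideal_mult)
qed

lemma monic_relation_if_fin_gen:
  fixes f :: "nat \<Rightarrow> 'r::comm_ring_1 mpol"
  assumes f: "\<And>i. i < s \<Longrightarrow> f i \<in> polys (X ` {..<n})"
    and fg: "fin_gen_along (koszul_H0_map n s f) (koszul_H0 n s f)"
    and z: "z \<in> polys (X ` {..<n})"
  shows "\<exists>q. Polynomial.coeff q (degree q) = 1 \<and> degree q > 0 \<and> at_poly q z \<in> gen_ideal s f"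
proof -
  let ?R = "polys (X ` {..<n}) :: 'r mpol set"
  obtain B where B: "finite B" "B \<subseteq> ?R"
    and gen: "\<forall>p\<in>?R. \<exists>c g. (\<forall>i<s. g i \<in> ?R) \<and> p = (\<Sum>b\<in>B. pconst (c b) * b) + (\<Sum>i<s. g i * f i)"
    using iffD1[OF fin_gen_koszul_H0_iff[OF f] fg] by blast
  obtain b where b: "bij_betw b {..<card B} B"
    using ex_bij_betw_nat_finite[OF B(1)] by (auto simp: atLeast0LessThan)
  have expand: "\<exists>c. p - (\<Sum>j<card B. pconst (c j) * b j) \<in> gen_ideal s f" if "p \<in> ?R" for p
  proof -
    from bspec[OF gen that] obtain c g
      where p: "p = (\<Sum>b\<in>B. pconst (c b) * b) + (\<Sum>i<s. g i * f i)" by blast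
    have "(\<Sum>b\<in>B. pconst (c b) * b) = (\<Sum>j<card B. pconst (c (b j)) * b j)"
      by (rule sum.reindex_bij_betw[OF b, symmetric])
    then have "p - (\<Sum>j<card B. pconst (c (b j)) * b j) = (\<Sum>i<s. g i * f i)" using p by simp
    then show ?thesis by (intro exI[of _ "\<lambda>j. c (b j)"]) (auto simp: gen_ideal_def)
  qed
  have "z * b i \<in> ?R" if "i < card B" for i
    using that b B(2) z by (intro polys_mult) (auto simp: bij_betw_def)
  then have "\<forall>i. \<exists>c. i < card B \<longrightarrow> z * b i - (\<Sum>j<card B. pconst (c j) * b j) \<in> gen_ideal s f"
    using expand by blast
  then obtain c where "\<And>i. i < card B \<Longrightarrow> z * b i - (\<Sum>j<card B. pconst (c i j) * b j) \<in> gen_ideal s f"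
    by metis
  moreover obtain d where "1 - (\<Sum>j<card B. pconst (d j) * b j) \<in> gen_ideal s f"
    using expand[OF polys_one] by blast
  ultimately show ?thesis by (rule monic_relation_of_linear_system)
qed

section \<open>Grassmann algebra: homogeneous elements and coefficient ideals\<close>

lemma gcoeff_gconst_mult: "gcoeff (gconst c * a) K = c * gcoeff a K"
proof -
  have "gcoeff (gconst c * a) K = (\<Sum>I\<in>Pow K. if I = {} then c * gcoeff a K else 0)"
    unfolding times_grassmann.rep_eq by (intro sum.cong refl) (auto simp: gcoeff_gmono)
  also have "\<dots> = c * gcoeff a K"
  proof (cases "finite K")
    case False
    then have "gcoeff a K = 0" using gcoeff_nonzero_finite by blast
    then show ?thesis using False by simp
  qed simp
  finally show ?thesis .
qed

lemma gcoeff_mult_gconst: "gcoeff (a * gconst c) K = c * gcoeff a K"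
proof -
  have "gcoeff (a * gconst c) K = (\<Sum>I\<in>Pow K. if I = K then c * gcoeff a K else 0)"
    unfolding times_grassmann.rep_eq by (intro sum.cong refl) (auto simp: gcoeff_gmono mult_ac)
  also have "\<dots> = c * gcoeff a K"
  proof (cases "finite K")
    case False
    then have "gcoeff a K = 0" using gcoeff_nonzero_finite by blast
    then show ?thesis using False by simp
  qed simp
  finally show ?thesis .
qed

lemma gconst_commute: "a * gconst c = gconst c * a"
  by (rule grassmann_eqI) (simp add: gcoeff_gconst_mult gcoeff_mult_gconst)

lemma gconst_sum: "gconst (sum h A) = (\<Sum>i\<in>A. gconst (h i))"
  by (rule grassmann_eqI) (simp add: gcoeff_gmono)

lemma gconst_diff: "gconst (c - d) = gconst c - gconst d"
  by (rule grassmann_eqI) (simp add: gcoeff_gmono)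

lemma gconst_mult: "gconst (c * d) = gconst c * gconst d"
  by (simp add: gmono_mult)

lemma gcoeff_sign_mult: "gcoeff ((- 1) ^ k * a) K = (- 1) ^ k * gcoeff a K"
  by (simp add: minus_one_power_iff)

lemma gderiv_uminus: "gderiv \<phi> (- a) = - gderiv \<phi> a"
  using gderiv_add[of \<phi> a "- a"] by (simp add: eq_neg_iff_add_eq_0 add.commute)

lemma gderiv_diff: "gderiv \<phi> (a - b) = gderiv \<phi> a - gderiv \<phi> b"
  using gderiv_add[of \<phi> a "- b"] by (simp add: gderiv_uminus)

lemma gderiv_mult_gconst: "gderiv \<phi> (a * gconst c) = gconst c * gderiv \<phi> a"
  by (simp add: gconst_commute gderiv_gconst_mult)

text \<open>
  Every term of \<open>gderiv \<phi> a\<close> arises by removing a variable \<open>v\<close> with \<open>\<phi> v \<noteq> 0\<close>.  In particular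
  a boundary has no component of top degree in the variables on which the derivation lives.
\<close>

lemma gcoeff_gderiv_eq_zero:
  fixes a :: "('g::linorder, 'a::comm_ring_1) grassmann"
  assumes "\<And>v. v \<notin> K \<Longrightarrow> \<phi> v = 0"
  shows "gcoeff (gderiv \<phi> a) K = 0"
  unfolding gderiv_def gcoeff_sum
proof (intro sum.neutral ballI)
  fix L :: "'g set" and v assume "v \<in> L"
  show "gcoeff (gmono ((- 1) ^ card {w \<in> L. w < v} * gcoeff a L * \<phi> v) (L - {v})) K = 0"
    using assms[of v] by (cases "v \<in> K") (auto simp: gcoeff_gmono)
qed

definition homog :: "nat \<Rightarrow> ('g, 'a::zero) grassmann \<Rightarrow> bool"
  where "homog d a \<longleftrightarrow> (\<forall>K. gcoeff a K \<noteq> 0 \<longrightarrow> card K = d)"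

lemma homogD: "homog d a \<Longrightarrow> card K \<noteq> d \<Longrightarrow> gcoeff a K = 0"
  by (auto simp: homog_def)

lemma homog_zero [simp]: "homog d (0 :: ('g, 'a::ab_group_add) grassmann)"
  by (simp add: homog_def)

lemma homog_add: "homog d a \<Longrightarrow> homog d b \<Longrightarrow> homog d (a + b :: ('g, 'a::ab_group_add) grassmann)"
  unfolding homog_def by (metis add_0 gcoeff_add)

lemma homog_diff: "homog d a \<Longrightarrow> homog d b \<Longrightarrow> homog d (a - b :: ('g, 'a::ab_group_add) grassmann)"
  unfolding homog_def by (metis diff_zero gcoeff_diff)

lemma homog_sum:
  "(\<And>i. i \<in> A \<Longrightarrow> homog d (h i)) \<Longrightarrow> homog d (\<Sum>i\<in>A. h i :: ('g, 'a::ab_group_add) grassmann)"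
  by (induction A rule: infinite_finite_induct) (auto intro: homog_add)

lemma homog_gmono: "card K = d \<Longrightarrow> homog d (gmono c K)"
  by (auto simp: homog_def gcoeff_gmono)

lemma homog_mult:
  fixes a b :: "('g::linorder, 'a::comm_ring_1) grassmann"
  assumes "homog p a" "homog q b"
  shows "homog (p + q) (a * b)"
  unfolding homog_def
proof (intro allI impI)
  fix K assume K: "gcoeff (a * b) K \<noteq> 0"
  then obtain I where I: "I \<in> Pow K" "gsign I (K - I) * gcoeff a I * gcoeff b (K - I) \<noteq> 0"
    unfolding times_grassmann.rep_eq by (auto elim: sum.not_neutral_contains_not_neutral)
  then have "gcoeff a I \<noteq> 0" "gcoeff b (K - I) \<noteq> 0" by auto
  then have "card I = p" "card (K - I) = q" using assms by (auto simp: homog_def)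
  moreover have "finite K" using K by (rule gcoeff_nonzero_finite)
  ultimately show "card K = p + q"
    using I(1) card_mono[of K I] by (auto simp: card_Diff_subset finite_subset)
qed

lemma homog_one [simp]: "homog 0 (1 :: ('g::linorder, 'a::comm_ring_1) grassmann)"
  by (simp add: homog_def one_grassmann.rep_eq)

lemma homog_gconst_mult: "homog d a \<Longrightarrow> homog d (gconst c * a)"
  unfolding homog_def gcoeff_gconst_mult by (metis mult_zero_right)

lemma homog_prod_list:
  "(\<And>a. a \<in> set as \<Longrightarrow> homog 1 a) \<Longrightarrow> homog (length as) (prod_list as)"
  by (induction as) (use homog_mult[of 1] in auto)

lemma parity_part_homog: "homog d a \<Longrightarrow> parity_part p a = (if d mod 2 = p then a else 0)"
  by (rule grassmann_eqI) (auto simp: gcoeff_parity_part homog_def)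

lemma gsign_commute:
  fixes I J :: "'g::linorder set"
  assumes "finite I" "finite J" "I \<inter> J = {}"
  shows "(gsign I J :: 'a::comm_ring_1) = (- 1) ^ (card I * card J) * gsign J I"
proof -
  let ?A = "{(i, j). i \<in> I \<and> j \<in> J \<and> j < i}" and ?B = "{(j, i). j \<in> J \<and> i \<in> I \<and> i < j}"
  have fin: "finite ?A" "finite ?B"
    by (rule finite_subset[of _ "I \<times> J"] finite_subset[of _ "J \<times> I"]; use assms in auto)+
  have "card I * card J = card (I \<times> J)" by (simp add: card_cartesian_product)
  also have "I \<times> J = ?A \<union> prod.swap ` ?B" using assms(3) by (auto simp: image_iff neq_iff)
  also have "card \<dots> = card ?A + card (prod.swap ` ?B)"
    using fin by (intro card_Un_disjoint) auto
  also have "card (prod.swap ` ?B) = card ?B"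
    by (rule card_image) (rule inj_on_subset[OF inj_swap subset_UNIV])
  finally have "card I * card J = card ?A + card ?B" .
  then show ?thesis
    by (simp add: gsign_def power_add mult.assoc flip: power_mult_distrib)
qed

lemma homog_commute:
  fixes a b :: "('g::linorder, 'a::comm_ring_1) grassmann"
  assumes "homog p a" "homog q b"
  shows "a * b = (- 1) ^ (p * q) * (b * a)"
proof (rule grassmann_eqI)
  fix K
  show "gcoeff (a * b) K = gcoeff ((- 1) ^ (p * q) * (b * a)) K"
  proof (cases "finite K")
    case True
    have "gcoeff (a * b) K =
        (\<Sum>I\<in>Pow K. (- 1) ^ (p * q) * (gsign I (K - I) * gcoeff b I * gcoeff a (K - I)))"
      unfolding times_grassmann.rep_eq
    proof (rule sum.reindex_bij_witness[of _ "\<lambda>I. K - I" "\<lambda>I. K - I"])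
      fix I assume I: "I \<in> Pow K"
      then have fin: "finite I" "finite (K - I)" "I \<inter> (K - I) = {}" "K - (K - I) = I"
        using True finite_subset by auto
      show "(- 1) ^ (p * q) * (gsign (K - I) (K - (K - I)) * gcoeff b (K - I) * gcoeff a (K - (K - I))) =
          gsign I (K - I) * gcoeff a I * gcoeff b (K - I)"
      proof (cases "gcoeff a I \<noteq> 0 \<and> gcoeff b (K - I) \<noteq> 0")
        case True
        then have "card I = p" "card (K - I) = q" using assms by (auto simp: homog_def)
        then show ?thesis
          unfolding fin(4) using gsign_commute[OF fin(1-3), where 'a = 'a] by (simp add: mult_ac)
      qed (auto simp: fin)
    qed auto
    also have "\<dots> = (- 1) ^ (p * q) * gcoeff (b * a) K"
      by (simp add: times_grassmann.rep_eq sum_distrib_left)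
    finally show ?thesis by (simp only: gcoeff_sign_mult)
  qed (metis gcoeff_nonzero_finite)
qed

definition poly_ideal :: "'a::comm_ring_1 set \<Rightarrow> bool"
  where "poly_ideal L \<longleftrightarrow> 0 \<in> L \<and> (\<forall>a\<in>L. \<forall>b\<in>L. a + b \<in> L) \<and> (\<forall>a\<in>L. \<forall>c. c * a \<in> L)"

text \<open>
  Only coefficients at subsets of \<open>S\<close> are tested: the elements are those that vanish after
  reducing modulo \<open>L\<close> and setting the variables outside \<open>S\<close> to 0, a two-sided ideal.
\<close>

definition coeffs_in :: "'a set \<Rightarrow> 'g set \<Rightarrow> ('g, 'a::zero) grassmann set"
  where "coeffs_in L S = {a. \<forall>K\<subseteq>S. gcoeff a K \<in> L}"

lemma coeffs_inD: "a \<in> coeffs_in L S \<Longrightarrow> K \<subseteq> S \<Longrightarrow> gcoeff a K \<in> L"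
  by (simp add: coeffs_in_def)

context
  fixes L :: "'a::comm_ring_1 set" and S :: "'g::linorder set"
  assumes L: "poly_ideal L"
begin

lemma poly_ideal_zero: "0 \<in> L"
  and poly_ideal_add: "a \<in> L \<Longrightarrow> b \<in> L \<Longrightarrow> a + b \<in> L"
  and poly_ideal_mult: "a \<in> L \<Longrightarrow> c * a \<in> L"
  using L by (auto simp only: poly_ideal_def)

lemma poly_ideal_sum: "(\<And>i. i \<in> A \<Longrightarrow> h i \<in> L) \<Longrightarrow> sum h A \<in> L"
  by (induction A rule: infinite_finite_induct) (auto intro: poly_ideal_zero poly_ideal_add)

lemma coeffs_in_add: "a \<in> coeffs_in L S \<Longrightarrow> b \<in> coeffs_in L S \<Longrightarrow> a + b \<in> coeffs_in L S"
  by (simp add: coeffs_in_def poly_ideal_add)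

lemma coeffs_in_zero: "0 \<in> coeffs_in L S"
  by (simp add: coeffs_in_def poly_ideal_zero)

lemma coeffs_in_mult_left:
  assumes "b \<in> coeffs_in L S"
  shows "a * b \<in> coeffs_in L S"
proof -
  have "gsign I (K - I) * gcoeff a I * gcoeff b (K - I) \<in> L" if "K \<subseteq> S" for K I
  proof -
    have "K - I \<subseteq> S" using that by blast
    then have "gcoeff b (K - I) \<in> L" using assms by (simp add: coeffs_in_def)
    then show ?thesis by (rule poly_ideal_mult)
  qed
  then show ?thesis unfolding coeffs_in_def by (auto simp: times_grassmann.rep_eq intro!: poly_ideal_sum)
qed

lemma coeffs_in_mult_right:
  assumes "a \<in> coeffs_in L S"
  shows "a * b \<in> coeffs_in L S"
proof -
  have "gsign I (K - I) * gcoeff a I * gcoeff b (K - I) \<in> L" if "K \<subseteq> S" "I \<subseteq> K" for K I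
  proof -
    have "I \<subseteq> S" using that by blast
    then have "gcoeff a I \<in> L" using assms by (simp add: coeffs_in_def)
    then have "gsign I (K - I) * gcoeff b (K - I) * gcoeff a I \<in> L"
      by (rule poly_ideal_mult)
    then show ?thesis by (simp add: mult_ac)
  qed
  then show ?thesis unfolding coeffs_in_def by (auto simp: times_grassmann.rep_eq intro!: poly_ideal_sum)
qed

lemma coeffs_in_uminus: "a \<in> coeffs_in L S \<Longrightarrow> - a \<in> coeffs_in L S"
  using coeffs_in_mult_left[of a "- 1"] by simp

lemma coeffs_in_diff: "a \<in> coeffs_in L S \<Longrightarrow> b \<in> coeffs_in L S \<Longrightarrow> a - b \<in> coeffs_in L S"
  using coeffs_in_add[of a "- b"] by (simp add: coeffs_in_uminus)

lemma coeffs_in_sum: "(\<And>i. i \<in> A \<Longrightarrow> h i \<in> coeffs_in L S) \<Longrightarrow> sum h A \<in> coeffs_in L S"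
  by (induction A rule: infinite_finite_induct) (auto intro: coeffs_in_add coeffs_in_zero)

lemma coeffs_in_gconst: "c \<in> L \<Longrightarrow> gconst c \<in> coeffs_in L S"
  by (auto simp: coeffs_in_def gcoeff_gmono poly_ideal_zero)

lemma coeffs_in_gvar: "v \<notin> S \<Longrightarrow> gvar v \<in> coeffs_in L S"
  by (auto simp: coeffs_in_def gcoeff_gmono poly_ideal_zero)

lemma gderiv_prod_list_in_coeffs_in:
  assumes "\<And>a. a \<in> set as \<Longrightarrow> homog 1 a \<and> gderiv \<phi> a \<in> coeffs_in L S"
  shows "gderiv \<phi> (prod_list as) \<in> coeffs_in L S"
  using assms
proof (induction as)
  case Nil
  then show ?case by (simp add: coeffs_in_zero flip: gmono_one)
next
  case (Cons a as)
  have "homog 1 a" using Cons.prems by simp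
  then have "parity_part 1 a = a" by (simp add: parity_part_homog)
  then have "gderiv \<phi> (prod_list (a # as)) = gderiv \<phi> a * prod_list as - a * gderiv \<phi> (prod_list as)"
    by (simp add: gderiv_mult)
  then show ?case
    using Cons by (simp add: coeffs_in_diff coeffs_in_mult_left coeffs_in_mult_right)
qed

text \<open>
  Modulo an ideal in which all factors are cycles, homologous odd factors have homologous
  products.  With \<open>a - b \<equiv> \<partial>c\<close> for the first factors and \<open>A - B \<equiv> \<partial>c'\<close> for the remaining products,
  \<open>aA - bB = (a - b)A + b(A - B) \<equiv> \<partial>(cA) - \<partial>(bc')\<close>; no sign appears at \<open>cA\<close> since \<open>c\<close> is even.
\<close>

lemma prod_list_homotopic:
  assumes "\<And>k. k \<in> set ks \<Longrightarrow> homog 1 (a k) \<and> homog 1 (b k)"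
    and "\<And>k. k \<in> set ks \<Longrightarrow> gderiv \<phi> (a k) \<in> coeffs_in L S \<and> gderiv \<phi> (b k) \<in> coeffs_in L S"
    and "\<And>k. k \<in> set ks \<Longrightarrow> \<exists>c. parity_part 0 c = c \<and> a k - b k - gderiv \<phi> c \<in> coeffs_in L S"
  shows "\<exists>c. prod_list (map a ks) - prod_list (map b ks) - gderiv \<phi> c \<in> coeffs_in L S"
  using assms
proof (induction ks)
  case Nil
  then show ?case by (intro exI[of _ 0]) (simp add: coeffs_in_zero)
next
  case (Cons k ks)
  let ?A = "prod_list (map a ks)" and ?B = "prod_list (map b ks)"
  obtain c where c: "parity_part 0 c = c" "a k - b k - gderiv \<phi> c \<in> coeffs_in L S"
    using Cons.prems(3)[of k] by auto
  obtain c' where c': "?A - ?B - gderiv \<phi> c' \<in> coeffs_in L S"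
    using Cons by auto
  have "homog 1 (b k)" using Cons.prems(1) by simp
  then have "parity_part 1 (b k) = b k" by (simp add: parity_part_homog)
  then have "gderiv \<phi> (c * ?A - b k * c') =
      gderiv \<phi> c * ?A + c * gderiv \<phi> ?A - gderiv \<phi> (b k) * c' + b k * gderiv \<phi> c'"
    by (simp add: gderiv_diff gderiv_mult[OF c(1)] gderiv_mult)
  then have "prod_list (map a (k # ks)) - prod_list (map b (k # ks)) - gderiv \<phi> (c * ?A - b k * c') =
      (a k - b k - gderiv \<phi> c) * ?A + b k * (?A - ?B - gderiv \<phi> c') -
      c * gderiv \<phi> ?A + gderiv \<phi> (b k) * c'"
    by (simp add: algebra_simps)
  moreover have "gderiv \<phi> ?A \<in> coeffs_in L S"
    by (rule gderiv_prod_list_in_coeffs_in) (use Cons.prems in auto)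
  ultimately have "prod_list (map a (k # ks)) - prod_list (map b (k # ks)) -
      gderiv \<phi> (c * ?A - b k * c') \<in> coeffs_in L S"
    using c(2) c' Cons.prems
    by (simp add: coeffs_in_add coeffs_in_diff coeffs_in_mult_left coeffs_in_mult_right)
  then show ?case by blast
qed

end

section \<open>The Koszul complex of the diagonal\<close>

text \<open>
  Restriction to the partial diagonal \<open>y\<^sub>l = x\<^sub>l\<close>, \<open>l < m\<close>.
\<close>

definition diag_subst :: "nat \<Rightarrow> 'r::comm_ring_1 mpol \<Rightarrow> 'r mpol"
  where "diag_subst m = subst_poly (\<lambda>v. case v of X l \<Rightarrow> pvar (X l) | Y l \<Rightarrow> pvar (if l < m then X l else Y l))"

abbreviation yx_diff :: "nat \<Rightarrow> 'r::comm_ring_1 mpol"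
  where "yx_diff l \<equiv> pvar (Y l) - pvar (X l)"

lemma diag_subst_yx_diff: "diag_subst m (yx_diff l) = (if l < m then 0 else yx_diff l)"
  by (simp add: diag_subst_def subst_poly_diff)

lemma diff_diag_subst_in_ideal: "p - diag_subst m p \<in> gen_ideal m yx_diff"
proof -
  have "p \<in> polys UNIV" by simp
  then show ?thesis
  proof (induction rule: polys_induct)
    case (var v)
    then show ?case
      by (cases v) (auto simp: diag_subst_def gen_ideal_generator[of _ m yx_diff])
  next
    case (add p q)
    have eq: "p + q - diag_subst m (p + q) = (p - diag_subst m p) + (q - diag_subst m q)"
      by (simp add: diag_subst_def subst_poly_add)
    show ?case unfolding eq using add by (intro gen_ideal_add)
  next
    case (mult p q)
    have eq: "p * q - diag_subst m (p * q) = p * (q - diag_subst m q) + diag_subst m q * (p - diag_subst m p)"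
      by (simp add: diag_subst_def subst_poly_mult algebra_simps)
    show ?case unfolding eq using mult by (intro gen_ideal_add gen_ideal_mult)
  qed (simp add: diag_subst_def)
qed

lemma lookup_pvar_mult:
  "Poly_Mapping.lookup (pvar v * p) (k + Poly_Mapping.single v 1) = Poly_Mapping.lookup p k"
  by (rule additive_eq_on_singles[of "\<lambda>p. Poly_Mapping.lookup (pvar v * p) _" "\<lambda>p. Poly_Mapping.lookup p k"])
    (auto simp: distrib_left lookup_add pvar_def mult_single lookup_single when_def add.commute)

lemma lookup_pvar_mult_zero:
  assumes "Poly_Mapping.lookup k v = 0"
  shows "Poly_Mapping.lookup (pvar v * p) k = 0"
proof (rule additive_eq_on_singles[of "\<lambda>p. Poly_Mapping.lookup (pvar v * p) k" "\<lambda>p. 0"])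
  fix m r
  have "Poly_Mapping.single v 1 + m \<noteq> k" using assms by (auto simp: lookup_add)
  then show "Poly_Mapping.lookup (pvar v * Poly_Mapping.single m r) k = 0"
    by (simp add: pvar_def mult_single lookup_single)
qed (simp_all add: distrib_left lookup_add)

text \<open>
  If \<open>y\<^sub>l p = x\<^sub>l p\<close>, the coefficient of \<open>p\<close> at a monomial equals the one where a factor \<open>x\<^sub>l\<close> has
  been traded for \<open>y\<^sub>l\<close>, and it is 0 once no \<open>x\<^sub>l\<close> is left.
\<close>

lemma yx_diff_regular:
  fixes p :: "'r::comm_ring_1 mpol"
  assumes "yx_diff l * p = 0"
  shows "p = 0"
proof -
  have eq: "pvar (Y l) * p = pvar (X l) * p" using assms by (simp add: left_diff_distrib)
  have "Poly_Mapping.lookup p k = 0" if "Poly_Mapping.lookup k (X l) = e" for e k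
    using that
  proof (induction e arbitrary: k)
    case 0
    have "Poly_Mapping.lookup p k = Poly_Mapping.lookup (pvar (X l) * p) (k + Poly_Mapping.single (Y l) 1)"
      using lookup_pvar_mult[of "Y l" p k] eq by simp
    also have "\<dots> = 0" by (rule lookup_pvar_mult_zero) (simp add: lookup_add lookup_single 0)
    finally show ?case .
  next
    case (Suc e)
    let ?k = "k - Poly_Mapping.single (X l) 1"
    have k: "k = ?k + Poly_Mapping.single (X l) 1"
      using Suc.prems by (intro poly_mapping_eqI) (auto simp: lookup_add lookup_minus lookup_single when_def)
    have "Poly_Mapping.lookup p k = Poly_Mapping.lookup (pvar (X l) * p) (k + Poly_Mapping.single (Y l) 1)"
      using lookup_pvar_mult[of "Y l" p k] eq by simp
    also have "k + Poly_Mapping.single (Y l) 1 = (?k + Poly_Mapping.single (Y l) 1) + Poly_Mapping.single (X l) 1"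
      by (subst k) (simp add: ac_simps)
    also have "Poly_Mapping.lookup (pvar (X l) * p) \<dots> = Poly_Mapping.lookup p (?k + Poly_Mapping.single (Y l) 1)"
      by (rule lookup_pvar_mult)
    also have "\<dots> = 0"
      by (rule Suc.IH) (use Suc.prems in \<open>simp add: lookup_add lookup_minus lookup_single\<close>)
    finally show ?case .
  qed
  then show ?thesis by (intro poly_mapping_eqI) simp
qed

text \<open>
  A relation between \<open>y\<^sub>0 - x\<^sub>0, \<dots>, y\<^sub>m - x\<^sub>m\<close> restricts on the partial diagonal to
  \<open>(y\<^sub>m - x\<^sub>m) z\<^sub>m = 0\<close>, so \<open>z\<^sub>m\<close> vanishes there, that is, \<open>z\<^sub>m = \<Sum>\<^sub>l\<^sub><\<^sub>m h\<^sub>l (y\<^sub>l - x\<^sub>l)\<close>.  Subtracting the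
  boundary of \<open>\<Sum>\<^sub>l\<^sub><\<^sub>m h\<^sub>l u\<^sub>l u\<^sub>m\<close> leaves a relation between the first \<open>m\<close> elements.
\<close>

lemma koszul_exact_degree_1:
  fixes z :: "nat \<Rightarrow> 'r::comm_ring_1 mpol"
  assumes "\<And>l. l < n \<Longrightarrow> \<phi> (U l) = yx_diff l" and "(\<Sum>l<n. yx_diff l * z l) = 0"
  shows "\<exists>c. parity_part 0 c = c \<and> gderiv \<phi> c = (\<Sum>l<n. gvar (U l) * gconst (z l))"
  using assms
proof (induction n arbitrary: z)
  case 0
  show ?case by (intro exI[of _ 0]) (simp add: parity_part_homog)
next
  case (Suc m)
  have "yx_diff m * diag_subst m (z m) = (\<Sum>l<Suc m. diag_subst m (yx_diff l) * diag_subst m (z l))"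
    by (simp add: diag_subst_yx_diff)
  also have "\<dots> = diag_subst m (\<Sum>l<Suc m. yx_diff l * z l)"
    by (simp only: diag_subst_def subst_poly_sum subst_poly_mult)
  also have "\<dots> = 0" unfolding Suc.prems(2) by (simp add: diag_subst_def)
  finally have "diag_subst m (z m) = 0" by (rule yx_diff_regular)
  then have "z m \<in> gen_ideal m yx_diff" using diff_diag_subst_in_ideal[of "z m" m] by simp
  then obtain h where h: "z m = (\<Sum>l<m. h l * yx_diff l)" by (auto simp: gen_ideal_def)
  let ?z = "\<lambda>l. z l + h l * yx_diff m"
  have "(\<Sum>l<m. yx_diff l * ?z l) = (\<Sum>l<m. yx_diff l * z l) + yx_diff m * (\<Sum>l<m. h l * yx_diff l)"
    by (simp add: distrib_left sum.distrib sum_distrib_left mult_ac)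
  also have "\<dots> = 0" using Suc.prems(2) by (simp flip: h)
  finally obtain c where c: "parity_part 0 c = c" "gderiv \<phi> c = (\<Sum>l<m. gvar (U l) * gconst (?z l))"
    using Suc.IH[of ?z] Suc.prems(1) by auto
  let ?c = "\<Sum>l<m. gconst (h l) * (gvar (U l) * gvar (U m))"
  have "homog 2 (gvar v * gvar w :: 'r galg)" for v w
    using homog_mult[OF homog_gmono homog_gmono, of "{v}" 1 "{w}" 1 1 1] by (simp add: numeral_2_eq_2)
  then have "homog 2 ?c" by (intro homog_sum homog_gconst_mult)
  then have par: "parity_part 0 ?c = ?c" by (simp add: parity_part_homog)
  have "gderiv \<phi> ?c = (\<Sum>l<m. gvar (U m) * gconst (h l * yx_diff l) - gvar (U l) * gconst (h l * yx_diff m))"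
    unfolding gderiv_sum
  proof (rule sum.cong[OF refl])
    fix l assume l: "l \<in> {..<m}"
    have "gderiv \<phi> (gconst (h l) * (gvar (U l) * gvar (U m))) =
        gconst (h l) * (gconst (yx_diff l) * gvar (U m) - gvar (U l) * gconst (yx_diff m))"
      using l Suc.prems(1) by (simp add: gderiv_gconst_mult gderiv_gvar_mult gderiv_gvar)
    also have "\<dots> = gvar (U m) * gconst (h l * yx_diff l) - gvar (U l) * gconst (h l * yx_diff m)"
      unfolding gconst_commute[of "gvar _"] unfolding gconst_mult
      by (simp only: right_diff_distrib mult.assoc)
    finally show "gderiv \<phi> (gconst (h l) * (gvar (U l) * gvar (U m))) = \<dots>" .
  qed
  also have "\<dots> = gvar (U m) * gconst (z m) - (\<Sum>l<m. gvar (U l) * gconst (h l * yx_diff m))"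
    by (simp add: sum_subtractf h gconst_sum sum_distrib_left)
  finally have "gderiv \<phi> (c + ?c) = (\<Sum>l<Suc m. gvar (U l) * gconst (z l))"
    by (simp add: gderiv_add c(2) gmono_add distrib_left sum.distrib)
  moreover have "parity_part 0 (c + ?c) = c + ?c"
  proof (rule grassmann_eqI)
    fix K
    show "gcoeff (parity_part 0 (c + ?c)) K = gcoeff (c + ?c) K"
      using arg_cong[OF c(1), of "\<lambda>a. gcoeff a K"] arg_cong[OF par, of "\<lambda>a. gcoeff a K"]
      by (auto simp: gcoeff_parity_part)
  qed
  ultimately show ?case by blast
qed

section \<open>The functional on the Koszul complex\<close>

lemma swap_avar_involution [simp]: "swap_avar (swap_avar v) = v"
  by (cases v) auto

lemma inj_swap_avar: "inj swap_avar"
  by (rule injI) (metis swap_avar_involution)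

lemma swap_avar_image_involution [simp]: "swap_avar ` swap_avar ` K = K"
  by (simp add: image_image)

lemma gcoeff_swap_xy: "gcoeff (swap_xy a) K = swap_poly (gcoeff a (swap_avar ` K))"
proof -
  have "gcoeff (swap_xy a) K =
      (\<Sum>L\<in>gsupp a. if L = swap_avar ` K then swap_poly (gcoeff a (swap_avar ` K)) else 0)"
    unfolding swap_xy_def gcoeff_sum
    by (intro sum.cong refl) (auto simp: gcoeff_gmono gsupp_finite)
  also have "\<dots> = swap_poly (gcoeff a (swap_avar ` K))"
    by (subst sum.delta) (auto simp: gsupp_def finite_gcoeff)
  finally show ?thesis .
qed

lemma swap_xy_add: "swap_xy (a + b) = swap_xy a + swap_xy b"
  by (rule grassmann_eqI) (simp add: gcoeff_swap_xy swap_poly_add)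

lemma swap_xy_zero [simp]: "swap_xy 0 = 0"
  by (rule grassmann_eqI) (simp add: gcoeff_swap_xy)

lemma swap_xy_sum: "swap_xy (sum h A) = (\<Sum>i\<in>A. swap_xy (h i))"
  by (induction A rule: infinite_finite_induct) (auto simp: swap_xy_add)

lemma swap_xy_gmono: "finite K \<Longrightarrow> swap_xy (gmono c K) = gmono (swap_poly c) (swap_avar ` K)"
  by (rule grassmann_eqI) (auto simp: gcoeff_swap_xy gcoeff_gmono)

lemma swap_xy_involution [simp]: "swap_xy (swap_xy a) = a"
  by (rule grassmann_eqI) (simp add: gcoeff_swap_xy)

lemma swap_xy_rconst_mult: "swap_xy (rconst r * a) = rconst r * swap_xy a"
  by (rule grassmann_eqI) (simp add: gcoeff_swap_xy rconst_def gcoeff_gconst_mult swap_poly_mult)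

lemma swap_poly_one [simp]: "swap_poly 1 = 1"
  using swap_poly_pconst[of 1] by (simp only: single_one)

lemma swap_poly_sign: "swap_poly ((- 1) ^ k) = (- 1) ^ k"
proof -
  have "swap_poly (- 1) = - swap_poly (1 :: 'a mpol)"
    by (rule poly_mapping_eqI) (simp only: lookup_swap_poly lookup_uminus)
  then show ?thesis by (simp add: minus_one_power_iff)
qed

text \<open>
  On elements without \<open>f\<^sub>y\<close> the renaming preserves the order of the variables and hence all
  signs in the derivation.
\<close>

lemma swap_xy_gderiv:
  assumes a: "a \<in> grassmann_over V (range FX)" and \<psi>: "\<And>K i. K \<in> gsupp a \<Longrightarrow> FX i \<in> K \<Longrightarrow> \<psi> (FY i) = swap_poly (\<phi> (FX i))"
  shows "swap_xy (gderiv \<phi> a) = gderiv \<psi> (swap_xy a)"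
proof -
  have mono: "swap_xy (gderiv \<phi> (gmono c K)) = gderiv \<psi> (swap_xy (gmono c K))"
    if K: "K \<in> gsupp a" for c K
  proof -
    have fin: "finite K" and sub: "K \<subseteq> range FX"
      using K a by (auto simp: gsupp_finite grassmann_over_def)
    have "gderiv \<psi> (swap_xy (gmono c K)) = (\<Sum>v\<in>swap_avar ` K.
        gmono ((- 1) ^ card {w \<in> swap_avar ` K. w < v} * swap_poly c * \<psi> v) (swap_avar ` K - {v}))"
      by (simp add: swap_xy_gmono gderiv_gmono fin)
    also have "\<dots> = (\<Sum>v\<in>K. gmono ((- 1) ^ card {w \<in> swap_avar ` K. w < swap_avar v} * swap_poly c *
        \<psi> (swap_avar v)) (swap_avar ` K - {swap_avar v}))"
      by (rule sum.reindex[OF inj_on_subset[OF inj_swap_avar subset_UNIV], unfolded o_def])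
    also have "\<dots> = (\<Sum>v\<in>K. swap_xy (gmono ((- 1) ^ card {w \<in> K. w < v} * c * \<phi> v) (K - {v})))"
    proof (rule sum.cong[OF refl])
      fix v assume v: "v \<in> K"
      have "{w \<in> swap_avar ` K. w < swap_avar v} = swap_avar ` {w \<in> K. w < v}"
      proof -
        have "swap_avar w < swap_avar v \<longleftrightarrow> w < v" if "w \<in> K" for w
          using subsetD[OF sub that] subsetD[OF sub v] by (auto simp: less_avar_def)
        then show ?thesis by auto
      qed
      then have "card {w \<in> swap_avar ` K. w < swap_avar v} = card {w \<in> K. w < v}"
        by (simp add: card_image inj_on_subset[OF inj_swap_avar])
      moreover have "\<psi> (swap_avar v) = swap_poly (\<phi> v)"
        using sub v \<psi>[OF K] by auto
      moreover have "swap_avar ` K - {swap_avar v} = swap_avar ` (K - {v})"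
        by (auto simp: image_iff) (metis swap_avar_involution)+
      ultimately show "gmono ((- 1) ^ card {w \<in> swap_avar ` K. w < swap_avar v} * swap_poly c *
        \<psi> (swap_avar v)) (swap_avar ` K - {swap_avar v}) =
        swap_xy (gmono ((- 1) ^ card {w \<in> K. w < v} * c * \<phi> v) (K - {v}))"
        using fin by (simp add: swap_xy_gmono swap_poly_sign swap_poly_mult mult.assoc)
    qed
    finally show ?thesis by (simp add: gderiv_gmono fin swap_xy_sum)
  qed
  have "swap_xy (gderiv \<phi> (\<Sum>K\<in>gsupp a. gmono (gcoeff a K) K)) =
      gderiv \<psi> (swap_xy (\<Sum>K\<in>gsupp a. gmono (gcoeff a K) K))"
    by (simp add: gderiv_sum swap_xy_sum mono)
  then show ?thesis by (simp only: gmono_expand[symmetric])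
qed

text \<open>
  Taking the coefficient of the product of all \<open>f\<^sub>i\<^sub>,\<^sub>y\<close> is Berezin integration over them.  For
  \<open>w\<close> in \<open>R[x]\<close> and \<open>f\<^sub>x\<close> and \<open>\<Gamma>\<close> in \<open>R[y]\<close> and \<open>f\<^sub>y\<close> the residue is a constant polynomial, whose value
  is read off at the monomial 0.
\<close>

definition residue_functional ::
  "(nat \<Rightarrow> 'r::comm_ring_1 poly) \<Rightarrow> nat \<Rightarrow> nat \<Rightarrow> 'r galg \<Rightarrow> 'r galg \<Rightarrow> 'r"
  where "residue_functional q n s \<Gamma> w =
    Poly_Mapping.lookup (y_residue q n (gcoeff (\<Gamma> * swap_xy w) (FY ` {..<s}))) 0"

text \<open>
  The largest ideal on which the residue takes values in \<open>F\<close>.  With \<open>F = 0\<close> it contains the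
  \<open>q\<^sub>k(y\<^sub>k)\<close>; with the ideal of \<open>f\<close> for \<open>F\<close> it contains the \<open>f\<^sub>i(x)\<close> as well.
\<close>

definition residue_ideal :: "(nat \<Rightarrow> 'r::comm_ring_1 poly) \<Rightarrow> nat \<Rightarrow> 'r mpol set \<Rightarrow> 'r mpol set"
  where "residue_ideal q n F = {p. \<forall>h. y_residue q n (p * h) \<in> F}"

lemma residue_idealD: "p \<in> residue_ideal q n F \<Longrightarrow> y_residue q n p \<in> F"
  unfolding residue_ideal_def by (drule CollectD, drule spec[of _ 1]) simp

lemma poly_ideal_residue_ideal:
  assumes "0 \<in> F" "\<And>a b. a \<in> F \<Longrightarrow> b \<in> F \<Longrightarrow> a + b \<in> F"
  shows "poly_ideal (residue_ideal q n F)"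
  unfolding poly_ideal_def residue_ideal_def
proof (intro conjI ballI CollectI allI)
  fix a c h assume a: "a \<in> {p. \<forall>h. y_residue q n (p * h) \<in> F}"
  have "y_residue q n (a * (c * h)) \<in> F" using a by blast
  moreover have "c * a * h = a * (c * h)" by (simp add: mult_ac)
  ultimately show "y_residue q n (c * a * h) \<in> F" by (simp only:)
qed (use assms in \<open>simp_all add: distrib_right y_residue_add\<close>)

lemma lookup_pconst_mult: "Poly_Mapping.lookup (pconst r * p) k = r * Poly_Mapping.lookup p k"
  by (rule additive_eq_on_singles[of "\<lambda>p. Poly_Mapping.lookup (pconst r * p) k"])
    (auto simp: distrib_left lookup_add mult_single lookup_single when_def)

lemma residue_functional_add:
  "residue_functional q n s \<Gamma> (a + b) = residue_functional q n s \<Gamma> a + residue_functional q n s \<Gamma> b"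
  by (simp add: residue_functional_def swap_xy_add distrib_left y_residue_add lookup_add)

lemma residue_functional_zero: "residue_functional q n s \<Gamma> 0 = 0"
  by (simp add: residue_functional_def)

lemma residue_functional_scale: "residue_functional q n s \<Gamma> (rconst r * a) = r * residue_functional q n s \<Gamma> a"
proof -
  have "\<Gamma> * (rconst r * swap_xy a) = rconst r * (\<Gamma> * swap_xy a)"
    by (simp add: rconst_def gconst_commute flip: mult.assoc)
  then show ?thesis
    by (simp add: residue_functional_def swap_xy_rconst_mult)
      (simp add: rconst_def gcoeff_gconst_mult y_residue_mult lookup_pconst_mult)
qed

lemma card_FY [simp]: "card (FY ` {..<s}) = s" and card_U [simp]: "card (U ` {..<s}) = s"
  by (simp_all add: card_image inj_on_def)

text \<open>
  The functional lives in the single degree \<open>s - n\<close>, and is 0 if \<open>n > s\<close>.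
\<close>

lemma residue_functional_parity_part:
  assumes "homog n \<Gamma>"
  shows "residue_functional q n s \<Gamma> (parity_part p w) \<in> {0, residue_functional q n s \<Gamma> w}"
proof -
  let ?T = "FY ` {..<s}"
  have card: "card (swap_avar ` (?T - I)) = s - n" if "I \<subseteq> ?T" "gcoeff \<Gamma> I \<noteq> 0" for I
  proof -
    have "card I = n" using assms that by (auto simp: homog_def)
    then show ?thesis
      using that finite_subset[OF that(1)] inj_on_subset[OF inj_swap_avar]
      by (simp add: card_image card_Diff_subset)
  qed
  have "gcoeff (\<Gamma> * swap_xy (parity_part p w)) ?T = (if (s - n) mod 2 = p then gcoeff (\<Gamma> * swap_xy w) ?T else 0)"
  proof -
    have "gcoeff (\<Gamma> * swap_xy (parity_part p w)) ?T = (\<Sum>I\<in>Pow ?T.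
        if (s - n) mod 2 = p then gsign I (?T - I) * gcoeff \<Gamma> I * gcoeff (swap_xy w) (?T - I) else 0)"
      unfolding times_grassmann.rep_eq
    proof (rule sum.cong[OF refl])
      fix I assume "I \<in> Pow ?T"
      then show "gsign I (?T - I) * gcoeff \<Gamma> I * gcoeff (swap_xy (parity_part p w)) (?T - I) =
        (if (s - n) mod 2 = p then gsign I (?T - I) * gcoeff \<Gamma> I * gcoeff (swap_xy w) (?T - I) else 0)"
        using card[of I] by (cases "gcoeff \<Gamma> I = 0") (auto simp: gcoeff_swap_xy gcoeff_parity_part)
    qed
    then show ?thesis by (simp add: times_grassmann.rep_eq)
  qed
  then show ?thesis by (simp add: residue_functional_def)
qed

text \<open>
  Since \<open>\<partial>(\<Gamma> b)\<close> has no component at the product of all \<open>f\<^sub>i\<^sub>,\<^sub>y\<close>, the value on \<open>\<partial>a\<close> is up to sign the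
  residue of a coefficient of \<open>\<partial>\<Gamma> b\<close>, and \<open>\<partial>\<Gamma>\<close> lies in the ideal killed by the residue.  The
  derivation is cut off at \<open>f\<^sub>i\<^sub>,\<^sub>y\<close> with \<open>i < s\<close> so that this component vanishes for arbitrary arguments.
\<close>

lemma residue_functional_cycle:
  fixes f :: "nat \<Rightarrow> 'r::comm_ring_1 mpol"
  assumes \<Gamma>: "\<Gamma> = prod_list \<gamma>" "length \<gamma> = n"
    and \<gamma>: "\<And>a. a \<in> set \<gamma> \<Longrightarrow> homog 1 a \<and>
      gderiv (\<lambda>v. case v of FY i \<Rightarrow> if i < s then swap_poly (f i) else 0 | _ \<Rightarrow> 0) a \<in> coeffs_in (residue_ideal q n {0}) UNIV"
  shows "residue_functional q n s \<Gamma> \<in> koszul_dual_cycles n s f"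
proof -
  let ?e = "residue_functional q n s \<Gamma>" and ?T = "FY ` {..<s}"
  let ?\<psi> = "\<lambda>v. case v of FY i \<Rightarrow> if i < s then swap_poly (f i) else 0 | _ \<Rightarrow> 0"
  have L: "poly_ideal (residue_ideal q n {0 :: 'r mpol})"
    by (rule poly_ideal_residue_ideal) auto
  have hom: "homog n \<Gamma>" unfolding \<Gamma>(1) using homog_prod_list[of \<gamma>] \<gamma> \<Gamma>(2) by blast
  have d\<Gamma>: "gderiv ?\<psi> \<Gamma> \<in> coeffs_in (residue_ideal q n {0}) UNIV"
    unfolding \<Gamma>(1) using \<gamma> by (rule gderiv_prod_list_in_coeffs_in[OF L])
  have "?e (koszul_diff f a) = 0" if a: "a \<in> koszul n s" for a
  proof -
    let ?b = "swap_xy a"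
    have sw: "swap_xy (koszul_diff f a) = gderiv ?\<psi> ?b"
    proof (rule swap_xy_gderiv)
      show "a \<in> grassmann_over (X ` {..<n}) (range FX)"
        using a unfolding koszul_def by (rule grassmann_over_mono) auto
      show "?\<psi> (FY i) = swap_poly (koszul_val f (FX i))" if "K \<in> gsupp a" "FX i \<in> K" for K i
        using a that by (auto simp: koszul_def grassmann_over_def)
    qed
    have "gderiv ?\<psi> (\<Gamma> * ?b) = gderiv ?\<psi> \<Gamma> * ?b + (- 1) ^ (n mod 2) * \<Gamma> * gderiv ?\<psi> ?b"
      using hom by (intro gderiv_mult) (simp add: parity_part_homog)
    moreover have "gcoeff (gderiv ?\<psi> (\<Gamma> * ?b)) ?T = 0"
      by (rule gcoeff_gderiv_eq_zero) (auto split: avar.split)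
    ultimately have "(- 1) ^ (n mod 2) * gcoeff (\<Gamma> * gderiv ?\<psi> ?b) ?T = - gcoeff (gderiv ?\<psi> \<Gamma> * ?b) ?T"
      by (simp add: mult.assoc gcoeff_sign_mult eq_neg_iff_add_eq_0 add.commute)
    then have "(- 1) ^ (n mod 2) * ((- 1) ^ (n mod 2) * gcoeff (\<Gamma> * gderiv ?\<psi> ?b) ?T) =
        (- 1) ^ (n mod 2) * - gcoeff (gderiv ?\<psi> \<Gamma> * ?b) ?T" by (rule arg_cong)
    then have "gcoeff (\<Gamma> * gderiv ?\<psi> ?b) ?T = (- 1) ^ (n mod 2) * - gcoeff (gderiv ?\<psi> \<Gamma> * ?b) ?T"
      by (simp add: mult.assoc[symmetric] flip: power_mult_distrib)
    also have "\<dots> = (- ((- 1) ^ (n mod 2))) * gcoeff (gderiv ?\<psi> \<Gamma> * ?b) ?T" by simp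
    also have "\<dots> \<in> residue_ideal q n {0}"
      using coeffs_in_mult_right[OF L d\<Gamma>, of ?b]
      by (intro poly_ideal_mult[OF L]) (simp add: coeffs_in_def)
    finally have "y_residue q n (gcoeff (\<Gamma> * gderiv ?\<psi> ?b) ?T) \<in> {0}"
      by (rule residue_idealD)
    then show ?thesis by (simp add: residue_functional_def sw)
  qed
  then have "dual_part p ?e (koszul_diff f a) = 0" if "a \<in> koszul n s" for a p
    using residue_functional_parity_part[OF hom, of q s p "koszul_diff f a"] that
    by (simp add: dual_part_def)
  then show ?thesis
    by (simp add: koszul_dual_cycles_def koszul_dual_def dual_diff_def residue_functional_add residue_functional_scale)
qed

section \<open>The contraction of the determinant\<close>

lemma parity_part_add: "parity_part p (a + b) = parity_part p a + parity_part p b"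
  by (rule grassmann_eqI) (simp add: gcoeff_parity_part)

lemma contract_y_add: "contract_y (a + b) e = contract_y a e + contract_y b e"
  by (simp add: contract_y_def parity_part_add extend_functional_add distrib_left sum.distrib)

lemma extend_functional_zero [simp]: "extend_functional p e 0 = 0"
  using extend_functional_add[of p e 0 0] by simp

lemma contract_y_zero [simp]: "contract_y 0 e = 0"
  using contract_y_add[of 0 0 e] by simp

lemma polys_empty:
  assumes "p \<in> polys {}"
  shows "p = pconst (Poly_Mapping.lookup p 0)"
proof (rule poly_mapping_eqI)
  fix k
  have "k = 0" if "k \<in> Poly_Mapping.keys p" using assms that by (simp add: polys_def)
  then show "Poly_Mapping.lookup p k = Poly_Mapping.lookup (pconst (Poly_Mapping.lookup p 0)) k"
    by (auto simp: lookup_single when_def in_keys_iff)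
qed

text \<open>
  The functional is supported in degree \<open>s - n\<close> of \<open>f\<^sub>y\<close>, which is the total degree of \<open>D\<close>.
  So the terms of \<open>D\<close> involving \<open>f\<^sub>x\<close> do not contribute, and on the others the extension of
  the functional is the \<open>R[x]\<close>-linear residue.  The sign is the one in the definition of the
  contraction.
\<close>

lemma contract_y_residue_functional:
  fixes D \<Gamma> :: "'r::comm_ring_1 galg"
  assumes D: "D \<in> grassmann_over (X ` {..<n} \<union> Y ` {..<n}) (FX ` {..<s} \<union> FY ` {..<s})"
    and deg: "\<And>K. K \<in> gsupp D \<Longrightarrow> card K + n = s"
    and \<Gamma>: "\<Gamma> \<in> grassmann_over (Y ` {..<n}) (FY ` {..<s})" "homog n \<Gamma>"
  shows "contract_y D (residue_functional q n s \<Gamma>) =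
    (- 1) ^ (s + n) * gconst (y_residue q n (gcoeff (\<Gamma> * D) (FY ` {..<s})))"
  using D
proof (induction rule: grassmann_over_induct)
  case zero
  show ?case by simp
next
  case (add a b)
  then show ?case by (simp add: contract_y_add distrib_left y_residue_add gmono_add)
next
  case (monomial m r K)
  let ?e = "residue_functional q n s \<Gamma>" and ?T = "FY ` {..<s}"
  let ?K = "K \<inter> range FY"
  let ?c = "Poly_Mapping.single (y_part m) (1 :: 'r)"
  let ?k = "card K mod 2"
  have card: "card K + n = s" using deg monomial(1) .
  have K: "K \<subseteq> range FX \<union> range FY" using monomial(3) by auto
  have e: "?e (gmono (swap_poly ?c) (swap_avar ` ?K)) =
      Poly_Mapping.lookup (y_residue q n (gcoeff (\<Gamma> * gmono ?c ?K) ?T)) 0"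
    using swap_xy_involution[of "gmono ?c ?K"] monomial(2)
    by (simp add: residue_functional_def swap_xy_gmono)
  have "card (swap_avar ` ?K) = card ?K"
    by (rule card_image) (rule inj_on_subset[OF inj_swap_avar subset_UNIV])
  then have dual: "dual_part p ?e (swap_xy (gmono ?c ?K)) = (if card ?K mod 2 = p
      then Poly_Mapping.lookup (y_residue q n (gcoeff (\<Gamma> * gmono ?c ?K) ?T)) 0 else 0)" for p
    using monomial(2) e
    by (simp add: dual_part_def swap_xy_gmono parity_part_homog[OF homog_gmono[OF refl]] residue_functional_zero)
  have "contract_y (gmono (Poly_Mapping.single m r) K) ?e = (\<Sum>p<2. (- 1) ^ (?k * p) *
      extend_functional p (dual_part p ?e \<circ> swap_xy) (gmono (Poly_Mapping.single m r) K))"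
    unfolding contract_y_def
  proof (rule sum.cong[OF refl])
    fix p :: nat
    have "(\<Sum>q<2. (- 1) ^ (q * p) * extend_functional p (dual_part p ?e \<circ> swap_xy)
        (parity_part q (gmono (Poly_Mapping.single m r) K))) =
      (\<Sum>q<2. if q = ?k then (- 1) ^ (?k * p) * extend_functional p (dual_part p ?e \<circ> swap_xy)
        (gmono (Poly_Mapping.single m r) K) else 0)"
      by (intro sum.cong refl) (auto simp: parity_part_homog[OF homog_gmono[OF refl]])
    also have "\<dots> = (- 1) ^ (?k * p) * extend_functional p (dual_part p ?e \<circ> swap_xy)
        (gmono (Poly_Mapping.single m r) K)"
      by simp
    finally show "(\<Sum>q<2. (- 1) ^ (q * p) * extend_functional p (dual_part p ?e \<circ> swap_xy)
        (parity_part q (gmono (Poly_Mapping.single m r) K))) = \<dots>" .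
  qed
  also have "\<dots> = (\<Sum>p<2. (- 1) ^ (?k * p) * gmono (Poly_Mapping.single (x_part m)
      ((- 1) ^ (p * card (K \<inter> range FX)) * r * dual_part p ?e (swap_xy (gmono ?c ?K)))) (K \<inter> range FX))"
    using monomial(2) by (simp add: extend_functional_monomial)
  finally have con: "contract_y (gmono (Poly_Mapping.single m r) K) ?e = \<dots>" .
  show ?case
  proof (cases "K \<subseteq> range FY")
    case False
    then have "?K \<subset> K" by auto
    then have "card ?K < card K" using monomial(2) by (rule psubset_card_mono[rotated])
    then have "gcoeff (\<Gamma> * gmono ?c ?K) ?T = 0"
      using homog_mult[OF \<Gamma>(2) homog_gmono[OF refl, of ?K ?c]] card by (intro homogD) auto
    then have "contract_y (gmono (Poly_Mapping.single m r) K) ?e = 0"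
      unfolding con dual by (simp cong: if_cong)
    moreover have "gcoeff (\<Gamma> * gmono (Poly_Mapping.single m r) K) ?T = 0"
      unfolding times_grassmann.rep_eq
      by (rule sum.neutral) (use False in \<open>auto simp: gcoeff_gmono\<close>)
    ultimately show ?thesis by simp
  next
    case True
    then have sets: "?K = K" "K \<inter> range FX = {}" by auto
    have "contract_y (gmono (Poly_Mapping.single m r) K) ?e = (\<Sum>p<2. if p = ?k then (- 1) ^ (?k * ?k) *
      gconst (Poly_Mapping.single (x_part m)
      (r * Poly_Mapping.lookup (y_residue q n (gcoeff (\<Gamma> * gmono ?c K) ?T)) 0)) else 0)"
      unfolding con dual unfolding sets by (intro sum.cong refl) auto
    also have "\<dots> = (- 1) ^ (?k * ?k) * gconst (Poly_Mapping.single (x_part m)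
      (r * Poly_Mapping.lookup (y_residue q n (gcoeff (\<Gamma> * gmono ?c K) ?T)) 0))"
      by simp
    also have "(- 1) ^ (?k * ?k) = ((- 1) ^ (s + n) :: 'r galg)"
    proof -
      have "even (?k * ?k) \<longleftrightarrow> even (s + n)" using card by auto
      then show ?thesis by (simp add: minus_one_power_iff)
    qed
    also have "Poly_Mapping.single (x_part m)
        (r * Poly_Mapping.lookup (y_residue q n (gcoeff (\<Gamma> * gmono ?c K) ?T)) 0) =
        y_residue q n (gcoeff (\<Gamma> * gmono (Poly_Mapping.single m r) K) ?T)"
    proof -
      have "x_part m + y_part m = m"
      proof (rule poly_mapping_eqI)
        fix v show "Poly_Mapping.lookup (x_part m + y_part m) v = Poly_Mapping.lookup m v"
          by (cases v) (auto simp: lookup_add lookup_x_part lookup_y_part)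
      qed
      then have mr: "Poly_Mapping.single m r = Poly_Mapping.single (x_part m) r * ?c"
        by (simp add: mult_single)
      have "gmono (Poly_Mapping.single m r) K = gconst (Poly_Mapping.single (x_part m) r) * gmono ?c K"
        using monomial(2) by (simp add: gmono_mult mr)
      then have "\<Gamma> * gmono (Poly_Mapping.single m r) K =
          gconst (Poly_Mapping.single (x_part m) r) * (\<Gamma> * gmono ?c K)"
        by (simp add: gconst_commute flip: mult.assoc)
      then have coeff: "gcoeff (\<Gamma> * gmono (Poly_Mapping.single m r) K) ?T =
          Poly_Mapping.single (x_part m) r * gcoeff (\<Gamma> * gmono ?c K) ?T"
        by (simp add: gcoeff_gconst_mult)
      have "Poly_Mapping.keys (x_part m) \<subseteq> range X" by (auto simp: in_keys_iff lookup_x_part split: if_splits)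
      then have x: "Poly_Mapping.single (x_part m) r \<in> polys (range X)" by (simp add: polys_def)
      have "Poly_Mapping.keys (y_part m) \<subseteq> Y ` {..<n}"
      proof
        fix v assume "v \<in> Poly_Mapping.keys (y_part m)"
        then have "v \<in> range Y" "v \<in> Poly_Mapping.keys m"
          by (auto simp: in_keys_iff lookup_y_part split: if_splits)
        then show "v \<in> Y ` {..<n}" using monomial(4) by auto
      qed
      then have "?c \<in> polys (Y ` {..<n})" by (simp add: polys_def)
      then have "gmono ?c K \<in> grassmann_over (Y ` {..<n}) UNIV"
        by (intro grassmann_over_gmono) auto
      moreover have "\<Gamma> \<in> grassmann_over (Y ` {..<n}) UNIV"
        using \<Gamma>(1) by (rule grassmann_over_mono) auto
      ultimately have "\<Gamma> * gmono ?c K \<in> grassmann_over (Y ` {..<n}) UNIV"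
        by (rule grassmann_over_mult[rotated])
      then have "gcoeff (\<Gamma> * gmono ?c K) ?T \<in> polys (Y ` {..<n})"
        by (simp add: grassmann_over_iff)
      then have "y_residue q n (gcoeff (\<Gamma> * gmono ?c K) ?T) \<in> polys (Y ` {..<n} - Y ` {..<n})"
        by (rule y_residue_in_polys)
      then have "y_residue q n (gcoeff (\<Gamma> * gmono ?c K) ?T) \<in> polys {}" by simp
      then have const: "y_residue q n (gcoeff (\<Gamma> * gmono ?c K) ?T) =
          pconst (Poly_Mapping.lookup (y_residue q n (gcoeff (\<Gamma> * gmono ?c K) ?T)) 0)"
        by (rule polys_empty)
      show ?thesis
        unfolding coeff y_residue_mult[OF x] by (subst (2) const) (simp add: mult_single)
    qed
    finally show ?thesis .
  qed
qed

text \<open>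
  In characteristic 2 anticommutativity does not give this; it holds because linear forms are
  sums of pairwise anticommuting elements of square 0.
\<close>

lemma homog_1_square:
  fixes a :: "('g::linorder, 'a::comm_ring_1) grassmann"
  assumes a: "homog 1 a"
  shows "a * a = 0"
proof -
  have sums: "(\<Sum>i\<in>A. h i) * (\<Sum>i\<in>A. h i) = 0 \<and> homog 1 (\<Sum>i\<in>A. h i)"
    if "\<And>i. i \<in> A \<Longrightarrow> homog 1 (h i) \<and> h i * h i = 0" for A :: "'g set set" and h :: "'g set \<Rightarrow> ('g, 'a) grassmann"
    using that
  proof (induction A rule: infinite_finite_induct)
    case (insert i A)
    let ?S = "\<Sum>i\<in>A. h i"
    have i: "homog 1 (h i)" "h i * h i = 0" and S: "homog 1 ?S" "?S * ?S = 0"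
      using insert by auto
    have "h i * ?S = - (?S * h i)" using homog_commute[OF i(1) S(1)] by simp
    then have "(h i + ?S) * (h i + ?S) = 0"
      using i(2) S(2) by (simp add: distrib_left distrib_right)
    then show ?case using insert(1,2) homog_add[OF i(1) S(1)] by simp
  qed simp_all
  have "gmono (gcoeff a K) K * gmono (gcoeff a K) K = 0 \<and> homog 1 (gmono (gcoeff a K) K)" if "K \<in> gsupp a" for K
  proof -
    have "card K = 1" using that a by (simp add: gsupp_def homog_def)
    then show ?thesis
      using gsupp_finite[OF that] by (auto simp: gmono_mult intro: homog_gmono)
  qed
  then have "(\<Sum>K\<in>gsupp a. gmono (gcoeff a K) K) * (\<Sum>K\<in>gsupp a. gmono (gcoeff a K) K) = 0"
    using sums[of "gsupp a" "\<lambda>K. gmono (gcoeff a K) K"] by blast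
  then show ?thesis by (simp only: gmono_expand[symmetric])
qed

lemma homog_1_factor_annihilates:
  fixes a :: "('g::linorder, 'a::comm_ring_1) grassmann"
  assumes "\<And>b. b \<in> set as \<Longrightarrow> homog 1 b" "a \<in> set as"
  shows "a * prod_list as = 0"
  using assms
proof (induction as)
  case (Cons b as)
  show ?case
  proof (cases "a = b")
    case True
    have "a * a = 0" using Cons.prems by (intro homog_1_square) auto
    then show ?thesis using True by (simp flip: mult.assoc)
  next
    case False
    then have "a * b = - (b * a)" using Cons.prems homog_commute[of 1 a 1 b] by simp
    then have "a * (b * prod_list as) = - (b * (a * prod_list as))" by (simp flip: mult.assoc)
    then show ?thesis using Cons False by simp
  qed
qed simp

text \<open>
  If every \<open>a\<^sub>k - b\<^sub>k\<close> annihilates \<open>Q\<close>, the factors can be exchanged one at a time: the factor in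
  question is moved next to \<open>Q\<close>, exchanged there, and moved back with the same sign.
\<close>

lemma prod_list_replace_mod_annihilator:
  fixes Q :: "('g::linorder, 'a::comm_ring_1) grassmann"
  assumes "\<And>k. k \<in> set ks \<Longrightarrow> homog 1 (a k) \<and> homog 1 (b k) \<and> a k * Q = b k * Q"
  shows "prod_list (map a ks) * Q = prod_list (map b ks) * Q"
  using assms
proof (induction ks)
  case (Cons k ks)
  let ?B = "prod_list (map b ks)" and ?d = "length ks"
  have B: "homog ?d ?B" using homog_prod_list[of "map b ks"] Cons.prems by auto
  have move: "c * (?B * Q) = (- 1) ^ ?d * (?B * (c * Q))" if "homog 1 c" for c
    using homog_commute[OF that B] by (simp add: mult.assoc[symmetric])
  have "prod_list (map a (k # ks)) * Q = a k * (?B * Q)" using Cons by (simp add: mult.assoc)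
  also have "\<dots> = b k * (?B * Q)" using Cons.prems by (simp add: move)
  finally show ?case by (simp add: mult.assoc)
qed simp

text \<open>
  The part of the \<open>i\<close>-th factor of \<open>det_product\<close> that does not involve \<open>f\<^sub>y\<close>.
\<close>

definition row_form :: "nat \<Rightarrow> (nat \<Rightarrow> nat \<Rightarrow> 'r::comm_ring_1 mpol) \<Rightarrow> nat \<Rightarrow> 'r galg"
  where "row_form n nabla i = (\<Sum>k<n. gvar (U k) * gconst (nabla k i)) + gvar (FX i)"

lemma det_product_row_form:
  "det_product n s nabla = prod_list (map (\<lambda>i. row_form n nabla i - gvar (FY i)) [0..<s])"
  by (simp add: det_product_def row_form_def)

lemma homog_gvar: "homog 1 (gvar v)"
  by (rule homog_gmono) simp

lemma homog_row_form: "homog 1 (row_form n nabla i)"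
  unfolding row_form_def gconst_commute[of "gvar _"]
  by (intro homog_add homog_sum homog_gconst_mult homog_gvar)

lemma homog_det_product: "homog s (det_product n s nabla)"
  using homog_prod_list[of "map (\<lambda>i. row_form n nabla i - gvar (FY i)) [0..<s]"]
  by (auto simp: det_product_row_form intro: homog_diff homog_row_form[unfolded One_nat_def] homog_gvar[unfolded One_nat_def])

lemma gcoeff_det_product_FY: "gcoeff (det_product n s nabla :: 'r::comm_ring_1 galg) (FY ` {..<s}) = (- 1) ^ s"
proof (induction s)
  case 0
  then show ?case by (simp add: det_product_def one_grassmann.rep_eq)
next
  case (Suc s)
  let ?Q = "det_product n s nabla" and ?P = "row_form n nabla s - gvar (FY s) :: 'r galg"
  let ?T = "FY ` {..<Suc s}" and ?T' = "FY ` {..<s}"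
  have P: "gcoeff ?P R = (if R = {FY s} then - 1 else 0)" if "R \<subseteq> range FY" for R
  proof -
    have "R \<noteq> {U k}" "R \<noteq> {FX k}" for k using that by auto
    then show ?thesis
      by (simp add: row_form_def gmono_mult gcoeff_gmono)
  qed
  have "gsign ?T' {FY s} = (1 :: 'r mpol)"
  proof -
    have "{(i, j). i \<in> ?T' \<and> j \<in> {FY s} \<and> j < i} = {}" by (auto simp: less_avar_def)
    then show ?thesis unfolding gsign_def by (simp only: card.empty power_0)
  qed
  moreover have "?T - ?T' = {FY s}" by (auto simp: lessThan_Suc)
  moreover have "gcoeff ?P {FY s} = - 1" by (subst P) auto
  ultimately have sgn: "gsign ?T' (?T - ?T') = (1 :: 'r mpol)" "gcoeff ?P (?T - ?T') = - 1"
    by (simp_all only:)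
  have "gcoeff (?Q * ?P) ?T = (\<Sum>I\<in>Pow ?T. if I = ?T' then - gcoeff ?Q ?T' else 0)"
    unfolding times_grassmann.rep_eq
  proof (rule sum.cong[OF refl])
    fix I assume I: "I \<in> Pow ?T"
    show "gsign I (?T - I) * gcoeff ?Q I * gcoeff ?P (?T - I) = (if I = ?T' then - gcoeff ?Q ?T' else 0)"
    proof (cases "I = ?T'")
      case False
      have "?T - I \<noteq> {FY s}"
      proof
        assume "?T - I = {FY s}"
        then have "I = ?T - {FY s}" using I by auto
        also have "\<dots> = ?T'" by (auto simp: lessThan_Suc)
        finally show False using False by contradiction
      qed
      then have "gcoeff ?P (?T - I) = 0" by (subst P) auto
      then show ?thesis using False by simp
    next
      case True
      then show ?thesis unfolding True sgn by simp
    qed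
  qed
  also have "\<dots> = - gcoeff ?Q ?T'" by (auto simp: lessThan_Suc)
  finally have "gcoeff (?Q * ?P) ?T = - ((- 1) ^ s)" using Suc by simp
  moreover have "det_product n (Suc s) nabla = ?Q * ?P" by (simp add: det_product_row_form)
  ultimately show ?case by simp
qed

lemma y_residue_sign_mult: "y_residue q n ((- 1) ^ k * p) = (- 1) ^ k * y_residue q n p"
  by (simp add: minus_one_power_iff y_residue_uminus)

lemma gmono_sign_mult: "gmono ((- 1) ^ k * c) K = (- 1) ^ k * (gmono c K :: ('g::linorder, 'a::comm_ring_1) grassmann)"
  by (rule grassmann_eqI) (simp add: gcoeff_sign_mult gcoeff_gmono)

text \<open>
  The product \<open>Q\<close> defining the determinant is annihilated by each of its factors
  \<open>\<eta>\<^sub>i - f\<^sub>i\<^sub>,\<^sub>y\<close>, with \<open>\<eta>\<^sub>i\<close> the \<open>row_form\<close>.  Hence \<open>\<Gamma> Q = A Q\<close>, and as \<open>A\<close> is free of \<open>f\<^sub>y\<close>, only the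
  component \<open>(-1)\<^sup>s f\<^sub>1\<^sub>,\<^sub>y \<dots> f\<^sub>s\<^sub>,\<^sub>y\<close> of \<open>Q\<close> contributes to the integral.  This sign and
  the sign \<open>(-1)\<^sup>n\<close> from moving \<open>\<Gamma>\<close> past \<open>u\<^sub>1 \<dots> u\<^sub>n\<close> cancel the sign of the contraction.
\<close>

lemma contract_koszul_det:
  fixes n s :: nat and nabla c :: "nat \<Rightarrow> nat \<Rightarrow> 'r::comm_ring_1 mpol"
  defines "\<Gamma> \<equiv> prod_list (map (\<lambda>k. \<Sum>i<s. gconst (c k i) * gvar (FY i)) [0..<n])"
    and "A \<equiv> prod_list (map (\<lambda>k. \<Sum>i<s. gconst (c k i) * row_form n nabla i) [0..<n])"
  assumes nabla: "\<And>k i. k < n \<Longrightarrow> i < s \<Longrightarrow> nabla k i \<in> polys (X ` {..<n} \<union> Y ` {..<n})"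
    and c: "\<And>k i. k < n \<Longrightarrow> i < s \<Longrightarrow> c k i \<in> polys (Y ` {..<n})"
  shows "contract_y (koszul_det n s nabla) (residue_functional q n s \<Gamma>) =
    gconst (y_residue q n (gcoeff A (U ` {..<n})))"
proof -
  let ?D = "koszul_det n s nabla" and ?Q = "det_product n s nabla"
  let ?T = "FY ` {..<s}" and ?U = "U ` {..<n}"
  let ?u = "gmono 1 ?U :: 'r galg"
  have "?D \<in> grassmann_over (X ` {..<n} \<union> Y ` {..<n}) (FX ` {..<s} \<union> FY ` {..<s}) \<and>
      (\<Prod>k\<leftarrow>[0..<n]. gvar (U k)) * ?D = u_degree_part n ?Q"
    unfolding koszul_det_def by (rule theI') (use koszul_det_unique nabla in blast)
  then have D: "?D \<in> grassmann_over (X ` {..<n} \<union> Y ` {..<n}) (FX ` {..<s} \<union> FY ` {..<s})"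
    and uD: "?u * ?D = u_degree_part n ?Q"
    by (simp_all add: prod_list_gvar_U)
  have noU: "K \<inter> range U = {}" if "gcoeff ?D K \<noteq> 0" for K
    using D that by (fastforce simp: grassmann_over_iff)
  have deg: "card K + n = s" if K: "K \<in> gsupp ?D" for K
  proof -
    have ne: "gcoeff ?D K \<noteq> 0" using K by (simp add: gsupp_def)
    have disj: "K \<inter> ?U = {}" using noU[OF ne] by auto
    then have "?U \<union> K - ?U = K" by auto
    then have "gcoeff (u_degree_part n ?Q) (?U \<union> K) \<noteq> 0"
      using gcoeff_U_mult[where D = ?D, OF noU, where L = "?U \<union> K" and n = n] ne by (simp add: uD)
    then have "card (?U \<union> K) = s"
      using homog_det_product[of s n nabla] by (auto simp: gcoeff_u_degree_part homog_def split: if_splits)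
    moreover have "card (?U \<union> K) = n + card K"
      using disj gsupp_finite[OF K] by (subst card_Un_disjoint) auto
    ultimately show ?thesis by simp
  qed
  have \<Gamma>_in: "\<Gamma> \<in> grassmann_over (Y ` {..<n}) ?T"
    unfolding \<Gamma>_def using c
    by (intro grassmann_over_prod_list) (auto intro!: grassmann_over_sum grassmann_over_mult grassmann_over_gmono)
  have homog_\<gamma>: "homog 1 (\<Sum>i<s. gconst (c k i) * gvar (FY i))" for k
    by (intro homog_sum homog_gconst_mult homog_gvar)
  have homog_a: "homog 1 (\<Sum>i<s. gconst (c k i) * row_form n nabla i)" for k
    by (intro homog_sum homog_gconst_mult homog_row_form)
  have homog_\<Gamma>: "homog n \<Gamma>"
    using homog_prod_list[of "map (\<lambda>k. \<Sum>i<s. gconst (c k i) * gvar (FY i)) [0..<n]"] homog_\<gamma>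
    by (auto simp: \<Gamma>_def)
  have \<Gamma>_FY: "I \<subseteq> range FY" if "gcoeff \<Gamma> I \<noteq> 0" for I
    using \<Gamma>_in that by (fastforce simp: grassmann_over_iff)
  have TU: "?U \<union> ?T - ?U = ?T" by auto
  have "gcoeff (\<Gamma> * ?D) ?T = gcoeff (?u * (\<Gamma> * ?D)) (?U \<union> ?T)"
  proof -
    have "\<Gamma> \<in> grassmann_over UNIV (range FX \<union> range FY)" "?D \<in> grassmann_over UNIV (range FX \<union> range FY)"
      by (rule grassmann_over_mono[OF \<Gamma>_in] grassmann_over_mono[OF D]; auto)+
    then have "\<Gamma> * ?D \<in> grassmann_over UNIV (range FX \<union> range FY)" by (rule grassmann_over_mult)
    then have "K \<inter> range U = {}" if "gcoeff (\<Gamma> * ?D) K \<noteq> 0" for K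
      using that by (fastforce simp: grassmann_over_iff)
    then show ?thesis by (subst gcoeff_U_mult) (auto simp: TU)
  qed
  also have "?u * (\<Gamma> * ?D) = (- 1) ^ (n * n) * (\<Gamma> * (?u * ?D))"
    using homog_commute[OF homog_gmono[of ?U n] homog_\<Gamma>, of 1] by (simp add: mult.assoc[symmetric])
  also have "gcoeff \<dots> (?U \<union> ?T) = (- 1) ^ n * gcoeff (\<Gamma> * u_degree_part n ?Q) (?U \<union> ?T)"
    by (simp add: gcoeff_sign_mult uD minus_one_power_iff)
  also have "gcoeff (\<Gamma> * u_degree_part n ?Q) (?U \<union> ?T) = gcoeff (\<Gamma> * ?Q) (?U \<union> ?T)"
    unfolding times_grassmann.rep_eq
  proof (rule sum.cong[OF refl])
    fix I assume "I \<in> Pow (?U \<union> ?T)"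
    show "gsign I (?U \<union> ?T - I) * gcoeff \<Gamma> I * gcoeff (u_degree_part n ?Q) (?U \<union> ?T - I) =
        gsign I (?U \<union> ?T - I) * gcoeff \<Gamma> I * gcoeff ?Q (?U \<union> ?T - I)"
    proof (cases "gcoeff \<Gamma> I = 0")
      case False
      then have "(?U \<union> ?T - I) \<inter> range U = ?U" using \<Gamma>_FY by fastforce
      then show ?thesis by (simp add: gcoeff_u_degree_part)
    qed simp
  qed
  also have "\<Gamma> * ?Q = A * ?Q"
    unfolding \<Gamma>_def A_def
  proof (rule prod_list_replace_mod_annihilator)
    fix k
    have "row_form n nabla i * ?Q = gvar (FY i) * ?Q" if "i < s" for i
    proof -
      have "(row_form n nabla i - gvar (FY i)) * ?Q = 0"
        unfolding det_product_row_form
        using that by (intro homog_1_factor_annihilates) (auto intro: homog_diff homog_row_form[unfolded One_nat_def] homog_gvar[unfolded One_nat_def])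
      then show ?thesis by (simp add: left_diff_distrib)
    qed
    then have "(\<Sum>i<s. gconst (c k i) * gvar (FY i)) * ?Q = (\<Sum>i<s. gconst (c k i) * row_form n nabla i) * ?Q"
      by (simp add: sum_distrib_right mult.assoc)
    then show "homog 1 (\<Sum>i<s. gconst (c k i) * gvar (FY i)) \<and> homog 1 (\<Sum>i<s. gconst (c k i) * row_form n nabla i) \<and>
        (\<Sum>i<s. gconst (c k i) * gvar (FY i)) * ?Q = (\<Sum>i<s. gconst (c k i) * row_form n nabla i) * ?Q"
      using homog_\<gamma> homog_a by blast
  qed
  also have "gcoeff (A * ?Q) (?U \<union> ?T) = (- 1) ^ s * gcoeff A ?U"
  proof -
    have "A \<in> grassmann_over UNIV (range U \<union> range FX)"
      unfolding A_def row_form_def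
      by (intro grassmann_over_prod_list)
        (auto intro!: grassmann_over_sum grassmann_over_add grassmann_over_mult grassmann_over_gmono)
    then have A_sub: "I \<subseteq> range U \<union> range FX" if "gcoeff A I \<noteq> 0" for I
      using that by (simp add: grassmann_over_iff)
    have sgn: "gsign ?U ?T = (1 :: 'r mpol)"
    proof -
      have "{(i, j). i \<in> ?U \<and> j \<in> ?T \<and> j < i} = {}" by (auto simp: less_avar_def)
      then show ?thesis unfolding gsign_def by (simp only: card.empty power_0)
    qed
    have "gcoeff (A * ?Q) (?U \<union> ?T) = (\<Sum>I\<in>Pow (?U \<union> ?T). if I = ?U then (- 1) ^ s * gcoeff A ?U else 0)"
      unfolding times_grassmann.rep_eq
    proof (rule sum.cong[OF refl])
      fix I assume I: "I \<in> Pow (?U \<union> ?T)"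
      show "gsign I (?U \<union> ?T - I) * gcoeff A I * gcoeff ?Q (?U \<union> ?T - I) =
          (if I = ?U then (- 1) ^ s * gcoeff A ?U else 0)"
      proof (cases "I = ?U")
        case True
        then show ?thesis by (simp add: TU sgn gcoeff_det_product_FY)
      next
        case False
        have "gcoeff ?Q (?U \<union> ?T - I) = 0" if "gcoeff A I \<noteq> 0"
        proof (rule homogD[OF homog_det_product], rule notI)
          assume card: "card (?U \<union> ?T - I) = s"
          have "I \<subseteq> ?U" using I A_sub[OF that] by auto
          then have "?T \<subseteq> ?U \<union> ?T - I" by auto
          then have "?T = ?U \<union> ?T - I" using card by (intro card_subset_eq) auto
          then have "?U \<subseteq> I" by auto
          then show False using \<open>I \<subseteq> ?U\<close> False by blast
        qed
        then show ?thesis using False by (cases "gcoeff A I = 0") auto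
      qed
    qed
    also have "\<dots> = (- 1) ^ s * gcoeff A ?U" by auto
    finally show ?thesis .
  qed
  finally have coeff: "gcoeff (\<Gamma> * ?D) ?T = (- 1) ^ n * ((- 1) ^ s * gcoeff A ?U)" .
  have "contract_y ?D (residue_functional q n s \<Gamma>) =
      (- 1) ^ (s + n) * gconst (y_residue q n (gcoeff (\<Gamma> * ?D) ?T))"
    using D deg \<Gamma>_in homog_\<Gamma> by (rule contract_y_residue_functional)
  then show ?thesis
    unfolding coeff y_residue_sign_mult gmono_sign_mult by (simp add: minus_one_power_iff)
qed

section \<open>Comparison with the monic system\<close>

lemma swap_poly_diff_in_ideal:
  assumes "p \<in> polys (X ` {..<n})"
  shows "swap_poly p - p \<in> gen_ideal n yx_diff"
  using assms
proof (induction rule: polys_induct)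
  case (var v)
  then show ?case using gen_ideal_generator[of _ n yx_diff] by (auto simp: swap_poly_pvar)
next
  case (add p q)
  have eq: "swap_poly (p + q) - (p + q) = (swap_poly p - p) + (swap_poly q - q)"
    by (simp add: swap_poly_add)
  show ?case unfolding eq using add by (intro gen_ideal_add)
next
  case (mult p q)
  have eq: "swap_poly (p * q) - p * q = swap_poly p * (swap_poly q - q) + q * (swap_poly p - p)"
    by (simp add: swap_poly_mult algebra_simps)
  show ?case unfolding eq using mult by (intro gen_ideal_add gen_ideal_mult)
qed simp

lemma swap_poly_at_poly: "swap_poly (at_poly q p) = at_poly q (swap_poly p)"
proof -
  have "swap_poly (p ^ i) = swap_poly p ^ i" for i
    by (induction i) (simp_all add: swap_poly_mult)
  then show ?thesis by (simp add: at_poly_def swap_poly_sum swap_poly_mult)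
qed

lemma prod_list_gvar_U_gconst:
  "prod_list (map (\<lambda>k. gvar (U k) * gconst (M k)) [0..<n]) = (gmono (\<Prod>k<n. M k) (U ` {..<n}) :: 'r::comm_ring_1 galg)"
proof (induction n)
  case 0
  show ?case by (simp add: gmono_one)
next
  case (Suc n)
  have "gsign (U ` {..<n}) {U n} = (1 :: 'r mpol)"
  proof -
    have "{(i, j). i \<in> U ` {..<n} \<and> j \<in> {U n} \<and> j < i} = {}" by (auto simp: less_avar_def)
    then show ?thesis unfolding gsign_def by (simp only: card.empty power_0)
  qed
  then show ?case using Suc by (simp add: gmono_mult lessThan_Suc image_iff mult.commute)
qed

text \<open>
  Both forms have \<open>\<partial>a \<equiv> \<partial>b \<equiv> q(y\<^sub>k)\<close> modulo the \<open>f\<^sub>i(x)\<close>, but exactness requires an honest cycle.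
  Since \<open>G\<^sub>i(y) - G\<^sub>i(x) = \<Sum>\<^sub>l w\<^sub>i\<^sub>l (y\<^sub>l - x\<^sub>l)\<close>, adding the multiples \<open>\<Sum>\<^sub>i f\<^sub>i(x) w\<^sub>i\<^sub>l\<close> to the coefficients of
  \<open>u\<^sub>l\<close> in \<open>a - b\<close> cancels the error \<open>\<Sum>\<^sub>i (G\<^sub>i(x) - G\<^sub>i(y)) f\<^sub>i(x)\<close> exactly.  The terms of \<open>a\<close> in \<open>f\<^sub>x\<close> vanish
  in \<open>coeffs_in L (range U)\<close>.
\<close>

lemma row_forms_homotopic:
  fixes n s k :: nat and f G :: "nat \<Rightarrow> 'r::comm_ring_1 mpol"
    and nabla :: "nat \<Rightarrow> nat \<Rightarrow> 'r mpol" and q :: "'r poly"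
  defines "\<phi> \<equiv> \<lambda>v. case v of U l \<Rightarrow> if l < n then yx_diff l else 0 | _ \<Rightarrow> 0"
  assumes L: "poly_ideal L"
    and f: "\<And>i. i < s \<Longrightarrow> f i \<in> L"
    and nabla: "\<And>i. i < s \<Longrightarrow> (\<Sum>l<n. yx_diff l * nabla l i) = swap_poly (f i) - f i"
    and k: "k < n"
    and G: "\<And>i. G i \<in> polys (X ` {..<n})" "at_poly q (pvar (X k)) = (\<Sum>i<s. G i * f i)"
    and gy: "at_poly q (pvar (Y k)) \<in> L"
  defines "a \<equiv> \<Sum>i<s. gconst (swap_poly (G i)) * row_form n nabla i"
    and "b \<equiv> gvar (U k) * gconst (diff_quotient q (pvar (X k)) (pvar (Y k)))"
  shows "gderiv \<phi> a \<in> coeffs_in L (range U)" "gderiv \<phi> b \<in> coeffs_in L (range U)"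
    "\<exists>c. parity_part 0 c = c \<and> a - b - gderiv \<phi> c \<in> coeffs_in L (range U)"
proof -
  let ?gx = "at_poly q (pvar (X k))" and ?gy = "at_poly q (pvar (Y k))"
  let ?M = "diff_quotient q (pvar (X k)) (pvar (Y k))"
  let ?c = "\<lambda>i. swap_poly (G i)"
  have Lf: "(\<Sum>i<s. h i * f i) \<in> L" for h
    by (intro poly_ideal_sum[OF L] poly_ideal_mult[OF L] f) simp
  have gy_eq: "?gy = (\<Sum>i<s. ?c i * swap_poly (f i))"
    using arg_cong[OF G(2), of swap_poly]
    by (simp add: swap_poly_at_poly swap_poly_pvar swap_poly_sum swap_poly_mult)
  have row: "gderiv \<phi> (row_form n nabla i) = gconst (swap_poly (f i) - f i)" if "i < s" for i
  proof -
    have "gderiv \<phi> (row_form n nabla i) = (\<Sum>l<n. gconst (nabla l i) * gconst (yx_diff l))"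
      by (simp add: row_form_def gderiv_add gderiv_sum gderiv_mult_gconst gderiv_gvar \<phi>_def)
    also have "\<dots> = gconst (\<Sum>l<n. yx_diff l * nabla l i)"
      by (simp add: gconst_sum gmono_mult mult.commute)
    finally show ?thesis by (simp only: nabla[OF that])
  qed
  have "gderiv \<phi> a = gconst (\<Sum>i<s. ?c i * (swap_poly (f i) - f i))"
    by (simp add: a_def gderiv_sum gderiv_gconst_mult row gconst_sum gmono_mult)
  also have "(\<Sum>i<s. ?c i * (swap_poly (f i) - f i)) = ?gy + (\<Sum>i<s. - ?c i * f i)"
    by (simp add: gy_eq right_diff_distrib sum_subtractf sum_negf)
  finally show "gderiv \<phi> a \<in> coeffs_in L (range U)"
    by (simp only: coeffs_in_gconst[OF L poly_ideal_add[OF L gy Lf]])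
  have yx_M: "yx_diff k * ?M = ?gy - ?gx"
    by (rule diff_quotient)
  have "gderiv \<phi> b = gconst ?M * gconst (\<phi> (U k))"
    by (simp only: b_def gderiv_mult_gconst gderiv_gvar)
  also have "\<dots> = gconst (yx_diff k * ?M)"
    using k by (simp add: \<phi>_def gmono_mult mult.commute)
  also have "yx_diff k * ?M = ?gy + (\<Sum>i<s. - G i * f i)"
    by (simp add: yx_M G(2) sum_negf)
  finally show "gderiv \<phi> b \<in> coeffs_in L (range U)"
    by (simp only: coeffs_in_gconst[OF L poly_ideal_add[OF L gy Lf]])
  have "\<forall>i. \<exists>w. ?c i - G i = (\<Sum>l<n. w l * yx_diff l)"
    using swap_poly_diff_in_ideal[OF G(1)] by (auto simp: gen_ideal_def)
  from choice[OF this] obtain w where w: "\<And>i. ?c i - G i = (\<Sum>l<n. w i l * yx_diff l)" by blast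
  define z where "z l = (\<Sum>i<s. ?c i * nabla l i) - (if l = k then ?M else 0) + (\<Sum>i<s. f i * w i l)" for l
  have "(\<Sum>l<n. yx_diff l * z l) = (\<Sum>l<n. \<Sum>i<s. ?c i * (yx_diff l * nabla l i))
      - (\<Sum>l<n. if l = k then yx_diff k * ?M else 0) + (\<Sum>l<n. \<Sum>i<s. f i * (w i l * yx_diff l))"
    unfolding sum_subtractf[symmetric] sum.distrib[symmetric] z_def
    by (intro sum.cong refl) (auto simp: distrib_left right_diff_distrib sum_distrib_left mult_ac)
  also have "\<dots> = (\<Sum>i<s. ?c i * (swap_poly (f i) - f i)) - (?gy - ?gx) + (\<Sum>i<s. f i * (?c i - G i))"
    using k nabla
    by (subst (1 2) sum.swap) (simp add: sum_distrib_left[symmetric] w yx_M)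
  also have "\<dots> = 0"
    unfolding gy_eq G(2) by (simp add: right_diff_distrib sum_subtractf mult.commute)
  finally have "(\<Sum>l<n. yx_diff l * z l) = 0" .
  moreover have "\<phi> (U l) = yx_diff l" if "l < n" for l using that by (simp add: \<phi>_def)
  ultimately obtain e where e: "parity_part 0 e = e" "gderiv \<phi> e = (\<Sum>l<n. gvar (U l) * gconst (z l))"
    using koszul_exact_degree_1[of n \<phi> z] by blast
  have a: "a = (\<Sum>l<n. gvar (U l) * gconst (\<Sum>i<s. ?c i * nabla l i)) + (\<Sum>i<s. gconst (?c i) * gvar (FX i))"
  proof -
    have "(\<Sum>i<s. gconst (?c i) * (\<Sum>l<n. gvar (U l) * gconst (nabla l i))) =
        (\<Sum>i<s. \<Sum>l<n. gvar (U l) * gconst (?c i * nabla l i))"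
      by (simp only: sum_distrib_left gconst_commute[of "gvar _"]) (simp only: gconst_mult mult.assoc)
    also have "\<dots> = (\<Sum>l<n. gvar (U l) * gconst (\<Sum>i<s. ?c i * nabla l i))"
      by (subst sum.swap) (simp add: gconst_sum sum_distrib_left)
    finally show ?thesis by (simp add: a_def row_form_def distrib_left sum.distrib)
  qed
  have b: "b = (\<Sum>l<n. gvar (U l) * gconst (if l = k then ?M else 0))"
  proof -
    have "(\<Sum>l<n. gvar (U l) * gconst (if l = k then ?M else 0)) = (\<Sum>l<n. if l = k then b else 0)"
      by (intro sum.cong refl) (simp add: b_def)
    then show ?thesis using k by simp
  qed
  have "a - b - gderiv \<phi> e = (\<Sum>i<s. gconst (?c i) * gvar (FX i)) - (\<Sum>l<n. gvar (U l) * gconst (\<Sum>i<s. f i * w i l))"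
    unfolding a b e(2) z_def
    by (simp add: gmono_add gconst_diff distrib_left right_diff_distrib sum.distrib sum_subtractf)
  moreover have "\<dots> \<in> coeffs_in L (range U)"
  proof (intro coeffs_in_diff[OF L] coeffs_in_sum[OF L] coeffs_in_mult_left[OF L])
    show "gvar (FX i) \<in> coeffs_in L (range U)" for i by (rule coeffs_in_gvar[OF L]) auto
    show "gconst (\<Sum>i<s. f i * w i l) \<in> coeffs_in L (range U)" for l
      using Lf[of "\<lambda>i. w i l"] by (intro coeffs_in_gconst[OF L]) (simp add: mult.commute)
  qed
  ultimately show "\<exists>c. parity_part 0 c = c \<and> a - b - gderiv \<phi> c \<in> coeffs_in L (range U)"
    using e(1) by metis
qed

lemma homologous_gconst_one:
  assumes f: "\<And>i. i < s \<Longrightarrow> f i \<in> polys (X ` {..<n})"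
    and p: "p \<in> polys (X ` {..<n})" "p - 1 \<in> gen_ideal s f"
  shows "homologous n s f (gconst p) 1"
proof -
  obtain h where h: "\<forall>i. h i \<in> polys (X ` {..<n})" "p - 1 = (\<Sum>i<s. h i * f i)"
    using gen_ideal_coefficients_in_polys[OF f p(2) polys_diff[OF p(1) polys_one]] by auto
  then have "gconst (p - 1) \<in> koszul_B0 n s f"
    unfolding koszul_B0_eq by (intro CollectI exI[of _ h]) simp
  then obtain c where "c \<in> koszul n s" "gconst (p - 1) = koszul_diff f c"
    by (auto simp: koszul_B0_def koszul_deg_def)
  then show ?thesis
    unfolding homologous_def by (intro bexI[of _ c]) (simp_all add: gconst_diff gmono_one)
qed

theorem theorem4:
  fixes n s :: nat
    and f :: "nat \<Rightarrow> 'r::comm_ring_1 mpol"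
    and nabla :: "nat \<Rightarrow> nat \<Rightarrow> 'r mpol"
  assumes "\<And>i. i < s \<Longrightarrow> f i \<in> polys (X ` {..<n})"
    and "\<And>k i. k < n \<Longrightarrow> i < s \<Longrightarrow> nabla k i \<in> polys (X ` {..<n} \<union> Y ` {..<n})"
    and "\<And>i. i < s \<Longrightarrow> (\<Sum>k<n. (xvar k - yvar k) * nabla k i) = f i - swap_poly (f i)"
    and "fin_gen_along (koszul_H0_map n s f) (koszul_H0 n s f)"
  shows "\<exists>e\<in>koszul_dual_cycles n s f. homologous n s f (contract_y (koszul_det n s nabla) e) 1"
proof -
  let ?I = "gen_ideal s f"
  have "\<forall>k. \<exists>q. k < n \<longrightarrow> Polynomial.coeff q (degree q) = 1 \<and> degree q > 0 \<and> at_poly q (pvar (X k)) \<in> ?I"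
    using monic_relation_if_fin_gen[OF assms(1,4) polys_pvar] by blast
  then obtain q where q: "\<And>k. k < n \<Longrightarrow> Polynomial.coeff (q k) (degree (q k)) = 1 \<and> degree (q k) > 0"
    and qI: "\<And>k. k < n \<Longrightarrow> at_poly (q k) (pvar (X k)) \<in> ?I" by metis
  have "at_poly (q k) (pvar (X k)) \<in> polys (X ` {..<n})" if "k < n" for k
    using that by (intro at_poly_in_polys polys_pvar) simp
  then have "\<forall>k. \<exists>G. k < n \<longrightarrow> (\<forall>i. G i \<in> polys (X ` {..<n})) \<and> at_poly (q k) (pvar (X k)) = (\<Sum>i<s. G i * f i)"
    using gen_ideal_coefficients_in_polys[OF assms(1) qI] by blast
  then obtain G where G: "\<And>k i. k < n \<Longrightarrow> G k i \<in> polys (X ` {..<n})"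
    and qG: "\<And>k. k < n \<Longrightarrow> at_poly (q k) (pvar (X k)) = (\<Sum>i<s. G k i * f i)" by metis
  let ?c = "\<lambda>k i. swap_poly (G k i)"
  have qc: "at_poly (q k) (pvar (Y k)) = (\<Sum>i<s. ?c k i * swap_poly (f i))" if "k < n" for k
    using arg_cong[OF qG[OF that], of swap_poly]
    by (simp add: swap_poly_at_poly swap_poly_pvar swap_poly_sum swap_poly_mult)
  have c: "?c k i \<in> polys (Y ` {..<n})" if "k < n" for k i
    using swap_poly_in_polys[OF G[OF that]] by (simp add: image_image)
  define a where "a k = (\<Sum>i<s. gconst (?c k i) * row_form n nabla i)" for k
  define b where "b k = gvar (U k) * gconst (diff_quotient (q k) (pvar (X k)) (pvar (Y k)))" for k
  define \<gamma> where "\<gamma> k = (\<Sum>i<s. gconst (?c k i) * gvar (FY i))" for k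
  let ?\<Gamma> = "prod_list (map \<gamma> [0..<n])" and ?A = "prod_list (map a [0..<n])"
  let ?e = "residue_functional q n s ?\<Gamma>" and ?p = "y_residue q n (gcoeff ?A (U ` {..<n}))"
  have "?e \<in> koszul_dual_cycles n s f"
  proof (rule residue_functional_cycle[OF refl])
    fix \<gamma>' assume "\<gamma>' \<in> set (map \<gamma> [0..<n])"
    then obtain k where k: "k < n" "\<gamma>' = \<gamma> k" by auto
    let ?\<psi> = "\<lambda>v. case v of FY i \<Rightarrow> if i < s then swap_poly (f i) else 0 | _ \<Rightarrow> 0"
    have "gderiv ?\<psi> (\<gamma> k) = (\<Sum>i<s. gconst (?c k i) * gconst (?\<psi> (FY i)))"
      by (simp only: \<gamma>_def gderiv_sum gderiv_gconst_mult gderiv_gvar)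
    also have "\<dots> = gconst (at_poly (q k) (pvar (Y k)))"
      by (simp add: gmono_mult qc[OF k(1)] gconst_sum)
    finally have "gderiv ?\<psi> (\<gamma> k) = gconst (at_poly (q k) (pvar (Y k)))" .
    moreover have "at_poly (q k) (pvar (Y k)) \<in> residue_ideal q n {0}"
      using q[OF k(1)] by (simp add: residue_ideal_def y_residue_at_poly[OF k(1)])
    moreover have "poly_ideal (residue_ideal q n {0 :: 'r mpol})"
      by (rule poly_ideal_residue_ideal) auto
    moreover have "homog 1 (\<gamma> k)"
      unfolding \<gamma>_def by (intro homog_sum homog_gconst_mult homog_gvar)
    ultimately show "homog 1 \<gamma>' \<and> gderiv ?\<psi> \<gamma>' \<in> coeffs_in (residue_ideal q n {0}) UNIV"
      by (simp add: k(2) coeffs_in_gconst)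
  qed simp
  moreover have "homologous n s f (contract_y (koszul_det n s nabla) ?e) 1"
  proof -
    let ?L = "residue_ideal q n ?I"
    have L: "poly_ideal ?L"
      by (rule poly_ideal_residue_ideal) (auto intro: gen_ideal_add)
    (* The residue is linear over R[x], so it maps multiples of elements of I to elements of I. *)
    have I_L: "p \<in> ?L" if "p \<in> ?I" "p \<in> polys (X ` {..<n})" for p
    proof -
      have "p \<in> polys (range X)" using that(2) by (rule polys_mono) auto
      then have "y_residue q n (p * h) = y_residue q n h * p" for h
        by (subst y_residue_mult) (simp_all only: mult.commute)
      then show ?thesis using that(1) by (simp add: residue_ideal_def gen_ideal_mult)
    qed
    define \<phi> where "\<phi> = (\<lambda>v. case v of U l \<Rightarrow> if l < n then yx_diff l else 0 | _ \<Rightarrow> (0 :: 'r mpol))"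
    have f_L: "f i \<in> ?L" if "i < s" for i
      using gen_ideal_generator[OF that] assms(1)[OF that] by (rule I_L)
    have nabla: "(\<Sum>l<n. yx_diff l * nabla l i) = swap_poly (f i) - f i" if "i < s" for i
    proof -
      have "(\<Sum>l<n. yx_diff l * nabla l i) = - (\<Sum>l<n. (xvar l - yvar l) * nabla l i)"
        by (simp add: sum_negf[symmetric] xvar_def yvar_def pvar_def left_diff_distrib)
      then show ?thesis by (simp add: assms(3)[OF that])
    qed
    have gy_L: "at_poly (q k) (pvar (Y k)) \<in> ?L" if "k < n" for k
      using q[OF that] by (simp add: residue_ideal_def y_residue_at_poly[OF that])
    have "\<exists>e. ?A - prod_list (map b [0..<n]) - gderiv \<phi> e \<in> coeffs_in ?L (range U)"
    proof (rule prod_list_homotopic[OF L])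
      fix k assume "k \<in> set [0..<n]"
      then have k: "k < n" by simp
      show "homog 1 (a k) \<and> homog 1 (b k)"
        unfolding a_def b_def gconst_commute[of "gvar _"]
        by (intro conjI homog_sum homog_gconst_mult homog_row_form homog_gvar)
      show "gderiv \<phi> (a k) \<in> coeffs_in ?L (range U) \<and> gderiv \<phi> (b k) \<in> coeffs_in ?L (range U)"
        and "\<exists>e. parity_part 0 e = e \<and> a k - b k - gderiv \<phi> e \<in> coeffs_in ?L (range U)"
        unfolding a_def b_def \<phi>_def
        using row_forms_homotopic[OF L f_L nabla k G[OF k] qG[OF k] gy_L[OF k]] by blast+
    qed
    then obtain e where "?A - prod_list (map b [0..<n]) - gderiv \<phi> e \<in> coeffs_in ?L (range U)" ..
    then have "gcoeff (?A - prod_list (map b [0..<n]) - gderiv \<phi> e) (U ` {..<n}) \<in> ?L"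
      by (rule coeffs_inD) auto
    moreover have "gcoeff (gderiv \<phi> e) (U ` {..<n}) = 0"
      by (rule gcoeff_gderiv_eq_zero) (auto simp: \<phi>_def split: avar.split)
    moreover have "gcoeff (prod_list (map b [0..<n])) (U ` {..<n}) =
        (\<Prod>k<n. diff_quotient (q k) (pvar (X k)) (pvar (Y k)))"
      unfolding b_def prod_list_gvar_U_gconst by (simp add: gcoeff_gmono)
    (* At u_1 ... u_n the boundary has no coefficient, so the two determinants agree modulo L. *)
    ultimately have "gcoeff ?A (U ` {..<n}) - (\<Prod>k<n. diff_quotient (q k) (pvar (X k)) (pvar (Y k))) \<in> ?L"
      by simp
    then have "y_residue q n (gcoeff ?A (U ` {..<n}) - (\<Prod>k<n. diff_quotient (q k) (pvar (X k)) (pvar (Y k)))) \<in> ?I"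
      by (rule residue_idealD)
    then have "?p - 1 \<in> ?I"
      using y_residue_diff_quotient[OF q] by (simp add: y_residue_diff)
    moreover have "?p \<in> polys (X ` {..<n})"
    proof -
      let ?V = "X ` {..<n} \<union> Y ` {..<n}"
      have "a k \<in> grassmann_over ?V UNIV" if "k < n" for k
        unfolding a_def row_form_def using assms(2) polys_mono[OF c[OF that], of ?V]
        by (auto intro!: grassmann_over_sum grassmann_over_add grassmann_over_mult grassmann_over_gmono)
      then have "?A \<in> grassmann_over ?V UNIV" by (intro grassmann_over_prod_list) auto
      then have "?p \<in> polys (?V - Y ` {..<n})"
        by (intro y_residue_in_polys) (simp add: grassmann_over_iff)
      then show ?thesis by (rule polys_mono) auto
    qed
    ultimately have "homologous n s f (gconst ?p) 1"
      using assms(1) by (intro homologous_gconst_one)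
    moreover have "contract_y (koszul_det n s nabla) ?e = gconst ?p"
      unfolding \<gamma>_def a_def using assms(2) c by (intro contract_koszul_det)
    ultimately show ?thesis by simp
  qed
  ultimately show ?thesis by (intro bexI[of _ ?e])
qed

end
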